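(* Let $\mathcal{G}=(\mathcal{V},\mathcal{E},A)$ be an undirected connected weighted graph with $\mathcal{V}=\{1,\dots,N\}$ and weighted adjacency matrix $A=[a_{ij}]$. For $i=1,\dots,N$ let $f_i:\mathbb{R}^n\times\mathbb{R}_+\to\mathbb{R}$ and $d_i:\mathbb{R}_+\to\mathbb{R}^n$ satisfy: (1) $f_i$ is twice continuously differentiable with respect to $x$, $\underline{\theta}_i$-strongly convex and $\bar\theta_i$-smooth in $x$ for some positive scalars $\underline{\theta}_i,\bar\theta_i$, i.e. $\underline{\theta}_i I_n\le H_i(x,t)\le\bar\theta_i I_n$ for all $x,t$, where $H_i(x,t)$ is the Hessian of $f_i$ with respect to $x$; (2) $\frac{\partial\nabla f_i(x,t)}{\partial t}$ is measurable with respect to $t$ and $\big\|\frac{\partial\nabla f_i(x,t)}{\partial t}\big\|\le\kappa$ for all $x,t$, for some $\kappa>0$ (common to all $i$); (3) there exists $\varpi>0$ such that for all $i,j\in\{1,\dots,N\}$ and all $x_i,x_j,t$, $\big\|H_i^{-1}(x_i,t)\frac{\partial\nabla f_i(x_i,t)}{\partial t}-H_j^{-1}(x_j,t)\frac{\partial\nabla f_j(x_j,t)}{\partial t}\big\|_1\le\varpi$; (4) there exists $\delta>0$ such that $\|\dot d_i(t)\|\le\delta$ for all $i$ and $t$. For each $i$ let $\varphi_i:\mathbb{R}^n\to\mathbb{R}^n$ be such that the system $\dot z_i=-\varphi_i(z_i)$ is finite-time stable at the origin. Set $\underline\theta=\min_i\underline\theta_i$ and $\bar\theta=\max_i\bar\theta_i$.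 Consider the distributed protocol, for $i=1,\dots,N$, $$\dot\lambda_i=-H_i(x_i,t)\Big(\varphi_i(z_i)-\frac{\partial\nabla g_i(\lambda_i,t)}{\partial t}+\alpha\sum_{j=1}^N a_{ij}\,\mathrm{sgn}(\lambda_i-\lambda_j)\Big),\qquad \dot z_i=-\varphi_i(z_i),$$ $$x_i=x_i(\lambda_i,t)=\arg\sup_{x\in\mathbb{R}^n}\big(\lambda_i^Tx-f_i(x,t)\big),$$ with $z_i(0)=-\nabla g_i(\lambda_i(0),0)=x_i(\lambda_i(0),0)-d_i(0)$ and $$\alpha>\Big(\frac{\kappa}{\underline\theta}+\delta\Big)\sqrt{\frac{N\bar\theta}{\underline\theta\,\lambda_2(B^TB)}}.$$ Then every $z_i(t)$ converges to $0$ in finite time, and then every $x_i(t)=x_i(\lambda_i(t),t)$ tracks in finite time the optimal trajectory $x_i^*(t)$ of the time-varying resource allocation problem $$\min_{x_1,\dots,x_N\in\mathbb{R}^n}\ \sum_{i=1}^N f_i(x_i,t)\quad\text{s.t. }\ \sum_{i=1}^N x_i=d(t),\qquad d(t)=\sum_{i=1}^N d_i(t),$$ i.e. there exists $T<\infty$ such that $\lim_{t\to T}\|x_i(t)-x_i^*(t)\|=0$ for all $i$.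
   Context: $\nabla$ denotes the gradient with respect to the vector argument ($x$ or $\lambda$), $\|\cdot\|$ is the Euclidean norm, $\|\cdot\|_1$ the 1-norm, and $\mathrm{sgn}(\cdot)$ is the componentwise sign function (with $\mathrm{sgn}(0)=0$). The adjacency matrix is symmetric, with $a_{ij}>0$ iff $(j,i)\in\mathcal{E}$ and $a_{ii}=0$. Local dual functions: $g_i(\lambda,t)=\lambda^Td_i(t)-f_i^*(\lambda,t)$, where $f_i^*(\lambda,t)=\sup_{x\in\mathbb{R}^n}(\lambda^Tx-f_i(x,t))$ is the Legendre–Fenchel conjugate in $x$. One has $\nabla g_i(\lambda,t)=d_i(t)-x_i(\lambda,t)$ and $\frac{\partial\nabla g_i(\lambda,t)}{\partial t}=\dot d_i(t)-\frac{\partial x_i(\lambda,t)}{\partial t}$. Weighted incidence matrix: with $m=|\mathcal{E}|$ the number of (undirected) edges, $B_0=[b_{ik}]\in\mathbb{R}^{N\times m}$ is defined by $b_{ik}=-b_{jk}=a_{ij}$ if $i<j$ for each edge $e_k=\{i,j\}\in\mathcal{E}$, all other entries being $0$; and $B=B_0\otimes I_n$. For a positive semidefinite matrix $M$, $\lambda_2(M)$ denotes its smallest positive eigenvalue. Finite-time stability: a system $\dot z=h(z)$ on $\mathbb{R}^n$ is finite-time (FT) stable at the origin if it is Lyapunov stable and there exists a finite settling time $T(z_0)$ such that $\lim_{t\to T(z_0)}z(t;z_0)=0$ and $z(t;z_0)=0$ for all $t\ge T(z_0)$, for any solution starting from $z_0\in\mathcal{X}_0$, where $\mathcal{X}_0$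 is a set of initial states; it is globally FT stable when $\mathcal{X}_0=\mathbb{R}^n$. The initial values $z_i(0)$ are understood to belong to the corresponding sets $\mathcal{X}_0$ (no restriction in the global case). Since the right-hand side of the protocol is discontinuous, solutions are understood in the sense of Filippov (absolutely continuous solutions of the differential inclusion given by the Filippov set-valued map).
   Formalization: Two conditions are added, without which the claim fails for Filippov solutions: each φ_i is locally essentially bounded, and ∂∇f_i(x,t)/∂t is continuous in x for each t (in addition to being measurable in t). *)

theory Defs
  imports "HOL-Analysis.Analysis"
begin

section \<open>Filippov solutions\<close>

definition absolutely_continuous_on :: "real \<Rightarrow> real \<Rightarrow> (real \<Rightarrow> 'a::metric_space) \<Rightarrow> bool" where
  "absolutely_continuous_on a b x \<longleftrightarrow>
     (\<forall>\<epsilon>>0. \<exists>\<delta>>0. \<forall>I :: (real \<times> real) set.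
        finite I \<longrightarrow>
        (\<forall>(u, v)\<in>I. a \<le> u \<and> u \<le> v \<and> v \<le> b) \<longrightarrow>
        disjoint_family_on (\<lambda>(u, v). {u<..<v}) I \<longrightarrow>
        (\<Sum>(u, v)\<in>I. v - u) < \<delta> \<longrightarrow>
        (\<Sum>(u, v)\<in>I. dist (x u) (x v)) < \<epsilon>)"

text \<open>
  The regularisation is with respect to the state only; the time \<open>t\<close> is frozen.
\<close>

definition filippov_map :: "(real \<Rightarrow> 'a \<Rightarrow> 'a) \<Rightarrow> real \<Rightarrow> 'a \<Rightarrow> 'a::euclidean_space set" where
  "filippov_map h t x =
     (\<Inter>r\<in>{0<..}. \<Inter>N\<in>{N. negligible N}. closure (convex hull (h t ` (ball x r - N))))"

definition filippov_solution :: "(real \<Rightarrow> 'a \<Rightarrow> 'a) \<Rightarrow> (real \<Rightarrow> 'a::euclidean_space) \<Rightarrow> bool" where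
  "filippov_solution h x \<longleftrightarrow>
     (\<forall>b\<ge>0. absolutely_continuous_on 0 b x) \<and>
     (AE t in lebesgue. 0 \<le> t \<longrightarrow>
        (\<exists>v. (x has_vector_derivative v) (at t) \<and> v \<in> filippov_map h t (x t)))"

text \<open>
  The standing condition under which Filippov's map is used. For a field that is unbounded
  near \<open>x\<close> (such as \<open>y / \<parallel>y\<parallel>\<^sup>2\<close> near \<open>0\<close>) the sets \<open>closure (convex hull \<dots>)\<close> do not shrink
  with \<open>r\<close> and the inclusion loses the coupling between components of the state.
\<close>

definition locally_essentially_bounded :: "('a::euclidean_space \<Rightarrow> 'b::real_normed_vector) \<Rightarrow> bool" where
  "locally_essentially_bounded h \<longleftrightarrow>
     (\<forall>x. \<exists>r>0. \<exists>M. AE y in lebesgue. y \<in> ball x r \<longrightarrow> norm (h y) \<le> M)"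

definition lyapunov_stable :: "('a \<Rightarrow> 'a::euclidean_space) \<Rightarrow> bool" where
  "lyapunov_stable h \<longleftrightarrow>
     (\<forall>\<epsilon>>0. \<exists>\<delta>>0. \<forall>z. filippov_solution (\<lambda>_. h) z \<and> norm (z 0) < \<delta> \<longrightarrow>
        (\<forall>t\<ge>0. norm (z t) < \<epsilon>))"

text \<open>
  Trajectories live on \<open>[0, \<infinity>)\<close>, hence the filter \<open>at T within {0..}\<close>, which for \<open>T = 0\<close>
  is the one-sided limit.
\<close>

definition vanishes_at :: "(real \<Rightarrow> 'a::real_normed_vector) \<Rightarrow> real \<Rightarrow> bool" where
  "vanishes_at z T \<longleftrightarrow> (z \<longlongrightarrow> 0) (at T within {0..}) \<and> (\<forall>t\<ge>T. z t = 0)"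

definition finite_time_stable :: "('a \<Rightarrow> 'a) \<Rightarrow> 'a::euclidean_space set \<Rightarrow> bool" where
  "finite_time_stable h X0 \<longleftrightarrow>
     lyapunov_stable h \<and>
     (\<forall>z0\<in>X0. \<exists>T\<ge>0. \<forall>z. filippov_solution (\<lambda>_. h) z \<and> z 0 = z0 \<longrightarrow> vanishes_at z T)"


section \<open>Derivatives, conjugates and matrices\<close>

definition gradient :: "('a::euclidean_space \<Rightarrow> real) \<Rightarrow> 'a \<Rightarrow> 'a" where
  "gradient F x = (THE D. GDERIV F x :> D)"

definition hessian :: "(real^'n \<Rightarrow> real) \<Rightarrow> real^'n \<Rightarrow> real^'n^'n" where
  "hessian F x = jacobian (gradient F) (at x)"

definition twice_continuously_differentiable :: "(real^'n \<Rightarrow> real) \<Rightarrow> bool" where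
  "twice_continuously_differentiable F \<longleftrightarrow>
     (\<forall>x. F differentiable (at x)) \<and>
     (\<forall>x. gradient F differentiable (at x)) \<and>
     continuous_on UNIV (hessian F)"

text \<open>Time derivatives are taken on \<open>[0, \<infinity>)\<close>, so they are one-sided at \<open>0\<close>.\<close>

definition time_deriv :: "(real \<Rightarrow> 'a::real_normed_vector) \<Rightarrow> real \<Rightarrow> 'a" where
  "time_deriv w t = vector_derivative w (at t within {0..})"

definition time_gradient :: "('a \<Rightarrow> real \<Rightarrow> real) \<Rightarrow> 'a \<Rightarrow> real \<Rightarrow> 'a::euclidean_space" where
  "time_gradient F x s = gradient (\<lambda>y. F y s) x"

definition fenchel_conjugate :: "('a::real_inner \<Rightarrow> real) \<Rightarrow> 'a \<Rightarrow> real" where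
  "fenchel_conjugate F l = (SUP x. l \<bullet> x - F x)"

definition local_dual :: "('a::real_inner \<Rightarrow> real \<Rightarrow> real) \<Rightarrow> (real \<Rightarrow> 'a) \<Rightarrow> 'a \<Rightarrow> real \<Rightarrow> real" where
  "local_dual F D l t = l \<bullet> D t - fenchel_conjugate (\<lambda>x. F x t) l"

definition primal_response :: "('a::real_inner \<Rightarrow> real \<Rightarrow> real) \<Rightarrow> 'a \<Rightarrow> real \<Rightarrow> 'a" where
  "primal_response F l t = (ARG_MAX (\<lambda>x. l \<bullet> x - F x t) x. True)"

definition norm1 :: "real^'n \<Rightarrow> real" where
  "norm1 v = (\<Sum>p\<in>UNIV. \<bar>v $ p\<bar>)"

text \<open>The library's \<^const>\<open>sgn\<close> on vectors is \<open>v / \<parallel>v\<parallel>\<close>, not the componentwise sign.\<close>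

definition sgn_vec :: "real^'n \<Rightarrow> real^'n" where
  "sgn_vec v = (\<chi> p. sgn (v $ p))"

definition loewner_le :: "real^'n^'n \<Rightarrow> real^'n^'n \<Rightarrow> bool" where
  "loewner_le P Q \<longleftrightarrow> (\<forall>v. v \<bullet> (P *v v) \<le> v \<bullet> (Q *v v))"

definition kronecker :: "real^'b::finite^'a::finite \<Rightarrow> real^'d::finite^'c::finite \<Rightarrow> real^('b \<times> 'd)^('a \<times> 'c)" where
  "kronecker P Q = (\<chi> r s. P $ fst r $ fst s * Q $ snd r $ snd s)"

definition least_positive_eigenvalue :: "real^'k^'k \<Rightarrow> real" where
  "least_positive_eigenvalue M = (LEAST \<mu>. 0 < \<mu> \<and> (\<exists>v. v \<noteq> 0 \<and> M *v v = \<mu> *\<^sub>R v))"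


section \<open>The communication graph\<close>

definition connected_weighted_graph :: "('N::finite \<times> 'N) set \<Rightarrow> real^'N^'N \<Rightarrow> bool" where
  "connected_weighted_graph E A \<longleftrightarrow>
     (\<forall>i j. A $ i $ j = A $ j $ i) \<and>
     (\<forall>i j. 0 \<le> A $ i $ j) \<and>
     (\<forall>i j. 0 < A $ i $ j \<longleftrightarrow> (j, i) \<in> E) \<and>
     (\<forall>i. A $ i $ i = 0) \<and>
     (\<forall>i j. (i, j) \<in> E\<^sup>*)"

text \<open>
  An undirected edge \<open>{i, j}\<close> is represented by the pair \<open>(i, j)\<close> with \<open>i < j\<close>, and
  \<open>e\<close> numbers the edges by the index type \<open>'m\<close>, so that \<open>CARD('m)\<close> is the number of
  undirected edges.
\<close>

definition edge_enumeration :: "('N::linorder \<times> 'N) set \<Rightarrow> ('m \<Rightarrow> 'N \<times> 'N) \<Rightarrow> bool" where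
  "edge_enumeration E e \<longleftrightarrow> bij_betw e UNIV {(i, j). (i, j) \<in> E \<and> i < j}"

definition incidence :: "real^'N^'N \<Rightarrow> ('m \<Rightarrow> 'N \<times> 'N) \<Rightarrow> real^'m^'N" where
  "incidence A e = (\<chi> l k. case e k of (i, j) \<Rightarrow>
     if l = i then A $ i $ j else if l = j then - A $ i $ j else 0)"

definition extended_incidence ::
    "real^'N^'N \<Rightarrow> ('m::finite \<Rightarrow> 'N \<times> 'N) \<Rightarrow> real^('m \<times> 'n::finite)^('N::finite \<times> 'n)" where
  "extended_incidence A e = kronecker (incidence A e) (mat 1 :: real^'n^'n)"


section \<open>The resource allocation problem and the protocol\<close>

definition optimal_allocation ::
    "('N::finite \<Rightarrow> real^'n \<Rightarrow> real \<Rightarrow> real) \<Rightarrow> ('N \<Rightarrow> real \<Rightarrow> real^'n) \<Rightarrow> real \<Rightarrow> (real^'n)^'N" where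
  "optimal_allocation f d t =
     (ARG_MIN (\<lambda>x. \<Sum>i\<in>UNIV. f i (x $ i) t) x. (\<Sum>i\<in>UNIV. x $ i) = (\<Sum>i\<in>UNIV. d i t))"

definition protocol ::
    "('N::finite \<Rightarrow> real^'n \<Rightarrow> real \<Rightarrow> real) \<Rightarrow> ('N \<Rightarrow> real \<Rightarrow> real^'n) \<Rightarrow>
     ('N \<Rightarrow> real^'n \<Rightarrow> real^'n) \<Rightarrow> real^'N^'N \<Rightarrow> real \<Rightarrow>
     real \<Rightarrow> ((real^'n)^'N) \<times> ((real^'n)^'N) \<Rightarrow> ((real^'n)^'N) \<times> ((real^'n)^'N)" where
  "protocol f d \<phi> A \<alpha> t = (\<lambda>(\<Lambda>, Z).
     (\<chi> i. - (hessian (\<lambda>x. f i x t) (primal_response (f i) (\<Lambda> $ i) t) *v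
            (\<phi> i (Z $ i)
             - time_deriv (time_gradient (local_dual (f i) (d i)) (\<Lambda> $ i)) t
             + \<alpha> *\<^sub>R (\<Sum>j\<in>UNIV. A $ i $ j *\<^sub>R sgn_vec (\<Lambda> $ i - \<Lambda> $ j)))),
      \<chi> i. - \<phi> i (Z $ i)))"

end

theory Submission
  imports Defs
begin

text \<open>
  Write \<open>x\<^sub>i\<close> for the response to \<open>\<lambda>\<^sub>i\<close> and \<open>s\<^sub>i = \<Sum>\<^sub>j a\<^sub>i\<^sub>j \<sigma>\<^sub>i\<^sub>j\<close>, where \<open>\<sigma>\<close> is the antisymmetric
  selection of the sign of \<open>\<lambda>\<^sub>i - \<lambda>\<^sub>j\<close> realised by the Filippov velocity. Along a solution
  \<open>x\<^sub>i - d\<^sub>i\<close> moves with velocity \<open>z\<^sub>i' - \<alpha> s\<^sub>i\<close>, and \<open>\<Sum>\<^sub>i s\<^sub>i = 0\<close>, so \<open>\<Sum>\<^sub>i (x\<^sub>i - d\<^sub>i - z\<^sub>i)\<close> keeps its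
  initial value \<open>0\<close>: once \<open>z\<close> has vanished, the \<open>x\<^sub>i\<close> are feasible. From then on
  \<open>\<lambda>\<^sub>i' = H\<^sub>i (p\<^sub>i - \<alpha> s\<^sub>i)\<close> with \<open>\<parallel>p\<^sub>i\<parallel> \<le> \<kappa> / \<theta> + \<delta>\<close>, and the weighted 1-norm disagreement of the \<open>\<lambda>\<^sub>i\<close>
  has derivative \<open>2 \<Sum>\<^sub>i s\<^sub>i \<bullet> \<lambda>\<^sub>i'\<close>. Away from consensus \<open>\<Sum>\<^sub>i \<parallel>s\<^sub>i\<parallel>\<^sup>2\<close> is at least the least positive
  eigenvalue of \<open>B\<^sup>TB\<close>, so by Cauchy-Schwarz in the metric of the \<open>H\<^sub>i\<close> the gain condition bounds
  this derivative by a negative constant and consensus is reached in finite time. Feasible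
  responses to a common \<open>\<lambda>\<close> are optimal.

  The Hessians are not assumed continuous in time. That the responses are nevertheless
  differentiable in \<open>(\<lambda>, t)\<close>, for almost every \<open>t\<close> and all \<open>\<lambda>\<close> at once, rests on a fact about
  arbitrary sets \<open>S\<close> of reals: at almost every \<open>t \<in> S\<close> the distance of \<open>s\<close> to \<open>S\<close> is \<open>o(\<bar>s - t\<bar>)\<close>.
\<close>

section \<open>Absolutely continuous functions and null sets\<close>

text \<open>The Filippov map freezes time and inspects the field at all nearby states, and the field
  contains the time derivative of the dual gradient. Identifying the field at one time therefore
  needs that derivative for every \<lambda>, which is why the exceptional times may not depend on
  \<lambda>. The selection \<sigma> is uncontrolled where two components agree. There the difference
  of the components has derivative zero at almost every time, again by the distance fact, so every
  selection yields the derivative of the absolute value and no nonsmooth chain rule is needed.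
  Absolute continuity enters through its \<epsilon>-\<delta> form only: a gauge argument passes from
  the sign of an almost everywhere derivative to monotonicity without integrating that derivative.
  The eigenvalue bound comes from duality: the edge signs pair with
  \<open>B\<^sup>T \<lambda>\<close> to its 1-norm, which dominates the Euclidean norm, so their
  projection onto the range of \<open>B\<^sup>T\<close> has norm at least 1, and \<open>B\<close>
  sees only that projection.\<close>

lemma ae_infdist_small:
  fixes S :: "real set"
  obtains N where "negligible N"
    and "\<And>t \<epsilon>. t \<in> S \<Longrightarrow> t \<notin> N \<Longrightarrow> 0 < \<epsilon> \<Longrightarrow>
           \<exists>\<delta>>0. \<forall>s. \<bar>s - t\<bar> < \<delta> \<longrightarrow> (\<exists>s'\<in>S. \<bar>s' - s\<bar> \<le> \<epsilon> * \<bar>s - t\<bar>)"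
proof -
  \<comment> \<open>A bad point \<open>t\<close> has, at arbitrarily small distance, some
    \<open>s\<close> whose ball of radius \<open>\<epsilon> * \<bar>s - t\<bar>\<close> misses
    \<open>S\<close>. These gaps also miss \<open>closure S\<close>, which unlike \<open>S\<close>
    is known to be measurable, and they fill a fixed fraction of a ball around
    \<open>t\<close>.\<close>
  define Bad where
    "Bad \<epsilon> = {t\<in>S. \<forall>\<delta>>0. \<exists>s. \<bar>s - t\<bar> < \<delta> \<and> (\<forall>s'\<in>S. \<epsilon> * \<bar>s - t\<bar> < \<bar>s' - s\<bar>)}" for \<epsilon> :: real
  have neg: "negligible (Bad \<epsilon>)" if \<epsilon>: "0 < \<epsilon>" "\<epsilon> \<le> 1" for \<epsilon>
  proof (subst negligible_on_intervals, intro allI)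
    fix a b :: real
    define B where "B = Bad \<epsilon> \<inter> cbox a b"
    define C where "C = closure S \<inter> cbox a b"
    have "compact C"
      unfolding C_def by (intro closed_Int_compact closed_closure compact_cbox)
    then have Cmeas: "C \<in> lmeasurable"
      by (rule lmeasurable_compact)
    have "negligible B"
      unfolding negligible_outer_le
    proof (intro allI impI)
      fix e :: real
      assume "0 < e"
      \<comment> \<open>A ball around \<open>t\<close> has length
        \<open>4 * \<bar>s - t\<bar>\<close> and its gap has length
        \<open>2 * \<epsilon> * \<bar>s - t\<bar>\<close>. With this ratio, gaps of total measure at
        most \<open>e * \<epsilon> / 2\<close> force balls of total measure at most
        \<open>e\<close>.\<close>
      with \<epsilon> have d: "0 < e * \<epsilon> / 2" by simp
      obtain U where U: "open U" "C \<subseteq> U" "U - C \<in> lmeasurable"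
        "emeasure lebesgue (U - C) < ennreal (e * \<epsilon> / 2)"
        using sets_lebesgue_outer_open[OF fmeasurableD[OF Cmeas] d] by metis
      then have mUC: "measure lebesgue (U - C) \<le> e * \<epsilon> / 2"
        by (simp add: emeasure_eq_measure2 ennreal_less_iff)
      \<comment> \<open>The doubled radius leaves room for the gap around \<open>s\<close> inside
        the ball around \<open>t\<close>, so disjoint balls carry disjoint gaps.\<close>
      define K where "K = {(t, s). t \<in> B \<and> s \<noteq> t \<and> ball t (2 * \<bar>s - t\<bar>) \<subseteq> U \<and>
        ball s (\<epsilon> * \<bar>s - t\<bar>) \<inter> S = {}}"
      have "\<exists>i. i \<in> K \<and> x \<in> ball (fst i) (2 * \<bar>snd i - fst i\<bar>) \<and> 2 * \<bar>snd i - fst i\<bar> < r"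
        if x: "x \<in> B" and r: "0 < r" for x r
      proof -
        have "x \<in> U"
          using x U subsetD[OF closure_subset, of x S] by (auto simp: B_def Bad_def C_def)
        then obtain q where q: "q > 0" "ball x q \<subseteq> U"
          using U(1) openE by blast
        have "0 < min (r / 2) (q / 2)" using r q by simp
        then obtain s where s: "\<bar>s - x\<bar> < min (r / 2) (q / 2)" "\<forall>s'\<in>S. \<epsilon> * \<bar>s - x\<bar> < \<bar>s' - s\<bar>"
          using x unfolding B_def Bad_def by blast
        have "s \<noteq> x" using s(2) x by (auto simp: B_def Bad_def)
        moreover have "ball x (2 * \<bar>s - x\<bar>) \<subseteq> U"
          using q s by (auto simp: dist_real_def)
        moreover have "ball s (\<epsilon> * \<bar>s - x\<bar>) \<inter> S = {}"
          using s(2) by (fastforce simp: dist_real_def)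
        ultimately show ?thesis
          using s x by (intro exI[of _ "(x, s)"]) (auto simp: K_def)
      qed
      note cover = this
      obtain I where I: "countable I" "I \<subseteq> K"
        "pairwise (\<lambda>i j. disjnt (ball (fst i) (2 * \<bar>snd i - fst i\<bar>)) (ball (fst j) (2 * \<bar>snd j - fst j\<bar>))) I"
        "negligible (B - (\<Union>i\<in>I. ball (fst i) (2 * \<bar>snd i - fst i\<bar>)))"
        by (rule Vitali_covering_theorem_balls[of B K fst "\<lambda>i. 2 * \<bar>snd i - fst i\<bar>", OF cover])
      define b where "b i = ball (fst i) (2 * \<bar>snd i - fst i\<bar>)" for i :: "real \<times> real"
      define g where "g i = ball (snd i) (\<epsilon> * \<bar>snd i - fst i\<bar>)" for i :: "real \<times> real"
      have gb: "g i \<subseteq> b i" for i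
      proof
        fix x assume "x \<in> g i"
        then have "\<bar>x - snd i\<bar> < \<epsilon> * \<bar>snd i - fst i\<bar>" by (auto simp: g_def dist_real_def)
        also have "\<epsilon> * \<bar>snd i - fst i\<bar> \<le> 1 * \<bar>snd i - fst i\<bar>"
          using \<epsilon> by (intro mult_right_mono) auto
        finally have "\<bar>x - snd i\<bar> < \<bar>snd i - fst i\<bar>" by simp
        then have "\<bar>x - snd i\<bar> + \<bar>snd i - fst i\<bar> < 2 * \<bar>snd i - fst i\<bar>" by simp
        moreover have "\<bar>fst i - x\<bar> \<le> \<bar>x - snd i\<bar> + \<bar>snd i - fst i\<bar>" by linarith
        ultimately show "x \<in> b i" unfolding b_def mem_ball dist_real_def by (rule le_less_trans[rotated])
      qed
      have ball_eq: "measure lebesgue (ball x r) = 2 * r" if "0 \<le> r" for x r :: real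
        using that by (simp add: ball_eq_greaterThanLessThan)
      have fin: "measure lebesgue (\<Union>i\<in>F. b i) \<le> e" if F: "F \<subseteq> I" "finite F" for F
      proof -
        have gUC: "g i \<subseteq> U - C" if "i \<in> F" for i
        proof -
          have i: "i \<in> K" using that F I by auto
          then have "g i \<inter> S = {}" by (auto simp: K_def g_def)
          moreover have "open (g i)" by (simp add: g_def)
          \<comment> \<open>Openness of the gap turns disjointness from \<open>S\<close> into
            disjointness from its closure, which puts the gap into \<open>U - C\<close>.\<close>
          ultimately have "g i \<inter> closure S = {}"
            by (simp add: open_Int_closure_eq_empty)
          moreover have "b i \<subseteq> U" using i by (auto simp: K_def b_def)
          ultimately show ?thesis using gb[of i] unfolding C_def by blast
        qed
        have disj: "pairwise (\<lambda>i j. disjnt (g i) (g j)) F"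
          using pairwise_subset[OF I(3) F(1)] gb
          unfolding pairwise_def b_def[symmetric] disjnt_def by blast
        have "measure lebesgue (\<Union>i\<in>F. b i) \<le> (\<Sum>i\<in>F. measure lebesgue (b i))"
          by (rule measure_UNION_le) (auto simp: F b_def)
        also have "\<dots> = (\<Sum>i\<in>F. 2 / \<epsilon> * measure lebesgue (g i))"
        proof (intro sum.cong refl)
          fix i
          have "measure lebesgue (b i) = 2 * (2 * \<bar>snd i - fst i\<bar>)"
            "measure lebesgue (g i) = 2 * (\<epsilon> * \<bar>snd i - fst i\<bar>)"
            unfolding b_def g_def by (rule ball_eq, use \<epsilon> in simp)+
          then show "measure lebesgue (b i) = 2 / \<epsilon> * measure lebesgue (g i)"
            using \<epsilon> by simp
        qed
        also have "\<dots> = 2 / \<epsilon> * measure lebesgue (\<Union>i\<in>F. g i)"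
          unfolding sum_distrib_left[symmetric]
          by (subst measure_UNION') (auto simp: F disj, simp add: g_def)
        also have "\<dots> \<le> 2 / \<epsilon> * (e * \<epsilon> / 2)"
        proof (rule mult_left_mono)
          have "measure lebesgue (\<Union>i\<in>F. g i) \<le> measure lebesgue (U - C)"
            using gUC by (intro measure_mono_fmeasurable) (auto simp: U g_def F)
          with mUC show "measure lebesgue (\<Union>i\<in>F. g i) \<le> e * \<epsilon> / 2" by simp
        qed (use \<epsilon> in auto)
        finally show ?thesis using \<epsilon> by simp
      qed
      have bl: "b i \<in> lmeasurable" for i by (simp add: b_def)
      note bound = fmeasurable_UN_bound[OF I(1) bl fin] measure_UN_bound[OF I(1) bl fin]
      have neg: "negligible (B - (\<Union>i\<in>I. b i))"
        using I(4) by (simp add: b_def)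
      show "\<exists>T. B \<subseteq> T \<and> T \<in> lmeasurable \<and> measure lebesgue T \<le> e"
      proof (intro exI conjI)
        show "B \<subseteq> (B - (\<Union>i\<in>I. b i)) \<union> (\<Union>i\<in>I. b i)" by auto
        show "(B - (\<Union>i\<in>I. b i)) \<union> (\<Union>i\<in>I. b i) \<in> lmeasurable"
          using neg bound(1) by (intro fmeasurable.Un) (auto simp: negligible_imp_measurable)
        have "measure lebesgue ((B - (\<Union>i\<in>I. b i)) \<union> (\<Union>i\<in>I. b i)) \<le>
          measure lebesgue (B - (\<Union>i\<in>I. b i)) + measure lebesgue (\<Union>i\<in>I. b i)"
          using neg bound(1) by (intro measure_Un_le) (auto simp: negligible_imp_sets)
        also have "\<dots> \<le> e" using neg bound(2) by (simp add: negligible_imp_measure0)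
        finally show "measure lebesgue ((B - (\<Union>i\<in>I. b i)) \<union> (\<Union>i\<in>I. b i)) \<le> e" .
      qed
    qed
    then show "negligible (Bad \<epsilon> \<inter> cbox a b)" by (simp add: B_def)
  qed
  show thesis
  proof
    show "negligible (\<Union>n. Bad (1 / Suc n))"
      by (intro negligible_Union_nat neg) auto
    fix t \<epsilon> :: real
    assume t: "t \<in> S" "t \<notin> (\<Union>n. Bad (1 / Suc n))" and "0 < \<epsilon>"
    then obtain n where n: "1 / Suc n < \<epsilon>"
      using nat_approx_posE by blast
    obtain \<delta> where \<delta>: "\<delta> > 0" "\<And>s. \<bar>s - t\<bar> < \<delta> \<Longrightarrow> \<exists>s'\<in>S. \<bar>s' - s\<bar> \<le> 1 / Suc n * \<bar>s - t\<bar>"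
    proof -
      have "t \<notin> Bad (1 / Suc n)" using t(2) by blast
      then have "\<exists>\<delta>>0. \<forall>s. \<bar>s - t\<bar> < \<delta> \<longrightarrow> (\<exists>s'\<in>S. \<bar>s' - s\<bar> \<le> 1 / Suc n * \<bar>s - t\<bar>)"
        using t(1) unfolding Bad_def mem_Collect_eq not_less[symmetric] by blast
      then show thesis using that by blast
    qed
    have "1 / Suc n * \<bar>s - t\<bar> \<le> \<epsilon> * \<bar>s - t\<bar>" for s
      using n by (intro mult_right_mono) auto
    then have "\<exists>s'\<in>S. \<bar>s' - s\<bar> \<le> \<epsilon> * \<bar>s - t\<bar>" if "\<bar>s - t\<bar> < \<delta>" for s
      using \<delta>(2)[OF that] order_trans by blast
    with \<delta>(1) show "\<exists>\<delta>>0. \<forall>s. \<bar>s - t\<bar> < \<delta> \<longrightarrow> (\<exists>s'\<in>S. \<bar>s' - s\<bar> \<le> \<epsilon> * \<bar>s - t\<bar>)"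
      by blast
  qed
qed

section \<open>Absolute continuity and monotonicity from almost everywhere derivatives\<close>

lemma absolutely_continuous_on_subinterval:
  assumes "absolutely_continuous_on a b x" "a \<le> c" "d \<le> b"
  shows "absolutely_continuous_on c d x"
  unfolding absolutely_continuous_on_def
proof (intro allI impI)
  fix \<epsilon> :: real assume "0 < \<epsilon>"
  then obtain \<delta> where \<delta>: "\<delta> > 0" and H: "\<And>I :: (real \<times> real) set. finite I \<Longrightarrow>
        (\<forall>(u, v)\<in>I. a \<le> u \<and> u \<le> v \<and> v \<le> b) \<Longrightarrow>
        disjoint_family_on (\<lambda>(u, v). {u<..<v}) I \<Longrightarrow>
        (\<Sum>(u, v)\<in>I. v - u) < \<delta> \<Longrightarrow> (\<Sum>(u, v)\<in>I. dist (x u) (x v)) < \<epsilon>"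
    using assms(1) unfolding absolutely_continuous_on_def by meson
  show "\<exists>\<delta>>0. \<forall>I :: (real \<times> real) set. finite I \<longrightarrow>
        (\<forall>(u, v)\<in>I. c \<le> u \<and> u \<le> v \<and> v \<le> d) \<longrightarrow>
        disjoint_family_on (\<lambda>(u, v). {u<..<v}) I \<longrightarrow>
        (\<Sum>(u, v)\<in>I. v - u) < \<delta> \<longrightarrow> (\<Sum>(u, v)\<in>I. dist (x u) (x v)) < \<epsilon>"
    using \<delta> assms(2,3) by (intro exI[of _ \<delta>] conjI allI impI H) fastforce+
qed

text \<open>The term \<open>v - u\<close> admits an explicit Lipschitz dependence of
  \<open>w\<close> on time besides the dependence through the trajectory \<open>X\<close>.\<close>

lemma absolutely_continuous_on_dominated:
  assumes X: "absolutely_continuous_on a b X"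
    and C: "0 \<le> C"
    and w: "\<And>u v. a \<le> u \<Longrightarrow> u \<le> v \<Longrightarrow> v \<le> b \<Longrightarrow> dist (w u) (w v) \<le> C * (dist (X u) (X v) + (v - u))"
  shows "absolutely_continuous_on a b w"
  unfolding absolutely_continuous_on_def
proof (intro allI impI)
  fix \<epsilon> :: real assume "0 < \<epsilon>"
  \<comment> \<open>The increments of \<open>X\<close> and the interval lengths each sum to less
    than \<open>\<eta>\<close>. The factor \<open>C + 1\<close> keeps the last inequality strict
    when \<open>C = 0\<close>.\<close>
  define \<eta> where "\<eta> = \<epsilon> / (2 * (C + 1))"
  have \<eta>: "0 < \<eta>" using \<open>0 < \<epsilon>\<close> C by (auto simp: \<eta>_def intro!: divide_pos_pos)
  then obtain \<delta> where \<delta>: "\<delta> > 0" and H: "\<And>I :: (real \<times> real) set. finite I \<Longrightarrow>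
        (\<forall>(u, v)\<in>I. a \<le> u \<and> u \<le> v \<and> v \<le> b) \<Longrightarrow>
        disjoint_family_on (\<lambda>(u, v). {u<..<v}) I \<Longrightarrow>
        (\<Sum>(u, v)\<in>I. v - u) < \<delta> \<Longrightarrow> (\<Sum>(u, v)\<in>I. dist (X u) (X v)) < \<eta>"
    using X unfolding absolutely_continuous_on_def by meson
  show "\<exists>\<delta>>0. \<forall>I :: (real \<times> real) set. finite I \<longrightarrow>
        (\<forall>(u, v)\<in>I. a \<le> u \<and> u \<le> v \<and> v \<le> b) \<longrightarrow>
        disjoint_family_on (\<lambda>(u, v). {u<..<v}) I \<longrightarrow>
        (\<Sum>(u, v)\<in>I. v - u) < \<delta> \<longrightarrow> (\<Sum>(u, v)\<in>I. dist (w u) (w v)) < \<epsilon>"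
  proof (intro exI[of _ "min \<delta> \<eta>"] conjI allI impI)
    fix I :: "(real \<times> real) set"
    assume I: "finite I" "\<forall>(u, v)\<in>I. a \<le> u \<and> u \<le> v \<and> v \<le> b"
      "disjoint_family_on (\<lambda>(u, v). {u<..<v}) I" "(\<Sum>(u, v)\<in>I. v - u) < min \<delta> \<eta>"
    have "(\<Sum>(u, v)\<in>I. dist (w u) (w v)) \<le> (\<Sum>(u, v)\<in>I. C * (dist (X u) (X v) + (v - u)))"
      using I(2) by (intro sum_mono) (auto intro!: w)
    also have "\<dots> = C * ((\<Sum>(u, v)\<in>I. dist (X u) (X v)) + (\<Sum>(u, v)\<in>I. v - u))"
      by (simp add: sum_distrib_left sum.distrib[symmetric] case_prod_unfold)
    also have "\<dots> \<le> C * (\<eta> + \<eta>)"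
      using H[OF I(1-3)] I(4) C by (intro mult_left_mono add_mono) auto
    also have "\<dots> < (C + 1) * (\<eta> + \<eta>)"
      using \<eta> by (intro mult_strict_right_mono) auto
    also have "\<dots> = 2 * (C + 1) * \<eta>" by simp
    also have "\<dots> = \<epsilon>" using C by (simp add: \<eta>_def)
    finally show "(\<Sum>(u, v)\<in>I. dist (w u) (w v)) < \<epsilon>" .
  qed (use \<delta> \<eta> in auto)
qed

text \<open>A fine tagged division splits \<open>u b - u a\<close> into two sums. Pieces tagged at
  points of differentiability grow with slope at most \<open>\<epsilon>\<close>. Pieces tagged in
  the null set lie in an open set of measure below \<open>\<delta>\<close>, so absolute continuity
  bounds their total growth by \<open>\<epsilon>\<close>.\<close>

lemma absolutely_continuous_on_nonincreasing:
  fixes u :: "real \<Rightarrow> real"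
  assumes ab: "a \<le> b" and ac: "absolutely_continuous_on a b u" and N: "negligible N"
    and der: "\<And>t. a < t \<Longrightarrow> t < b \<Longrightarrow> t \<notin> N \<Longrightarrow> \<exists>D\<le>0. (u has_real_derivative D) (at t)"
  shows "u b \<le> u a"
proof (rule field_le_epsilon)
  fix e :: real
  assume e: "0 < e"
  \<comment> \<open>The good pieces contribute \<open>\<epsilon> * (b - a)\<close> and the
    exceptional ones \<open>\<epsilon>\<close>.\<close>
  define \<epsilon> where "\<epsilon> = e / (b - a + 1)"
  have \<epsilon>: "0 < \<epsilon>" using e ab by (simp add: \<epsilon>_def)
  obtain \<delta> where \<delta>: "\<delta> > 0" and H: "\<And>I :: (real \<times> real) set. finite I \<Longrightarrow>
        (\<forall>(u, v)\<in>I. a \<le> u \<and> u \<le> v \<and> v \<le> b) \<Longrightarrow>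
        disjoint_family_on (\<lambda>(u, v). {u<..<v}) I \<Longrightarrow>
        (\<Sum>(u, v)\<in>I. v - u) < \<delta> \<Longrightarrow> (\<Sum>(x, y)\<in>I. dist (u x) (u y)) < \<epsilon>"
    using ac \<epsilon> unfolding absolutely_continuous_on_def by meson
  \<comment> \<open>The derivative is known in the open interval only, so tags at the endpoints are
    treated as exceptional.\<close>
  define N' where "N' = N \<union> {a, b}"
  have N': "negligible N'" using N by (simp add: N'_def)
  obtain T where T: "open T" "N' \<subseteq> T" "T - N' \<in> lmeasurable" "emeasure lebesgue (T - N') < ennreal \<delta>"
    using sets_lebesgue_outer_open[OF negligible_imp_sets[OF N'] \<delta>] by metis
  have Teq: "T = (T - N') \<union> N'" using T(2) by auto
  have Tm: "T \<in> lmeasurable"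
    by (subst Teq) (intro fmeasurable.Un T(3) negligible_imp_measurable N')
  have "measure lebesgue T \<le> measure lebesgue (T - N') + measure lebesgue N'"
    by (subst Teq) (intro measure_Un_le fmeasurableD T(3) negligible_imp_measurable N')
  also have "\<dots> < \<delta>"
    using T(3,4) \<delta> negligible_imp_measure0[OF N']
    by (simp add: emeasure_eq_measure2 ennreal_less_iff)
  finally have mT: "measure lebesgue T < \<delta>" .
  \<comment> \<open>The increment is controlled on each side of the tag separately, because a piece
    of the division is split at its tag.\<close>
  have "\<exists>r>0. \<forall>y. \<bar>y - t\<bar> < r \<longrightarrow> (t \<le> y \<longrightarrow> u y - u t \<le> \<epsilon> * (y - t)) \<and> (y \<le> t \<longrightarrow> u t - u y \<le> \<epsilon> * (t - y))"
    if t: "a < t" "t < b" "t \<notin> N'" for t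
  proof -
    obtain D where D: "D \<le> 0" "(u has_real_derivative D) (at t)"
      using der t by (auto simp: N'_def)
    then obtain r where r: "r > 0" "\<And>y. \<bar>y - t\<bar> < r \<Longrightarrow> \<bar>u y - u t - D * (y - t)\<bar> \<le> \<epsilon> * \<bar>y - t\<bar>"
      using \<epsilon> unfolding has_field_derivative_def has_derivative_at_alt by (force simp: )
    have "(t \<le> y \<longrightarrow> u y - u t \<le> \<epsilon> * (y - t)) \<and> (y \<le> t \<longrightarrow> u t - u y \<le> \<epsilon> * (t - y))" if "\<bar>y - t\<bar> < r" for y
    proof (intro conjI impI)
      assume "t \<le> y"
      then have "D * (y - t) \<le> 0" using D(1) by (simp add: mult_nonpos_nonneg)
      with r(2)[OF that] \<open>t \<le> y\<close> show "u y - u t \<le> \<epsilon> * (y - t)" by auto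
    next
      assume "y \<le> t"
      then have "0 \<le> D * (y - t)" using D(1) by (simp add: mult_nonpos_nonpos)
      with r(2)[OF that] \<open>y \<le> t\<close> show "u t - u y \<le> \<epsilon> * (t - y)" by auto
    qed
    with r(1) show ?thesis by blast
  qed
  then have "\<forall>t. \<exists>r. a < t \<longrightarrow> t < b \<longrightarrow> t \<notin> N' \<longrightarrow> 0 < r \<and> (\<forall>y. \<bar>y - t\<bar> < r \<longrightarrow>
      (t \<le> y \<longrightarrow> u y - u t \<le> \<epsilon> * (y - t)) \<and> (y \<le> t \<longrightarrow> u t - u y \<le> \<epsilon> * (t - y)))"
    by blast
  then obtain r where "\<forall>t. a < t \<longrightarrow> t < b \<longrightarrow> t \<notin> N' \<longrightarrow> 0 < r t \<and> (\<forall>y. \<bar>y - t\<bar> < r t \<longrightarrow>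
      (t \<le> y \<longrightarrow> u y - u t \<le> \<epsilon> * (y - t)) \<and> (y \<le> t \<longrightarrow> u t - u y \<le> \<epsilon> * (t - y)))"
    by (rule choice[THEN exE])
  then have r: "\<And>t. a < t \<Longrightarrow> t < b \<Longrightarrow> t \<notin> N' \<Longrightarrow> 0 < r t"
    "\<And>t y. a < t \<Longrightarrow> t < b \<Longrightarrow> t \<notin> N' \<Longrightarrow> \<bar>y - t\<bar> < r t \<Longrightarrow> t \<le> y \<Longrightarrow> u y - u t \<le> \<epsilon> * (y - t)"
    "\<And>t y. a < t \<Longrightarrow> t < b \<Longrightarrow> t \<notin> N' \<Longrightarrow> \<bar>y - t\<bar> < r t \<Longrightarrow> y \<le> t \<Longrightarrow> u t - u y \<le> \<epsilon> * (t - y)"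
    by blast+
  \<comment> \<open>Exceptional tags get the whole open set \<open>T\<close> as neighbourhood, so
    their pieces are contained in it. The last branch concerns points outside the interval and only
    completes the gauge.\<close>
  define g where "g t = (if t \<in> N' then T else if a < t \<and> t < b then ball t (r t) else ball t 1)" for t
  have "gauge g"
    using T r(1) by (auto simp: gauge_def g_def)
  then obtain p where p: "p tagged_division_of {a..b}" "g fine p"
    using fine_division_exists_real by blast
  note pd = tagged_division_ofD[OF p(1)]
  have K: "Inf K \<le> x \<and> x \<le> Sup K \<and> a \<le> Inf K \<and> Sup K \<le> b \<and> K = {Inf K..Sup K} \<and> K \<subseteq> g x"
    if "(x, K) \<in> p" for x K
  proof -
    have "\<exists>c d. K = {c..d}" using pd(4)[OF that] by auto
    then obtain c d where cd: "K = {c..d}" by blast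
    moreover have "x \<in> K" "K \<subseteq> {a..b}" "K \<subseteq> g x"
      using pd(2,3)[OF that] fineD[OF p(2) that] by auto
    ultimately show ?thesis by (auto simp: cInf_atLeastAtMost cSup_atLeastAtMost)
  qed
  define q where "q = {k \<in> p. fst k \<in> N'}"
  have "finite p" by (rule pd(1))
  have good: "(case k of (x, K) \<Rightarrow> u (Sup K) - u (Inf K)) \<le> (case k of (x, K) \<Rightarrow> \<epsilon> * (Sup K - Inf K))"
    if "k \<in> p - q" for k
  proof -
    obtain x K where k: "k = (x, K)" by (cases k)
    have xK: "(x, K) \<in> p" "x \<notin> N'" using that k by (auto simp: q_def)
    have x: "a < x" "x < b"
      using K[OF xK(1)] xK(2) by (auto simp: N'_def less_le)
    have "K \<subseteq> ball x (r x)" using K[OF xK(1)] xK x by (simp add: g_def)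
    moreover have "Inf K \<in> K" "Sup K \<in> K" using K[OF xK(1)] by (metis atLeastAtMost_iff order_refl order_trans)+
    ultimately have "\<bar>Inf K - x\<bar> < r x" "\<bar>Sup K - x\<bar> < r x"
      by (auto simp: dist_real_def abs_minus_commute)
    then have "u (Sup K) - u x \<le> \<epsilon> * (Sup K - x)" "u x - u (Inf K) \<le> \<epsilon> * (x - Inf K)"
      using r(2)[OF x xK(2)] r(3)[OF x xK(2)] K[OF xK(1)] by auto
    then show ?thesis by (simp add: k algebra_simps)
  qed
  define J where "J = (\<lambda>(x, K). (Inf K, Sup K)) ` q"
  \<comment> \<open>Absolute continuity is stated for sets of intervals, while pieces with different
    tags could share their endpoints. This happens only for degenerate pieces, whose terms are zero,
    so the reindexed sum loses nothing.\<close>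
  have Jinj: "Inf K = Sup K" if "(x, K) \<in> q" "(y, L) \<in> q" "(x, K) \<noteq> (y, L)" "Inf K = Inf L" "Sup K = Sup L"
    for x y :: real and K L :: "real set"
  proof -
    have "(x, K) \<in> p" "(y, L) \<in> p" using that by (auto simp: q_def)
    moreover from this have "K = L" using K that by metis
    moreover have "interior K \<inter> interior L = {}"
      using pd(5) calculation that by blast
    ultimately have "interior {Inf K..Sup K} = {}" using K by (metis inf.idem)
    then have "{Inf K<..<Sup K} = {}" by (simp only: interior_atLeastAtMost_real)
    then have "Sup K \<le> Inf K" by simp
    with K[OF \<open>(x, K) \<in> p\<close>] show ?thesis by linarith
  qed
  have "finite J" using \<open>finite p\<close> by (auto simp: J_def q_def)
  have Jab: "\<forall>(x, y)\<in>J. a \<le> x \<and> x \<le> y \<and> y \<le> b"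
    using K by (fastforce simp: J_def q_def)
  have Jdisj: "disjoint_family_on (\<lambda>(x, y). {x<..<y}) J"
    unfolding disjoint_family_on_def
  proof (intro ballI impI)
    fix m n assume "m \<in> J" "n \<in> J" "m \<noteq> n"
    then obtain x K y L where k: "(x, K) \<in> p" "(y, L) \<in> p" "m = (Inf K, Sup K)" "n = (Inf L, Sup L)"
      by (auto simp: J_def q_def)
    with \<open>m \<noteq> n\<close> have "interior K \<inter> interior L = {}"
      using pd(5) by blast
    moreover have "interior K = {Inf K<..<Sup K}" "interior L = {Inf L<..<Sup L}"
      using K[OF k(1)] K[OF k(2)] interior_atLeastAtMost_real by metis+
    ultimately show "(case m of (x, y) \<Rightarrow> {x<..<y}) \<inter> (case n of (x, y) \<Rightarrow> {x<..<y}) = {}"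
      using k by simp
  qed
  have Ioo: "{x<..<y} \<in> lmeasurable" for x y :: real
    using lmeasurable_box[of x y] by simp
  have "(\<Sum>(x, y)\<in>J. y - x) = (\<Sum>m\<in>J. measure lebesgue (case m of (x, y) \<Rightarrow> {x<..<y}))"
    using Jab by (intro sum.cong) auto
  also have "\<dots> = measure lebesgue (\<Union>m\<in>J. case m of (x, y) \<Rightarrow> {x<..<y})"
    by (rule measure_finite_Union[symmetric]) (use \<open>finite J\<close> Jdisj fmeasurableD2[OF Ioo] in \<open>auto simp: split_def\<close>)
  also have "\<dots> \<le> measure lebesgue T"
  proof (rule measure_mono_fmeasurable)
    show "(\<Union>m\<in>J. case m of (x, y) \<Rightarrow> {x<..<y}) \<subseteq> T"
    proof (clarsimp simp: J_def q_def)
      fix x K s assume "(x, K) \<in> p" "x \<in> N'" "Inf K < s" "s < Sup K"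
      then show "s \<in> T" using K[of x K] by (metis atLeastAtMost_iff g_def less_imp_le subsetD)
    qed
  qed (use \<open>finite J\<close> in \<open>auto simp: Tm intro!: sets.finite_UN\<close>)
  finally have "(\<Sum>(x, y)\<in>J. y - x) < \<delta>" using mT by simp
  then have Jsmall: "(\<Sum>(x, y)\<in>J. dist (u x) (u y)) < \<epsilon>"
    by (rule H[OF \<open>finite J\<close> Jab Jdisj])
  have "(\<Sum>(x, y)\<in>J. dist (u x) (u y)) = (\<Sum>k\<in>q. (case k of (x, K) \<Rightarrow> dist (u (Inf K)) (u (Sup K))))"
    unfolding J_def
  proof (subst sum.reindex_nontrivial)
    fix k l assume k: "k \<in> q" "l \<in> q" "k \<noteq> l"
      and eq: "(case k of (x, K) \<Rightarrow> (Inf K, Sup K)) = (case l of (x, K) \<Rightarrow> (Inf K, Sup K))"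
    have "Inf (snd k) = Sup (snd k)"
      using Jinj[of "fst k" "snd k" "fst l" "snd l"] k eq by (simp add: split_def)
    then show "(case case k of (x, K) \<Rightarrow> (Inf K, Sup K) of (x, y) \<Rightarrow> dist (u x) (u y)) = 0"
      by (simp add: split_def)
  qed (use \<open>finite p\<close> in \<open>auto simp: q_def intro!: sum.cong\<close>)
  moreover have "(\<Sum>k\<in>q. (case k of (x, K) \<Rightarrow> u (Sup K) - u (Inf K))) \<le>
      (\<Sum>k\<in>q. (case k of (x, K) \<Rightarrow> dist (u (Inf K)) (u (Sup K))))"
    by (intro sum_mono) (auto simp: dist_real_def)
  ultimately have bad: "(\<Sum>k\<in>q. (case k of (x, K) \<Rightarrow> u (Sup K) - u (Inf K))) \<le> \<epsilon>"
    using Jsmall by linarith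
  have "u b - u a = (\<Sum>(x, K)\<in>p. u (Sup K) - u (Inf K))"
    using additive_tagged_division_1[OF ab p(1), of u] by simp
  also have "\<dots> = (\<Sum>(x, K)\<in>p - q. u (Sup K) - u (Inf K)) + (\<Sum>(x, K)\<in>q. u (Sup K) - u (Inf K))"
    by (rule sum.subset_diff) (use \<open>finite p\<close> in \<open>auto simp: q_def\<close>)
  also have "\<dots> \<le> (\<Sum>(x, K)\<in>p - q. \<epsilon> * (Sup K - Inf K)) + \<epsilon>"
    by (intro add_mono sum_mono good bad)
  also have "(\<Sum>(x, K)\<in>p - q. \<epsilon> * (Sup K - Inf K)) \<le> (\<Sum>(x, K)\<in>p. \<epsilon> * (Sup K - Inf K))"
  proof (rule sum_mono2)
    fix k assume "k \<in> p - (p - q)"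
    then have "Inf (snd k) \<le> Sup (snd k)" using K[of "fst k" "snd k"] by simp
    then show "0 \<le> (case k of (x, K) \<Rightarrow> \<epsilon> * (Sup K - Inf K))" using \<epsilon> by (simp add: split_def)
  qed (use \<open>finite p\<close> in auto)
  also have "\<dots> = \<epsilon> * (b - a)"
    using additive_tagged_division_1[OF ab p(1), of "\<lambda>x. x"]
    by (simp add: sum_distrib_left[symmetric] split_def)
  finally have "u b - u a \<le> \<epsilon> * (b - a + 1)" by (simp add: algebra_simps)
  also have "\<dots> = e" using ab by (simp add: \<epsilon>_def)
  finally show "u b \<le> u a + e" by simp
qed

lemma absolutely_continuous_on_growth_bound:
  fixes u :: "real \<Rightarrow> real"
  assumes ab: "a \<le> b" and ac: "absolutely_continuous_on a b u" and N: "negligible N"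
    and der: "\<And>t. a < t \<Longrightarrow> t < b \<Longrightarrow> t \<notin> N \<Longrightarrow> \<exists>D\<le>c. (u has_real_derivative D) (at t)"
  shows "u b \<le> u a + c * (b - a)"
proof -
  have "absolutely_continuous_on a b (\<lambda>t. u t - c * t)"
  proof (rule absolutely_continuous_on_dominated[OF ac])
    fix x y assume "a \<le> x" "x \<le> y" "y \<le> b"
    have "dist (u x - c * x) (u y - c * y) \<le> dist (u x) (u y) + \<bar>c\<bar> * (y - x)"
    proof -
      have "\<bar>c * (y - x)\<bar> = \<bar>c\<bar> * (y - x)" "c * (y - x) = c * y - c * x"
        using \<open>x \<le> y\<close> by (simp_all add: abs_mult) (simp add: right_diff_distrib)
      then show ?thesis unfolding dist_real_def by linarith
    qed
    also have "\<dots> \<le> (1 + \<bar>c\<bar>) * dist (u x) (u y) + (1 + \<bar>c\<bar>) * (y - x)"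
      using \<open>x \<le> y\<close> by (intro add_mono) (auto simp: algebra_simps)
    finally show "dist (u x - c * x) (u y - c * y) \<le> (1 + \<bar>c\<bar>) * (dist (u x) (u y) + (y - x))"
      by (simp add: algebra_simps)
  qed auto
  then have "u b - c * b \<le> u a - c * a"
  proof (rule absolutely_continuous_on_nonincreasing[OF ab _ N])
    fix t assume "a < t" "t < b" "t \<notin> N"
    then obtain D where "D \<le> c" "(u has_real_derivative D) (at t)" using der by blast
    then show "\<exists>D\<le>0. ((\<lambda>t. u t - c * t) has_real_derivative D) (at t)"
      by (intro exI[of _ "D - c"]) (auto intro!: derivative_eq_intros)
  qed
  then show ?thesis by (simp add: algebra_simps)
qed

text \<open>Average over \<open>u\<close> in the unit cube \<open>Q\<close>, which has measure 1:
  translating the preimage by \<open>g u\<close> turns its measure into the integral over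
  \<open>y\<close> of the indicator of \<open>B\<close> at \<open>f y + u\<close>. After exchanging
  the integrals, the inner one is at most the measure of \<open>B\<close>, which is zero. This
  argument needs no choice of coordinates along the kernel of \<open>f\<close>.\<close>

lemma negligible_vimage_linear_surjection:
  fixes f :: "'a::euclidean_space \<Rightarrow> 'b::euclidean_space"
  assumes f: "linear f" and g: "linear g" and fg: "\<And>u. f (g u) = u" and N: "negligible N"
  shows "negligible (f -` N)"
proof -
  obtain B where B: "B \<in> null_sets lborel" "N \<subseteq> B"
    using N unfolding negligible_iff_null_sets null_sets_completion_iff2 by auto
  have Bs[measurable]: "B \<in> sets borel" using B by auto
  have [measurable]: "f \<in> borel_measurable borel" "g \<in> borel_measurable borel"
    using f g by (auto intro!: borel_measurable_continuous_onI linear_continuous_on linear_conv_bounded_linear[THEN iffD1])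
  have P[measurable]: "f -` B \<in> sets borel"
    using measurable_sets_borel[of f borel B] by simp
  define Q where "Q = cbox (0::'b) One"
  have [measurable]: "Q \<in> sets borel" by (simp add: Q_def)
  have Q1: "emeasure lborel Q = 1" by (simp add: Q_def emeasure_lborel_cbox_eq inner_diff_left)
  have shift: "(\<integral>\<^sup>+ u. indicator A (c + u) \<partial>lborel) = emeasure lborel A" if [measurable]: "A \<in> sets borel" for A and c :: "'c::euclidean_space"
  proof -
    have "emeasure lborel A = (\<integral>\<^sup>+ u. indicator A u \<partial>distr lborel borel ((+) c))"
      by (subst lborel_distr_plus) simp
    also have "\<dots> = (\<integral>\<^sup>+ u. indicator A (c + u) \<partial>lborel)"
      by (subst nn_integral_distr) auto
    finally show ?thesis by simp
  qed
  have "emeasure lborel (f -` B) = (\<integral>\<^sup>+ u. indicator Q u * emeasure lborel (f -` B) \<partial>lborel)"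
    by (subst nn_integral_multc) (auto simp: Q1)
  also have "\<dots> = (\<integral>\<^sup>+ u. (\<integral>\<^sup>+ y. indicator Q u * indicator B (f y + u) \<partial>lborel) \<partial>lborel)"
  proof (rule nn_integral_cong)
    fix u
    have "(\<integral>\<^sup>+ y. indicator Q u * indicator B (f y + u) \<partial>lborel) =
      indicator Q u * (\<integral>\<^sup>+ y. indicator (f -` B) (g u + y) \<partial>lborel)"
      by (subst nn_integral_cmult[symmetric]) (auto simp: indicator_def linear_add[OF f] fg add.commute intro!: nn_integral_cong)
    then show "indicator Q u * emeasure lborel (f -` B) = (\<integral>\<^sup>+ y. indicator Q u * indicator B (f y + u) \<partial>lborel)"
      by (simp add: shift)
  qed
  also have "\<dots> = (\<integral>\<^sup>+ y. (\<integral>\<^sup>+ u. indicator Q u * indicator B (f y + u) \<partial>lborel) \<partial>lborel)"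
    by (rule lborel_pair.Fubini') measurable
  also have "\<dots> \<le> (\<integral>\<^sup>+ y. (\<integral>\<^sup>+ u. indicator B (f y + u) \<partial>lborel) \<partial>lborel)"
    by (intro nn_integral_mono) (auto simp: indicator_def)
  also have "\<dots> = 0"
    using null_setsD1[OF B(1)] by (simp add: shift)
  finally have "f -` B \<in> null_sets lborel" by auto
  moreover have "f -` N \<subseteq> f -` B" using B by auto
  ultimately show ?thesis
    unfolding negligible_iff_null_sets null_sets_completion_iff2 by blast
qed

section \<open>Strongly convex functions\<close>

lemma has_derivative_gradient:
  assumes "F differentiable (at x)"
  shows "(F has_derivative (\<lambda>h. h \<bullet> gradient F x)) (at x)"
proof -
  obtain D where D: "(F has_derivative D) (at x)"
    using assms by (auto simp: differentiable_def)
  have "linear D" using D by (rule has_derivative_linear)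
  \<comment> \<open>\<open>adjoint D 1\<close> is the Riesz representative of the functional
    \<open>D\<close>.\<close>
  then have eq: "D = (\<lambda>h. h \<bullet> adjoint D 1)"
    using adjoint_works[of D _ 1] by (auto simp: fun_eq_iff)
  have "GDERIV F x :> adjoint D 1"
    unfolding gderiv_def using D eq by metis
  moreover have "E = adjoint D 1" if "GDERIV F x :> E" for E
  proof -
    have "(\<lambda>h. h \<bullet> E) = (\<lambda>h. h \<bullet> adjoint D 1)"
      using has_derivative_unique that \<open>GDERIV F x :> adjoint D 1\<close> unfolding gderiv_def by blast
    then have "h \<bullet> E = h \<bullet> adjoint D 1" for h by (rule fun_cong)
    then show ?thesis by (metis vector_eq_ldot)
  qed
  ultimately have "GDERIV F x :> gradient F x"
    unfolding gradient_def by (rule theI)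
  then show ?thesis by (simp add: gderiv_def)
qed

lemma gradient_eqI:
  assumes "(F has_derivative (\<lambda>h. h \<bullet> D)) (at x)"
  shows "gradient F x = D"
proof -
  have "(F has_derivative (\<lambda>h. h \<bullet> gradient F x)) (at x)"
    using assms by (intro has_derivative_gradient) (auto simp: differentiable_def)
  then have "(\<lambda>h. h \<bullet> gradient F x) = (\<lambda>h. h \<bullet> D)"
    using assms has_derivative_unique by blast
  then have "h \<bullet> gradient F x = h \<bullet> D" for h by (rule fun_cong)
  then show ?thesis by (metis vector_eq_ldot)
qed

text \<open>The norm of the type of matrices is the Frobenius norm, so Cauchy-Schwarz row by row
  suffices.\<close>

lemma norm_matrix_vector_mult_le: "norm ((A::real^'n^'m) *v x) \<le> norm A * norm x"
proof -
  have "norm (A *v x) \<le> L2_set (\<lambda>i. norm (A $ i) * norm x) UNIV"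
    unfolding norm_vec_def[of "A *v x"] real_norm_def
    by (intro L2_set_mono) (auto simp: matrix_mult_dot Cauchy_Schwarz_ineq2)
  also have "\<dots> = norm A * norm x"
    by (simp add: norm_vec_def[of A] L2_set_left_distrib)
  finally show ?thesis .
qed

lemma continuous_on_matrix_vector_mult [continuous_intros]:
  fixes H :: "'a::topological_space \<Rightarrow> real^'n^'m"
  assumes "continuous_on S H" "continuous_on S v"
  shows "continuous_on S (\<lambda>z. H z *v v z)"
  unfolding matrix_vector_mult_def by (intro continuous_intros assms)

lemma mat_vector_mult [simp]: "(mat c :: real^'n^'n) *v v = c *\<^sub>R v"
  by (simp add: vec_eq_iff matrix_vector_mult_def mat_def if_distrib[of "\<lambda>x. x * _"] cong: if_cong)

lemma has_derivative_hessian: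
  assumes "twice_continuously_differentiable F"
  shows "(gradient F has_derivative (\<lambda>h. hessian F x *v h)) (at x)"
  using assms unfolding twice_continuously_differentiable_def hessian_def jacobian_works by blast

lemma twice_continuously_differentiable_DERIV:
  assumes F: "twice_continuously_differentiable F"
  shows "((\<lambda>s. F (y + s *\<^sub>R v)) has_real_derivative gradient F (y + s *\<^sub>R v) \<bullet> v) (at s)"
    and "((\<lambda>s. gradient F (y + s *\<^sub>R v) \<bullet> u) has_real_derivative
          (hessian F (y + s *\<^sub>R v) *v v) \<bullet> u) (at s)"
proof -
  have line: "((\<lambda>s. y + s *\<^sub>R v) has_derivative (\<lambda>h. h *\<^sub>R v)) (at s)"
    by (auto intro!: derivative_eq_intros)
  have "(F has_derivative (\<lambda>h. h \<bullet> gradient F (y + s *\<^sub>R v))) (at (y + s *\<^sub>R v))"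
    using F by (intro has_derivative_gradient) (auto simp: twice_continuously_differentiable_def)
  from diff_chain_at[OF line this]
  show "((\<lambda>s. F (y + s *\<^sub>R v)) has_real_derivative gradient F (y + s *\<^sub>R v) \<bullet> v) (at s)"
    by (simp add: has_field_derivative_def o_def inner_commute mult_commute_abs)
  from diff_chain_at[OF line has_derivative_hessian[OF F]]
  have "((\<lambda>s. gradient F (y + s *\<^sub>R v)) has_derivative (\<lambda>h. hessian F (y + s *\<^sub>R v) *v (h *\<^sub>R v))) (at s)"
    by (simp add: o_def)
  then have "((\<lambda>s. gradient F (y + s *\<^sub>R v) \<bullet> u) has_derivative
      (\<lambda>h. (hessian F (y + s *\<^sub>R v) *v (h *\<^sub>R v)) \<bullet> u)) (at s)"
    by (rule has_derivative_inner_left)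
  then show "((\<lambda>s. gradient F (y + s *\<^sub>R v) \<bullet> u) has_real_derivative
          (hessian F (y + s *\<^sub>R v) *v v) \<bullet> u) (at s)"
    by (simp add: has_field_derivative_def matrix_vector_mult_scaleR mult_commute_abs)
qed

text \<open>The mean value theorem is applied along \<open>u\<close> and then along
  \<open>v\<close>. The second difference is symmetric in \<open>u\<close> and \<open>v\<close>
  while the right-hand side is not, and this yields the symmetry of the Hessian in the limit of
  small \<open>s\<close>.\<close>

lemma second_difference_mean_value:
  assumes F: "twice_continuously_differentiable F" and s: "0 < s"
  obtains z where "norm (z - x) \<le> s * (norm u + norm v)"
    and "F (x + s *\<^sub>R u + s *\<^sub>R v) - F (x + s *\<^sub>R u) - F (x + s *\<^sub>R v) + F x
         = s\<^sup>2 * ((hessian F z *v v) \<bullet> u)"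
proof -
  define g where "g \<tau> = F ((x + s *\<^sub>R v) + \<tau> *\<^sub>R u) - F (x + \<tau> *\<^sub>R u)" for \<tau>
  have "(g has_real_derivative
      gradient F ((x + s *\<^sub>R v) + \<tau> *\<^sub>R u) \<bullet> u - gradient F (x + \<tau> *\<^sub>R u) \<bullet> u) (at \<tau>)" for \<tau>
    unfolding g_def by (intro DERIV_diff twice_continuously_differentiable_DERIV F)
  from MVT2[OF s this] obtain \<xi> where \<xi>: "0 < \<xi>" "\<xi> < s"
    "g s - g 0 = s * (gradient F ((x + s *\<^sub>R v) + \<xi> *\<^sub>R u) \<bullet> u - gradient F (x + \<xi> *\<^sub>R u) \<bullet> u)"
    by auto
  from MVT2[OF s twice_continuously_differentiable_DERIV(2)[OF F, of "x + \<xi> *\<^sub>R u" v u]]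
  obtain \<eta> where \<eta>: "0 < \<eta>" "\<eta> < s"
    "gradient F ((x + \<xi> *\<^sub>R u) + s *\<^sub>R v) \<bullet> u - gradient F (x + \<xi> *\<^sub>R u) \<bullet> u
      = s * ((hessian F ((x + \<xi> *\<^sub>R u) + \<eta> *\<^sub>R v) *v v) \<bullet> u)"
    by auto
  show thesis
  proof
    have "norm (\<xi> *\<^sub>R u + \<eta> *\<^sub>R v) \<le> \<xi> * norm u + \<eta> * norm v"
      using \<xi> \<eta> norm_triangle_ineq[of "\<xi> *\<^sub>R u" "\<eta> *\<^sub>R v"] by simp
    also have "\<dots> \<le> s * norm u + s * norm v"
      using \<xi> \<eta> by (intro add_mono mult_right_mono) auto
    finally show "norm (((x + \<xi> *\<^sub>R u) + \<eta> *\<^sub>R v) - x) \<le> s * (norm u + norm v)"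
      by (simp add: algebra_simps)
    show "F (x + s *\<^sub>R u + s *\<^sub>R v) - F (x + s *\<^sub>R u) - F (x + s *\<^sub>R v) + F x
         = s\<^sup>2 * ((hessian F ((x + \<xi> *\<^sub>R u) + \<eta> *\<^sub>R v) *v v) \<bullet> u)"
      using \<xi>(3) \<eta>(3) by (simp add: g_def power2_eq_square algebra_simps)
  qed
qed

lemma hessian_symmetric:
  assumes F: "twice_continuously_differentiable F"
  shows "u \<bullet> (hessian F x *v v) = v \<bullet> (hessian F x *v u)"
proof -
  have cont: "continuous_on UNIV (\<lambda>z. (hessian F z *v v) \<bullet> u)" for u v
    using F by (intro continuous_intros) (auto simp: twice_continuously_differentiable_def)
  have "\<bar>(hessian F x *v v) \<bullet> u - (hessian F x *v u) \<bullet> v\<bar> \<le> 0 + e" if e: "0 < e" for e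
  proof -
    obtain d1 where d1: "d1 > 0"
      "\<And>z. dist z x < d1 \<Longrightarrow> dist ((hessian F z *v v) \<bullet> u) ((hessian F x *v v) \<bullet> u) < e / 2"
      using cont[of v u, unfolded continuous_on_iff, rule_format, of x "e / 2"] e by auto
    obtain d2 where d2: "d2 > 0"
      "\<And>z. dist z x < d2 \<Longrightarrow> dist ((hessian F z *v u) \<bullet> v) ((hessian F x *v u) \<bullet> v) < e / 2"
      using cont[of u v, unfolded continuous_on_iff, rule_format, of x "e / 2"] e by auto
    \<comment> \<open>Small enough that both mean value points fall into the neighbourhoods of
      continuity. The summand 1 covers the case where \<open>u\<close> and \<open>v\<close> are
      zero.\<close>
    define s where "s = min d1 d2 / (2 * (norm u + norm v + 1))"
    have pos: "0 < norm u + norm v + 1" by (simp add: add_nonneg_pos)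
    have s: "0 < s" using d1 d2 pos by (simp add: s_def)
    have "s * (norm u + norm v) < s * (2 * (norm u + norm v + 1))"
      using s by (intro mult_strict_left_mono) (auto simp: add_nonneg_pos)
    also have "\<dots> = min d1 d2" using pos by (simp add: s_def)
    finally have small: "s * (norm u + norm v) < min d1 d2" .
    obtain z where z: "norm (z - x) \<le> s * (norm u + norm v)"
      "F (x + s *\<^sub>R u + s *\<^sub>R v) - F (x + s *\<^sub>R u) - F (x + s *\<^sub>R v) + F x
         = s\<^sup>2 * ((hessian F z *v v) \<bullet> u)"
      using second_difference_mean_value[OF F s] by blast
    obtain w where w: "norm (w - x) \<le> s * (norm v + norm u)"
      "F (x + s *\<^sub>R v + s *\<^sub>R u) - F (x + s *\<^sub>R v) - F (x + s *\<^sub>R u) + F x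
         = s\<^sup>2 * ((hessian F w *v u) \<bullet> v)"
      using second_difference_mean_value[OF F s] by blast
    have "s\<^sup>2 * ((hessian F z *v v) \<bullet> u) = s\<^sup>2 * ((hessian F w *v u) \<bullet> v)"
      unfolding z(2)[symmetric] w(2)[symmetric] by (simp add: algebra_simps)
    then have "(hessian F z *v v) \<bullet> u = (hessian F w *v u) \<bullet> v" using s by simp
    moreover have "dist z x < d1" "dist w x < d2"
      using z(1) w(1) small by (auto simp: dist_norm add.commute)
    ultimately show ?thesis using d1(2)[of z] d2(2)[of w] by (simp add: dist_real_def abs_if split: if_splits)
  qed
  then have "\<bar>(hessian F x *v v) \<bullet> u - (hessian F x *v u) \<bullet> v\<bar> \<le> 0"
    by (rule field_le_epsilon)
  then show ?thesis by (simp add: inner_commute)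
qed

locale strongly_convex_C2 =
  fixes F :: "real^'n \<Rightarrow> real" and \<theta> :: real
  assumes modulus_pos: "0 < \<theta>"
    and C2: "twice_continuously_differentiable F"
    and hessian_ge: "\<And>x. loewner_le (mat \<theta>) (hessian F x)"
begin

lemma hessian_coercive: "\<theta> * (norm v)\<^sup>2 \<le> v \<bullet> (hessian F x *v v)"
  using hessian_ge[of x] by (simp add: loewner_le_def power2_norm_eq_inner)

lemma gradient_strongly_monotone:
  "\<theta> * (norm (x - y))\<^sup>2 \<le> (gradient F x - gradient F y) \<bullet> (x - y)"
proof -
  from MVT2[OF zero_less_one twice_continuously_differentiable_DERIV(2)[OF C2, of y "x - y" "x - y"]]
  obtain z where "(gradient F x - gradient F y) \<bullet> (x - y) =
      (hessian F (y + z *\<^sub>R (x - y)) *v (x - y)) \<bullet> (x - y)"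
    by (auto simp: inner_diff_left)
  then show ?thesis using hessian_coercive by (simp add: inner_commute)
qed

lemma strong_convexity:
  "F x + gradient F x \<bullet> (y - x) + \<theta> / 2 * (norm (y - x))\<^sup>2 \<le> F y"
proof -
  define d where "d = y - x"
  \<comment> \<open>The function along the segment minus its tangent and minus the quadratic term.
    Strong monotonicity of the gradient makes its derivative nonnegative.\<close>
  define h where "h s = F (x + s *\<^sub>R d) - s * (gradient F x \<bullet> d) - \<theta> / 2 * s\<^sup>2 * (norm d)\<^sup>2" for s
  have "h 0 \<le> h 1"
  proof (rule DERIV_nonneg_imp_nondecreasing[of 0 1 h])
    fix s :: real assume s: "0 \<le> s" "s \<le> 1"
    have "(h has_real_derivative
        gradient F (x + s *\<^sub>R d) \<bullet> d - gradient F x \<bullet> d - \<theta> * s * (norm d)\<^sup>2) (at s)"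
      unfolding h_def
      by (rule derivative_eq_intros twice_continuously_differentiable_DERIV(1)[OF C2] refl)+ simp
    moreover have "0 \<le> gradient F (x + s *\<^sub>R d) \<bullet> d - gradient F x \<bullet> d - \<theta> * s * (norm d)\<^sup>2"
    proof (cases "s = 0")
      case False
      have "\<theta> * (s\<^sup>2 * (norm d)\<^sup>2) \<le> s * ((gradient F (x + s *\<^sub>R d) - gradient F x) \<bullet> d)"
        using gradient_strongly_monotone[of "x + s *\<^sub>R d" x] by (simp add: power_mult_distrib)
      then have "s * (\<theta> * s * (norm d)\<^sup>2) \<le> s * ((gradient F (x + s *\<^sub>R d) - gradient F x) \<bullet> d)"
        by (simp add: power2_eq_square mult_ac)
      then show ?thesis using False s by (simp add: inner_diff_left)
    qed simp
    ultimately show "\<exists>D. (h has_real_derivative D) (at s) \<and> 0 \<le> D" by blast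
  qed simp
  then show ?thesis by (simp add: h_def d_def)
qed

lemma gradient_surj: "\<exists>x. gradient F x = l"
proof -
  define \<psi> where "\<psi> x = F x - l \<bullet> x" for x
  \<comment> \<open>Beyond this radius the quadratic term of \<open>strong_convexity\<close> at 0
    outweighs the linear one, so \<open>\<psi>\<close> is at least \<open>\<psi> 0\<close> there and
    a minimiser over the ball is a global one.\<close>
  define R where "R = 2 * norm (gradient F 0 - l) / \<theta>"
  have R: "0 \<le> R" using modulus_pos by (simp add: R_def)
  have diff: "F differentiable (at x)" for x
    using C2 by (simp add: twice_continuously_differentiable_def)
  then have "continuous_on UNIV F"
    by (intro differentiable_imp_continuous_on) (simp add: differentiable_on_def)
  then have "continuous_on (cball 0 R) \<psi>"
    unfolding \<psi>_def by (intro continuous_intros) (auto intro: continuous_on_subset)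
  then obtain x where x: "x \<in> cball 0 R" "\<And>y. y \<in> cball 0 R \<Longrightarrow> \<psi> x \<le> \<psi> y"
    using continuous_attains_inf[of "cball 0 R" \<psi>] R by auto
  have min: "\<psi> x \<le> \<psi> y" for y
  proof (cases "norm y \<le> R")
    case False
    have "2 * norm (gradient F 0 - l) \<le> \<theta> * norm y"
      using False modulus_pos by (simp add: R_def field_simps not_le)
    then have "norm y * (2 * norm (gradient F 0 - l)) \<le> norm y * (\<theta> * norm y)"
      by (rule mult_left_mono) simp
    moreover have "- (norm (gradient F 0 - l) * norm y) \<le> (gradient F 0 - l) \<bullet> y"
      using Cauchy_Schwarz_ineq2[of "gradient F 0 - l" y] by linarith
    ultimately have "0 \<le> (gradient F 0 - l) \<bullet> y + \<theta> / 2 * (norm y)\<^sup>2"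
      by (simp add: power2_eq_square algebra_simps)
    then have "\<psi> 0 \<le> \<psi> y"
      using strong_convexity[of 0 y] by (simp add: \<psi>_def inner_diff_left)
    then show ?thesis using x(2)[of 0] R by simp
  qed (use x in auto)
  have "(\<psi> has_derivative (\<lambda>h. h \<bullet> gradient F x - l \<bullet> h)) (at x)"
    unfolding \<psi>_def by (intro has_derivative_diff has_derivative_gradient diff) (auto intro!: derivative_eq_intros)
  then have "(\<lambda>h. h \<bullet> gradient F x - l \<bullet> h) = (\<lambda>h. 0)"
    using differential_zero_maxmin[of x UNIV \<psi>] min by blast
  then have "(gradient F x - l) \<bullet> gradient F x - l \<bullet> (gradient F x - l) = 0" by (rule fun_cong)
  then have "(gradient F x - l) \<bullet> (gradient F x - l) = 0"
    by (simp add: inner_diff_left inner_diff_right inner_commute)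
  then show ?thesis by auto
qed

definition response :: "real^'n \<Rightarrow> real^'n" where
  "response l = (ARG_MAX (\<lambda>x. l \<bullet> x - F x) x. True)"

text \<open>Strong convexity makes the maximiser strict, hence unique, and so the choice made by
  \<open>ARG_MAX\<close> is forced. The response is the inverse of the gradient map.\<close>

lemma response_eqI:
  assumes "gradient F x = l"
  shows "response l = x"
proof -
  have *: "l \<bullet> y - F y < l \<bullet> x - F x" if "y \<noteq> x" for y
  proof -
    have "0 < \<theta> / 2 * (norm (y - x))\<^sup>2" using that modulus_pos by simp
    then show ?thesis using strong_convexity[of x y] assms by (simp add: inner_diff_right)
  qed
  have "is_arg_max (\<lambda>x. l \<bullet> x - F x) (\<lambda>_. True) x"
    unfolding is_arg_max_def using * by (metis less_asym)
  moreover have "y = x" if "is_arg_max (\<lambda>x. l \<bullet> x - F x) (\<lambda>_. True) y" for y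
    using that * unfolding is_arg_max_def by blast
  ultimately show ?thesis
    unfolding response_def arg_max_def by (rule some_equality)
qed

lemma gradient_response [simp]: "gradient F (response l) = l"
  using gradient_surj response_eqI by metis

lemma response_optimal:
  "l \<bullet> y - F y + \<theta> / 2 * (norm (y - response l))\<^sup>2 \<le> l \<bullet> response l - F (response l)"
  using strong_convexity[of "response l" y] by (simp add: inner_diff_right)

lemma response_optimal_weak: "l \<bullet> y - F y \<le> l \<bullet> response l - F (response l)"
proof -
  have "0 \<le> \<theta> / 2 * (norm (y - response l))\<^sup>2" using modulus_pos by simp
  then show ?thesis using response_optimal[of l y] by linarith
qed

lemma norm_diff_le_gradient: "\<theta> * norm (x - y) \<le> norm (gradient F x - gradient F y)"
proof (cases "x = y")
  case False
  have "\<theta> * norm (x - y) * norm (x - y) \<le> norm (gradient F x - gradient F y) * norm (x - y)"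
    using gradient_strongly_monotone[of x y] norm_cauchy_schwarz[of "gradient F x - gradient F y" "x - y"]
    by (simp add: power2_eq_square)
  then show ?thesis using False by simp
qed simp

lemma response_lipschitz: "norm (response l - response m) \<le> norm (l - m) / \<theta>"
  using norm_diff_le_gradient[of "response l" "response m"] modulus_pos
  by (simp add: pos_le_divide_eq mult.commute)

lemma fenchel_conjugate_eq: "fenchel_conjugate F l = l \<bullet> response l - F (response l)"
  unfolding fenchel_conjugate_def
  by (rule cSup_eq_maximum) (auto simp: response_optimal_weak)

text \<open>An envelope argument: optimality of the responses to \<open>l\<close> and to
  \<open>m\<close> traps the remainder \<open>\<Delta>\<close> between 0 and
  \<open>(m - l) \<bullet> (response m - response l)\<close>, which is quadratic in
  \<open>m - l\<close> because the response is Lipschitz with constant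
  \<open>1 / \<theta>\<close>.\<close>

lemma has_derivative_fenchel_conjugate:
  "(fenchel_conjugate F has_derivative (\<lambda>h. h \<bullet> response l)) (at l)"
  unfolding has_derivative_at_alt
proof (intro conjI allI impI)
  show "bounded_linear (\<lambda>h. h \<bullet> response l)" by (rule bounded_linear_inner_left)
  fix e :: real assume e: "0 < e"
  show "\<exists>d>0. \<forall>m. norm (m - l) < d \<longrightarrow>
      norm (fenchel_conjugate F m - fenchel_conjugate F l - (m - l) \<bullet> response l) \<le> e * norm (m - l)"
  proof (intro exI[of _ "e * \<theta>"] conjI allI impI)
    show "0 < e * \<theta>" using e modulus_pos by simp
    fix m assume m: "norm (m - l) < e * \<theta>"
    define \<Delta> where "\<Delta> = fenchel_conjugate F m - fenchel_conjugate F l - (m - l) \<bullet> response l"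
    have "0 \<le> \<Delta>"
      using response_optimal_weak[of m "response l"]
      by (simp add: \<Delta>_def fenchel_conjugate_eq inner_diff_left)
    moreover have "\<Delta> \<le> (m - l) \<bullet> (response m - response l)"
      using response_optimal_weak[of l "response m"]
      by (simp add: \<Delta>_def fenchel_conjugate_eq inner_diff_left inner_diff_right)
    moreover have "\<dots> \<le> norm (m - l) * norm (response m - response l)"
      by (rule norm_cauchy_schwarz)
    moreover have "\<dots> \<le> norm (m - l) * (norm (m - l) / \<theta>)"
      by (intro mult_left_mono response_lipschitz) simp
    moreover have "\<dots> \<le> norm (m - l) * e"
      using m modulus_pos by (intro mult_left_mono) (auto simp: pos_divide_le_eq)
    ultimately show "norm \<Delta> \<le> e * norm (m - l)" by (simp add: mult.commute)
  qed
qed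

lemma gradient_local_dual: "gradient (\<lambda>m. m \<bullet> D - fenchel_conjugate F m) l = D - response l"
proof (rule gradient_eqI)
  show "((\<lambda>m. m \<bullet> D - fenchel_conjugate F m) has_derivative (\<lambda>h. h \<bullet> (D - response l))) (at l)"
    unfolding inner_diff_right
    by (intro has_derivative_diff has_derivative_fenchel_conjugate) (auto intro!: derivative_eq_intros)
qed

lemma hessian_inj: "hessian F x *v v = 0 \<Longrightarrow> v = 0"
  using hessian_coercive[of v x] modulus_pos by (auto simp: mult_le_0_iff)

lemma invertible_hessian: "invertible (hessian F x)"
  by (metis hessian_inj invertible_left_inverse matrix_left_invertible_ker)

lemma hessian_inv:
  "hessian F x ** matrix_inv (hessian F x) = mat 1"
  "matrix_inv (hessian F x) ** hessian F x = mat 1"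
  using someI_ex[OF invertible_hessian[of x, unfolded invertible_def]]
  by (simp_all add: matrix_inv_def)

lemma hessian_inv_right: "hessian F x *v (matrix_inv (hessian F x) *v v) = v"
  by (simp add: matrix_vector_mul_assoc hessian_inv)

lemma hessian_inv_left: "matrix_inv (hessian F x) *v (hessian F x *v v) = v"
  by (simp add: matrix_vector_mul_assoc hessian_inv)

lemma norm_hessian_inv_le: "norm (matrix_inv (hessian F x) *v v) \<le> norm v / \<theta>"
proof -
  define w where "w = matrix_inv (hessian F x) *v v"
  have v: "v = hessian F x *v w" by (simp add: w_def hessian_inv_right)
  have "\<theta> * norm w * norm w \<le> norm w * norm v"
    using hessian_coercive[of w x] norm_cauchy_schwarz[of w "hessian F x *v w"]
    by (simp add: v power2_eq_square)
  then have "\<theta> * norm w \<le> norm v"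
    by (cases "w = 0") (auto simp: mult.commute[of _ "norm w"])
  then show ?thesis using modulus_pos by (simp add: w_def pos_le_divide_eq mult.commute)
qed

end

section \<open>Smoothness of the response map in time\<close>

locale tracked_cost =
  fixes f :: "real^'n \<Rightarrow> real \<Rightarrow> real" and \<theta> \<kappa> :: real
  assumes strongly_convex: "\<And>t. 0 \<le> t \<Longrightarrow> strongly_convex_C2 (\<lambda>x. f x t) \<theta>"
    and time_gradient_differentiable: "\<And>x t. 0 \<le> t \<Longrightarrow> time_gradient f x differentiable (at t within {0..})"
    and time_gradient_deriv_le: "\<And>x t. 0 \<le> t \<Longrightarrow> norm (time_deriv (time_gradient f x) t) \<le> \<kappa>"
begin

abbreviation "G \<equiv> time_gradient f"
abbreviation "H x t \<equiv> hessian (\<lambda>y. f y t) x"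
abbreviation "X \<equiv> primal_response f"

lemma modulus_pos: "0 < \<theta>"
  using strongly_convex[of 0] by (simp add: strongly_convex_C2_def)

lemma rate_nonneg: "0 \<le> \<kappa>"
  using time_gradient_deriv_le[of 0] norm_ge_zero order_trans by blast

lemma response_eq: "0 \<le> t \<Longrightarrow> X l t = strongly_convex_C2.response (\<lambda>x. f x t) l"
  by (simp add: primal_response_def strongly_convex_C2.response_def[OF strongly_convex])

lemma G_response: "0 \<le> t \<Longrightarrow> G (X l t) t = l"
  by (simp add: time_gradient_def response_eq strongly_convex_C2.gradient_response[OF strongly_convex])

lemma time_gradient_local_dual:
  "0 \<le> t \<Longrightarrow> time_gradient (local_dual f d) l t = d t - X l t"
  by (simp add: time_gradient_def local_dual_def response_eq
      strongly_convex_C2.gradient_local_dual[OF strongly_convex])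

lemma G_has_vector_derivative:
  "0 \<le> t \<Longrightarrow> (G x has_vector_derivative time_deriv (G x) t) (at t within {0..})"
  using time_gradient_differentiable vector_derivative_works unfolding time_deriv_def by blast

lemma G_lipschitz_time:
  assumes "0 \<le> s" "0 \<le> t"
  shows "norm (G x s - G x t) \<le> \<kappa> * \<bar>s - t\<bar>"
proof -
  have "norm (G x s - G x t) \<le> \<kappa> * norm (s - t)"
  proof (rule differentiable_bound[of "{0..}"])
    fix u :: real assume u: "u \<in> {0..}"
    show "(G x has_derivative (\<lambda>h. h *\<^sub>R time_deriv (G x) u)) (at u within {0..})"
      using G_has_vector_derivative[of u x] u by (simp add: has_vector_derivative_def)
    show "onorm (\<lambda>h. h *\<^sub>R time_deriv (G x) u) \<le> \<kappa>"
      using time_gradient_deriv_le[of u x] u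
      by (intro onorm_le) (simp add: mult.commute[of \<kappa>] mult_left_mono)
  qed (use assms in auto)
  then show ?thesis by simp
qed

text \<open>Both points are compared through the gradient at the single time \<open>s\<close>. It
  equals \<open>l\<close> at the first point. At the second it differs from \<open>m\<close> by at
  most \<open>\<kappa> * \<bar>s - t\<bar>\<close>, because \<open>m\<close> is the gradient there
  at time \<open>t\<close>.\<close>

lemma response_lipschitz:
  assumes "0 \<le> s" "0 \<le> t"
  shows "norm (X l s - X m t) \<le> (norm (l - m) + \<kappa> * \<bar>s - t\<bar>) / \<theta>"
proof -
  interpret strongly_convex_C2 "\<lambda>x. f x s" \<theta> by (rule strongly_convex[OF assms(1)])
  have "\<theta> * norm (X l s - X m t) \<le> norm (G (X l s) s - G (X m t) s)"
    using norm_diff_le_gradient by (simp add: time_gradient_def)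
  also have "\<dots> = norm ((l - m) + (G (X m t) t - G (X m t) s))"
    using assms by (simp add: G_response)
  also have "\<dots> \<le> norm (l - m) + norm (G (X m t) t - G (X m t) s)" by (rule norm_triangle_ineq)
  also have "\<dots> \<le> norm (l - m) + \<kappa> * \<bar>s - t\<bar>"
    using G_lipschitz_time[OF assms(2,1), of "X m t"] by (simp add: abs_minus_commute)
  finally show ?thesis using modulus_pos by (simp add: pos_le_divide_eq mult.commute)
qed

lemma G_has_derivative: "0 \<le> t \<Longrightarrow> ((\<lambda>x. G x t) has_derivative (\<lambda>h. H x t *v h)) (at x)"
  using has_derivative_hessian[OF strongly_convex_C2.C2[OF strongly_convex]]
  by (simp add: time_gradient_def)

lemma continuous_on_H: "0 \<le> t \<Longrightarrow> continuous_on UNIV (\<lambda>x. H x t)"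
  using strongly_convex_C2.C2[OF strongly_convex] by (simp add: twice_continuously_differentiable_def)

text \<open>
  No joint regularity of the Hessian in \<open>(x, t)\<close> is available. The sets \<open>S\<close> of times at which
  the gradient is almost linear with a prescribed matrix near a prescribed point form a countable
  family; almost every point of such a set is approached by the set at a better than linear rate,
  which together with the Lipschitz dependence on time replaces the missing continuity.
\<close>

lemma G_almost_linear_nearby_times:
  obtains N where "negligible N"
    and "\<And>t x \<epsilon>. t \<notin> N \<Longrightarrow> 0 \<le> t \<Longrightarrow> 0 < \<epsilon> \<Longrightarrow> \<exists>r>0. \<exists>\<delta>>0. \<forall>s. \<bar>s - t\<bar> < \<delta> \<longrightarrow>
      (\<exists>s'\<ge>0. \<bar>s' - s\<bar> \<le> \<epsilon> * \<bar>s - t\<bar> \<and>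
        (\<forall>y\<in>ball x r. norm (G y s' - G x s' - H x t *v (y - x)) \<le> \<epsilon> * norm (y - x)))"
proof -
  obtain D1 :: "(real^'n) set" where D1: "countable D1" "\<And>U. open U \<Longrightarrow> U \<noteq> {} \<Longrightarrow> \<exists>d\<in>D1. d \<in> U"
    using countable_dense_exists by blast
  obtain D2 :: "(real^'n^'n) set" where D2: "countable D2" "\<And>U. open U \<Longrightarrow> U \<noteq> {} \<Longrightarrow> \<exists>d\<in>D2. d \<in> U"
    using countable_dense_exists by blast
  \<comment> \<open>The index records a centre, a radius, a candidate Hessian and a tolerance.
    Centres and matrices are later restricted to countable dense sets, so that the exceptional sets
    have a null union.\<close>
  define S where "S = (\<lambda>(q, m, M, l). {s. 0 \<le> s \<and>
    (\<forall>x\<in>ball q (1 / Suc m). \<forall>y\<in>ball q (1 / Suc m).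
      norm (G y s - G x s - M *v (y - x)) \<le> 1 / Suc l * norm (y - x))})"
  have "\<forall>i. \<exists>N. negligible N \<and> (\<forall>t \<epsilon>. t \<in> S i \<longrightarrow> t \<notin> N \<longrightarrow> 0 < \<epsilon> \<longrightarrow>
     (\<exists>\<delta>>0. \<forall>s. \<bar>s - t\<bar> < \<delta> \<longrightarrow> (\<exists>s'\<in>S i. \<bar>s' - s\<bar> \<le> \<epsilon> * \<bar>s - t\<bar>)))"
  proof
    fix i show "\<exists>N. negligible N \<and> (\<forall>t \<epsilon>. t \<in> S i \<longrightarrow> t \<notin> N \<longrightarrow> 0 < \<epsilon> \<longrightarrow>
     (\<exists>\<delta>>0. \<forall>s. \<bar>s - t\<bar> < \<delta> \<longrightarrow> (\<exists>s'\<in>S i. \<bar>s' - s\<bar> \<le> \<epsilon> * \<bar>s - t\<bar>)))"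
      by (rule ae_infdist_small[of "S i"]) blast
  qed
  then obtain N where N: "\<forall>i. negligible (N i) \<and> (\<forall>t \<epsilon>. t \<in> S i \<longrightarrow> t \<notin> N i \<longrightarrow> 0 < \<epsilon> \<longrightarrow>
     (\<exists>\<delta>>0. \<forall>s. \<bar>s - t\<bar> < \<delta> \<longrightarrow> (\<exists>s'\<in>S i. \<bar>s' - s\<bar> \<le> \<epsilon> * \<bar>s - t\<bar>)))"
    by (rule choice[THEN exE])
  define I where "I = D1 \<times> (UNIV :: nat set) \<times> D2 \<times> (UNIV :: nat set)"
  have "countable I" using D1 D2 by (simp add: I_def)
  show thesis
  proof
    show "negligible (\<Union>i\<in>I. N i)"
      using N \<open>countable I\<close> by (intro negligible_countable_Union) auto
    fix t x and \<epsilon> :: real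
    assume t: "t \<notin> (\<Union>i\<in>I. N i)" "0 \<le> t" and \<epsilon>: "0 < \<epsilon>"
    \<comment> \<open>The tolerance is spent twice: on the linear approximation by \<open>M\<close>
      and on replacing \<open>M\<close> by the Hessian.\<close>
    obtain l where l: "1 / Suc l < \<epsilon> / 2" using nat_approx_posE[of "\<epsilon> / 2"] \<epsilon> by auto
    define \<epsilon>' where "\<epsilon>' = 1 / real (Suc l)"
    have \<epsilon>': "0 < \<epsilon>'" "\<epsilon>' < \<epsilon> / 2" using l by (simp_all add: \<epsilon>'_def)
    obtain \<rho> where \<rho>: "\<rho> > 0" "\<And>z. dist z x < \<rho> \<Longrightarrow> dist (H z t) (H x t) < \<epsilon>' / 2"
      using continuous_on_H[OF t(2), unfolded continuous_on_iff, rule_format, of x "\<epsilon>' / 2"] \<epsilon>' by auto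
    obtain m where m: "1 / Suc m < \<rho> / 2" using nat_approx_posE[of "\<rho> / 2"] \<rho> by auto
    obtain q where q: "q \<in> D1" "q \<in> ball x (1 / Suc m)" using D1(2)[of "ball x (1 / Suc m)"] by auto
    obtain M where M: "M \<in> D2" "M \<in> ball (H x t) (\<epsilon>' / 2)"
      using D2(2)[of "ball (H x t) (\<epsilon>' / 2)"] \<epsilon>' by auto
    define i where "i = (q, m, M, l)"
    have i: "i \<in> I" using q M by (simp add: i_def I_def)
    have near: "dist z x < \<rho>" if "z \<in> ball q (1 / Suc m)" for z
    proof -
      have "dist z x \<le> dist z q + dist q x" by (rule dist_triangle)
      also have "\<dots> < 1 / Suc m + 1 / Suc m"
        using that q by (intro add_strict_mono) (auto simp: dist_commute)
      also have "\<dots> < \<rho>" using m by simp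
      finally show ?thesis .
    qed
    have "norm (G y t - G z t - M *v (y - z)) \<le> \<epsilon>' * norm (y - z)"
      if "z \<in> ball q (1 / Suc m)" "y \<in> ball q (1 / Suc m)" for z y
    proof -
      \<comment> \<open>The map \<open>w \<mapsto> G w t - M *v w\<close> has derivative
        \<open>H w t - M\<close>, which is small on the ball by continuity in the state at the fixed
        time \<open>t\<close>.\<close>
      have "norm ((G y t - M *v y) - (G z t - M *v z)) \<le> \<epsilon>' * norm (y - z)"
      proof (rule differentiable_bound[of "ball q (1 / Suc m)"])
        fix w assume w: "w \<in> ball q (1 / Suc m)"
        show "((\<lambda>w. G w t - M *v w) has_derivative (\<lambda>h. H w t *v h - M *v h)) (at w within ball q (1 / Suc m))"
          by (intro has_derivative_diff has_derivative_at_withinI[OF G_has_derivative[OF t(2)]]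
              bounded_linear_imp_has_derivative matrix_vector_mul_bounded_linear)
        have "dist (H w t) M \<le> dist (H w t) (H x t) + dist (H x t) M" by (rule dist_triangle)
        also have "\<dots> \<le> \<epsilon>' / 2 + \<epsilon>' / 2"
          using \<rho>(2)[OF near[OF w]] M by (intro add_mono) auto
        finally have "norm (H w t - M) \<le> \<epsilon>'" by (simp add: dist_norm)
        then have "norm ((H w t - M) *v h) \<le> \<epsilon>' * norm h" for h
          by (intro order_trans[OF norm_matrix_vector_mult_le] mult_right_mono) auto
        then show "onorm (\<lambda>h. H w t *v h - M *v h) \<le> \<epsilon>'"
          by (intro onorm_le) (simp add: matrix_vector_mult_diff_rdistrib)
      qed (use that in auto)
      then show ?thesis by (simp add: matrix_vector_mult_diff_distrib algebra_simps)
    qed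
    then have "t \<in> S i" using t(2) by (auto simp: S_def i_def \<epsilon>'_def)
    moreover have "t \<notin> N i" using t i by blast
    ultimately obtain \<delta> where \<delta>: "\<delta> > 0"
      "\<And>s. \<bar>s - t\<bar> < \<delta> \<Longrightarrow> \<exists>s'\<in>S i. \<bar>s' - s\<bar> \<le> \<epsilon> * \<bar>s - t\<bar>"
      using N \<epsilon> by blast
    have xq: "x \<in> ball q (1 / Suc m)" using q by (simp add: dist_commute)
    then obtain r where r: "r > 0" "ball x r \<subseteq> ball q (1 / Suc m)"
      using open_ball openE by blast
    have "norm (G y s' - G x s' - H x t *v (y - x)) \<le> \<epsilon> * norm (y - x)"
      if s': "s' \<in> S i" and y: "y \<in> ball x r" for s' y
    proof -
      have 1: "norm (G y s' - G x s' - M *v (y - x)) \<le> \<epsilon>' * norm (y - x)"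
        using s' y r xq unfolding S_def i_def \<epsilon>'_def by blast
      have "norm (M - H x t) \<le> \<epsilon>'" using M \<epsilon>' by (simp add: dist_norm norm_minus_commute)
      then have 2: "norm ((M - H x t) *v (y - x)) \<le> \<epsilon>' * norm (y - x)"
        by (intro order_trans[OF norm_matrix_vector_mult_le] mult_right_mono) auto
      have eq: "G y s' - G x s' - H x t *v (y - x) = (G y s' - G x s' - M *v (y - x)) + (M - H x t) *v (y - x)"
        by (simp add: matrix_vector_mult_diff_rdistrib)
      have "norm (G y s' - G x s' - H x t *v (y - x)) \<le> \<epsilon>' * norm (y - x) + \<epsilon>' * norm (y - x)"
        unfolding eq by (rule norm_triangle_mono[OF 1 2])
      also have "\<dots> = (2 * \<epsilon>') * norm (y - x)" by simp
      also have "\<dots> \<le> \<epsilon> * norm (y - x)" using \<epsilon>' by (intro mult_right_mono) auto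
      finally show ?thesis .
    qed
    note lin = this
    have S0: "0 \<le> s'" if "s' \<in> S i" for s' using that by (auto simp: S_def i_def)
    show "\<exists>r>0. \<exists>\<delta>>0. \<forall>s. \<bar>s - t\<bar> < \<delta> \<longrightarrow>
      (\<exists>s'\<ge>0. \<bar>s' - s\<bar> \<le> \<epsilon> * \<bar>s - t\<bar> \<and>
        (\<forall>y\<in>ball x r. norm (G y s' - G x s' - H x t *v (y - x)) \<le> \<epsilon> * norm (y - x)))"
    proof (rule exI[of _ r], rule conjI[OF r(1)], rule exI[of _ \<delta>], rule conjI[OF \<delta>(1)], intro allI impI)
      fix s assume "\<bar>s - t\<bar> < \<delta>"
      then obtain s' where "s' \<in> S i" "\<bar>s' - s\<bar> \<le> \<epsilon> * \<bar>s - t\<bar>" using \<delta>(2) by blast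
      then show "\<exists>s'\<ge>0. \<bar>s' - s\<bar> \<le> \<epsilon> * \<bar>s - t\<bar> \<and>
        (\<forall>y\<in>ball x r. norm (G y s' - G x s' - H x t *v (y - x)) \<le> \<epsilon> * norm (y - x))"
        using lin S0 by (intro exI[of _ s']) auto
    qed
  qed
qed

text \<open>An implicit function argument without joint continuity of the Hessian. At the perturbed
  time \<open>s\<close> nothing is known about linearity of the gradient, so
  \<open>X \<mu> s\<close> is replaced by the response at a nearby time \<open>s'\<close> where the
  gradient is almost linear. The Lipschitz bound makes this replacement cost a small multiple of the
  increment.\<close>

lemma response_has_derivative_ae:
  obtains N where "negligible N"
    and "\<And>t l. t \<notin> N \<Longrightarrow> 0 < t \<Longrightarrow> ((\<lambda>p. X (fst p) (snd p)) has_derivative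
      (\<lambda>h. matrix_inv (H (X l t) t) *v (fst h - snd h *\<^sub>R time_deriv (G (X l t)) t))) (at (l, t))"
proof -
  obtain N where N: "negligible N" and approx: "\<And>t x \<epsilon>. t \<notin> N \<Longrightarrow> 0 \<le> t \<Longrightarrow> 0 < \<epsilon> \<Longrightarrow>
      \<exists>r>0. \<exists>\<delta>>0. \<forall>s. \<bar>s - t\<bar> < \<delta> \<longrightarrow> (\<exists>s'\<ge>0. \<bar>s' - s\<bar> \<le> \<epsilon> * \<bar>s - t\<bar> \<and>
        (\<forall>y\<in>ball x r. norm (G y s' - G x s' - H x t *v (y - x)) \<le> \<epsilon> * norm (y - x)))"
    by (rule G_almost_linear_nearby_times) blast
  show thesis
  proof (rule that[OF N])
    fix t l assume t: "t \<notin> N" "0 < t"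
    have t0: "0 \<le> t" using t by simp
    interpret sc: strongly_convex_C2 "\<lambda>x. f x t" \<theta> by (rule strongly_convex[OF t0])
    define x where "x = X l t"
    define g where "g = time_deriv (G x) t"
    define P where "P = matrix_inv (H x t)"
    have g: "norm g \<le> \<kappa>" unfolding g_def by (rule time_gradient_deriv_le[OF t0])
    have P: "norm (P *v v) \<le> norm v / \<theta>" "P *v (H x t *v v) = v" for v
      unfolding P_def by (rule sc.norm_hessian_inv_le, rule sc.hessian_inv_left)
    have Gx: "G x t = l" unfolding x_def by (rule G_response[OF t0])
    \<comment> \<open>Lipschitz constant of the response at \<open>s'\<close> relative to the
      increment \<open>\<rho>\<close>: the multiplier moves by at most \<open>\<rho>\<close> and the
      time by at most \<open>2 * \<rho>\<close>.\<close>
    define L where "L = (1 + 2 * \<kappa>) / \<theta>"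
    have L: "0 < L" using modulus_pos rate_nonneg by (simp add: L_def)
    \<comment> \<open>The first term pays for moving from \<open>s\<close> to \<open>s'\<close>; the
      second is the linearisation error after applying the inverse Hessian.\<close>
    define C where "C = \<kappa> / \<theta> + (\<kappa> + 2 + L) / \<theta>"
    have "0 \<le> \<kappa> / \<theta>" using modulus_pos rate_nonneg by simp
    moreover from rate_nonneg L have "0 < \<kappa> + 2 + L" by linarith
    ultimately have C: "0 < C" unfolding C_def using modulus_pos
      by (metis add_nonneg_pos divide_pos_pos)
    have "((\<lambda>p. X (fst p) (snd p)) has_derivative (\<lambda>h. P *v (fst h - snd h *\<^sub>R g))) (at (l, t))"
      unfolding has_derivative_at_alt
    proof (intro conjI allI impI)
      show "bounded_linear (\<lambda>h. P *v (fst h - snd h *\<^sub>R g))"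
        by (intro bounded_linear_compose[OF matrix_vector_mul_bounded_linear] bounded_linear_sub
            bounded_linear_fst bounded_linear_compose[OF bounded_linear_scaleR_left bounded_linear_snd])
      fix e :: real assume e: "0 < e"
      define \<epsilon> where "\<epsilon> = min 1 (e / C)"
      have \<epsilon>: "0 < \<epsilon>" "\<epsilon> \<le> 1" "C * \<epsilon> \<le> e"
      proof -
        have "C * \<epsilon> \<le> C * (e / C)" using C by (intro mult_left_mono) (auto simp: \<epsilon>_def)
        then show "0 < \<epsilon>" "\<epsilon> \<le> 1" "C * \<epsilon> \<le> e" using e C by (simp_all add: \<epsilon>_def)
      qed
      obtain r \<delta>1 where r: "r > 0" and \<delta>1: "\<delta>1 > 0" "\<And>s. \<bar>s - t\<bar> < \<delta>1 \<Longrightarrow> \<exists>s'\<ge>0. \<bar>s' - s\<bar> \<le> \<epsilon> * \<bar>s - t\<bar> \<and>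
        (\<forall>y\<in>ball x r. norm (G y s' - G x s' - H x t *v (y - x)) \<le> \<epsilon> * norm (y - x))"
        using approx[OF t(1) t0 \<epsilon>(1), of x] by blast
      have "(G x has_derivative (\<lambda>h. h *\<^sub>R g)) (at t within {0..})"
        using G_has_vector_derivative[OF t0, of x] by (simp add: g_def has_vector_derivative_def)
      then obtain \<delta>2 where \<delta>2: "\<delta>2 > 0"
        "\<And>s. 0 \<le> s \<Longrightarrow> \<bar>s - t\<bar> < \<delta>2 \<Longrightarrow> norm (G x s - G x t - (s - t) *\<^sub>R g) \<le> \<epsilon> * \<bar>s - t\<bar>"
      proof -
        assume "(G x has_derivative (\<lambda>h. h *\<^sub>R g)) (at t within {0..})"
        then have "\<exists>d>0. \<forall>s\<in>{0..}. norm (s - t) < d \<longrightarrow>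
            norm (G x s - G x t - (s - t) *\<^sub>R g) \<le> \<epsilon> * norm (s - t)"
          using \<epsilon>(1) unfolding has_derivative_within_alt by blast
        then show thesis using that by auto
      qed
      \<comment> \<open>The halving of \<open>\<delta>2\<close> allows \<open>s'\<close> to be at
        distance \<open>2 * \<rho>\<close> from \<open>t\<close>, the bound \<open>t\<close> keeps
        \<open>s\<close> nonnegative, and \<open>r / L\<close> keeps \<open>y\<close> in the ball
        around \<open>x\<close>.\<close>
      define \<delta> where "\<delta> = min (min \<delta>1 (\<delta>2 / 2)) (min t (r / L))"
      show "\<exists>d>0. \<forall>p. norm (p - (l, t)) < d \<longrightarrow>
        norm (X (fst p) (snd p) - X (fst (l, t)) (snd (l, t)) -
          P *v (fst (p - (l, t)) - snd (p - (l, t)) *\<^sub>R g)) \<le> e * norm (p - (l, t))"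
      proof (intro exI[of _ \<delta>] conjI allI impI)
        show "0 < \<delta>" using \<delta>1 \<delta>2 t r L by (simp add: \<delta>_def)
        fix p assume p: "norm (p - (l, t)) < \<delta>"
        obtain \<mu> s where ps: "p = (\<mu>, s)" by (cases p)
        define \<rho> where "\<rho> = norm (p - (l, t))"
        have \<rho>: "norm (\<mu> - l) \<le> \<rho>" "\<bar>s - t\<bar> \<le> \<rho>" "0 \<le> \<rho>"
          using norm_fst_le[of "\<mu> - l" "s - t"] norm_snd_le[of "s - t" "\<mu> - l"]
          by (auto simp: \<rho>_def ps)
        have small: "\<rho> < \<delta>1" "2 * \<rho> < \<delta>2" "\<rho> < t" "L * \<rho> < r"
        proof -
          have "\<rho> < \<delta>" using p by (simp add: \<rho>_def)
          then have "\<rho> < r / L" "\<rho> < \<delta>1" "\<rho> < \<delta>2 / 2" "\<rho> < t" by (simp_all add: \<delta>_def)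
          then show "\<rho> < \<delta>1" "2 * \<rho> < \<delta>2" "\<rho> < t" "L * \<rho> < r"
            using L by (simp_all add: pos_less_divide_eq mult.commute)
        qed
        have s: "0 \<le> s" using \<rho> small by linarith
        obtain s' where s': "0 \<le> s'" "\<bar>s' - s\<bar> \<le> \<epsilon> * \<bar>s - t\<bar>"
          "\<And>y. y \<in> ball x r \<Longrightarrow> norm (G y s' - G x s' - H x t *v (y - x)) \<le> \<epsilon> * norm (y - x)"
        proof -
          have "\<bar>s - t\<bar> < \<delta>1" using \<rho>(2) small(1) by linarith
          then show thesis using \<delta>1(2)[of s] that by blast
        qed
        have ss: "\<bar>s' - s\<bar> \<le> \<epsilon> * \<rho>"
          using s'(2) mult_left_mono[OF \<rho>(2), of \<epsilon>] \<epsilon>(1) by linarith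
        have "\<epsilon> * \<rho> \<le> 1 * \<rho>" using \<epsilon> \<rho> by (intro mult_right_mono) auto
        then have st: "\<bar>s' - t\<bar> \<le> 2 * \<rho>" using ss \<rho>(2) by linarith
        define y where "y = X \<mu> s'"
        have "norm (y - x) \<le> (norm (\<mu> - l) + \<kappa> * \<bar>s' - t\<bar>) / \<theta>"
          unfolding y_def x_def by (rule response_lipschitz[OF s'(1) t0])
        also have "\<dots> \<le> (\<rho> + \<kappa> * (2 * \<rho>)) / \<theta>"
          using \<rho> st modulus_pos rate_nonneg by (intro divide_right_mono add_mono mult_left_mono) auto
        also have "\<dots> = L * \<rho>" by (simp add: L_def algebra_simps)
        finally have yx: "norm (y - x) \<le> L * \<rho>" .
        then have yr: "y \<in> ball x r" using small by (simp add: dist_norm norm_minus_commute)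
        have Gy: "G y s' = \<mu>" unfolding y_def by (rule G_response[OF s'(1)])
        define E1 where "E1 = G y s' - G x s' - H x t *v (y - x)"
        define E2 where "E2 = G x s' - G x t - (s' - t) *\<^sub>R g"
        have E1: "norm E1 \<le> \<epsilon> * (L * \<rho>)"
          using s'(3)[OF yr] mult_left_mono[OF yx, of \<epsilon>] \<epsilon>(1) unfolding E1_def by linarith
        have E2: "norm E2 \<le> \<epsilon> * (2 * \<rho>)"
          using \<delta>2(2)[OF s'(1)] st small mult_left_mono[OF st, of \<epsilon>] \<epsilon>(1) unfolding E2_def by linarith
        have E3: "norm ((s' - s) *\<^sub>R g) \<le> (\<epsilon> * \<rho>) * \<kappa>"
          using ss g rate_nonneg by (simp add: mult_mono)
        \<comment> \<open>Three sources: the time shift from \<open>s\<close> to \<open>s'\<close>,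
          the linearisation of the gradient in time at \<open>x\<close>, and its linearisation in
          space at \<open>s'\<close>.\<close>
        define err where "err = (s' - s) *\<^sub>R g + E2 + E1"
        have "norm err \<le> (\<epsilon> * \<rho>) * \<kappa> + \<epsilon> * (2 * \<rho>) + \<epsilon> * (L * \<rho>)"
          unfolding err_def by (intro norm_triangle_mono E1 E2 E3)
        also have "\<dots> = (\<kappa> + 2 + L) * \<epsilon> * \<rho>" by (simp add: algebra_simps)
        finally have err: "norm err \<le> (\<kappa> + 2 + L) * \<epsilon> * \<rho>" .
        have "\<mu> - l - (s - t) *\<^sub>R g = H x t *v (y - x) + err"
          unfolding err_def E1_def E2_def Gy Gx by (simp add: algebra_simps)
        then have "P *v (\<mu> - l - (s - t) *\<^sub>R g) = (y - x) + P *v err"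
          by (simp add: matrix_vector_right_distrib P(2))
        then have split: "X \<mu> s - x - P *v (\<mu> - l - (s - t) *\<^sub>R g) = (X \<mu> s - y) + - (P *v err)"
          by simp
        have A: "norm (- (P *v err)) \<le> (\<kappa> + 2 + L) / \<theta> * \<epsilon> * \<rho>"
        proof -
          have "norm (P *v err) \<le> norm err / \<theta>" by (rule P(1))
          also have "\<dots> \<le> ((\<kappa> + 2 + L) * \<epsilon> * \<rho>) / \<theta>"
            using err modulus_pos by (intro divide_right_mono) auto
          finally show ?thesis by simp
        qed
        have B: "norm (X \<mu> s - y) \<le> \<kappa> / \<theta> * \<epsilon> * \<rho>"
        proof -
          have "norm (X \<mu> s - y) \<le> (norm (\<mu> - \<mu>) + \<kappa> * \<bar>s - s'\<bar>) / \<theta>"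
            unfolding y_def by (rule response_lipschitz[OF s s'(1)])
          also have "\<dots> \<le> (\<kappa> * (\<epsilon> * \<rho>)) / \<theta>"
            using ss modulus_pos rate_nonneg
            by (intro divide_right_mono) (auto simp: abs_minus_commute intro!: mult_left_mono)
          finally show ?thesis by (simp add: mult_ac)
        qed
        have "norm (X \<mu> s - x - P *v (\<mu> - l - (s - t) *\<^sub>R g)) \<le>
            \<kappa> / \<theta> * \<epsilon> * \<rho> + (\<kappa> + 2 + L) / \<theta> * \<epsilon> * \<rho>"
          unfolding split by (rule norm_triangle_mono[OF B A])
        also have "\<dots> = C * \<epsilon> * \<rho>" unfolding C_def by (simp only: distrib_right)
        also have "\<dots> \<le> e * \<rho>" using \<epsilon>(3) \<rho>(3) by (rule mult_right_mono)
        finally show "norm (X (fst p) (snd p) - X (fst (l, t)) (snd (l, t)) -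
          P *v (fst (p - (l, t)) - snd (p - (l, t)) *\<^sub>R g)) \<le> e * norm (p - (l, t))"
          by (simp add: ps x_def \<rho>_def)
      qed
    qed
    then show "((\<lambda>p. X (fst p) (snd p)) has_derivative
      (\<lambda>h. matrix_inv (H (X l t) t) *v (fst h - snd h *\<^sub>R time_deriv (G (X l t)) t))) (at (l, t))"
      unfolding P_def g_def x_def .
  qed
qed

end

section \<open>The spectral bound for sign patterns on edges\<close>

declare transpose_matrix_vector [simp del]

lemma inner_matrix_transpose: "(A *v x) \<bullet> y = x \<bullet> (transpose A *v (y :: real^'m))" for A :: "real^'k^'m"
  by (metis dot_lmul_matrix inner_commute transpose_matrix_vector)

text \<open>The Rayleigh quotient of \<open>transpose B ** B\<close> attains its minimum on the unit
  sphere of the range of \<open>transpose B\<close>. The minimiser is an eigenvector, and every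
  eigenvector with positive eigenvalue lies in that range, so the minimum is the least positive
  eigenvalue. The nonzero \<open>transpose B *v y\<close> makes the sphere nonempty.\<close>

lemma least_positive_eigenvalue_gram:
  fixes B :: "real^'k^'m"
  assumes nz: "transpose B *v y \<noteq> 0"
  defines "\<mu> \<equiv> least_positive_eigenvalue (transpose B ** B)"
  shows "0 < \<mu>" and "\<And>z. \<mu> * (norm (transpose B *v z))\<^sup>2 \<le> (norm (B *v (transpose B *v z)))\<^sup>2"
proof -
  define W where "W = range ((*v) (transpose B))"
  have W: "subspace W"
    unfolding W_def by (rule linear_subspace_image) (auto simp: matrix_vector_mul_linear subspace_UNIV)
  have Wmul: "transpose B *v z \<in> W" for z by (simp add: W_def)
  define K where "K = W \<inter> sphere 0 1"
  have "compact K"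
    unfolding K_def by (intro closed_Int_compact closed_subspace W compact_sphere)
  moreover have "(1 / norm (transpose B *v y)) *\<^sub>R (transpose B *v y) \<in> K"
    using nz by (auto simp: K_def intro!: subspace_scale[OF W] Wmul)
  moreover have "continuous_on K (\<lambda>w. (norm (B *v w))\<^sup>2)"
    by (intro continuous_intros)
  ultimately obtain w where w: "w \<in> K" "\<And>v. v \<in> K \<Longrightarrow> (norm (B *v w))\<^sup>2 \<le> (norm (B *v v))\<^sup>2"
    using continuous_attains_inf[of K "\<lambda>w. (norm (B *v w))\<^sup>2"] by blast
  define \<nu> where "\<nu> = (norm (B *v w))\<^sup>2"
  have wW: "w \<in> W" "norm w = 1" using w(1) by (auto simp: K_def)
  have ray: "\<nu> * (norm u)\<^sup>2 \<le> (norm (B *v u))\<^sup>2" if u: "u \<in> W" for u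
  proof (cases "u = 0")
    case False
    then have "(1 / norm u) *\<^sub>R u \<in> K" using u by (auto simp: K_def intro!: subspace_scale[OF W])
    from w(2)[OF this] have "\<nu> \<le> (norm (B *v u))\<^sup>2 / (norm u)\<^sup>2"
      by (simp add: \<nu>_def matrix_vector_mult_scaleR power_mult_distrib power_divide)
    then show ?thesis using False by (simp add: pos_le_divide_eq)
  qed simp
  define M where "M = transpose B ** B"
  have M: "M *v v = transpose B *v (B *v v)" for v by (simp add: M_def matrix_vector_mul_assoc)
  have MB: "v \<bullet> (M *v u) = (B *v v) \<bullet> (B *v u)" for u v
    unfolding M by (rule inner_matrix_transpose[symmetric])
  \<comment> \<open>The eigenvector residual stays in \<open>W\<close>, hence is an admissible
    perturbation of the minimiser \<open>w\<close>.\<close>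
  define r where "r = M *v w - \<nu> *\<^sub>R w"
  have rW: "r \<in> W"
    unfolding r_def M by (intro subspace_diff[OF W] subspace_scale[OF W] wW Wmul)
  define q where "q = (norm (B *v r))\<^sup>2 - \<nu> * (norm r)\<^sup>2"
  have q0: "0 \<le> q" using ray[OF rW] by (simp add: q_def)
  have rr: "r \<bullet> r = (B *v w) \<bullet> (B *v r) - \<nu> * (w \<bullet> r)"
  proof -
    have "r \<bullet> r = r \<bullet> (M *v w) - \<nu> * (r \<bullet> w)"
      by (subst (2) r_def) (simp add: inner_diff_right)
    then show ?thesis by (simp add: MB inner_commute)
  qed
  have expand: "0 \<le> 2 * s * (r \<bullet> r) + s\<^sup>2 * q" for s
  proof -
    have "w + s *\<^sub>R r \<in> W" by (intro subspace_add[OF W] subspace_scale[OF W] wW rW)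
    from ray[OF this]
    have "\<nu> * ((w + s *\<^sub>R r) \<bullet> (w + s *\<^sub>R r)) \<le> (B *v w + s *\<^sub>R (B *v r)) \<bullet> (B *v w + s *\<^sub>R (B *v r))"
      by (simp add: power2_norm_eq_inner matrix_vector_right_distrib matrix_vector_mult_scaleR)
    moreover have "w \<bullet> w = 1" using wW(2) by (simp add: norm_eq_1)
    moreover have "(B *v w) \<bullet> (B *v w) = \<nu>" by (simp add: \<nu>_def power2_norm_eq_inner)
    ultimately have "0 \<le> 2 * s * ((B *v w) \<bullet> (B *v r) - \<nu> * (w \<bullet> r)) + s\<^sup>2 * q"
      unfolding q_def power2_norm_eq_inner
      by (simp add: inner_add_left inner_add_right inner_commute[of r w] inner_commute[of "B *v r" "B *v w"]
          power2_eq_square algebra_simps)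
    then show ?thesis by (simp only: rr[symmetric])
  qed
  have "r \<bullet> r = 0"
  proof (rule ccontr)
    assume "r \<bullet> r \<noteq> 0"
    then have pos: "0 < r \<bullet> r" using inner_ge_zero[of r] by linarith
    \<comment> \<open>A step along \<open>- r\<close> short enough that the quadratic term cannot
      compensate the negative linear term; the summand 1 avoids division by zero.\<close>
    define s where "s = (r \<bullet> r) / (q + 1)"
    have s: "0 < s" using pos q0 by (simp add: s_def)
    have "s * q \<le> s * (q + 1)" using s by simp
    also have "\<dots> = r \<bullet> r" using q0 by (simp add: s_def)
    finally have "s * (s * q) \<le> s * (r \<bullet> r)" using s by simp
    moreover have "0 < s * (r \<bullet> r)" using s pos by simp
    moreover have "0 \<le> 2 * (- s) * (r \<bullet> r) + (- s)\<^sup>2 * q" by (rule expand)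
    ultimately show False by (simp add: power2_eq_square mult.assoc)
  qed
  then have eig: "M *v w = \<nu> *\<^sub>R w" by (simp add: r_def)
  \<comment> \<open>Otherwise \<open>w\<close> would lie both in the kernel of \<open>B\<close> and
    in the range of \<open>transpose B\<close>, which are orthogonal.\<close>
  have \<nu>: "0 < \<nu>"
  proof (rule ccontr)
    assume "\<not> 0 < \<nu>"
    then have "B *v w = 0" by (simp add: \<nu>_def)
    moreover obtain x where "w = transpose B *v x" using wW(1) by (auto simp: W_def)
    ultimately have "w \<bullet> w = 0" using inner_matrix_transpose[of B w x] by simp
    then show False using wW(2) by simp
  qed
  have "\<mu> = \<nu>"
    unfolding \<mu>_def least_positive_eigenvalue_def M_def[symmetric]
  proof (rule Least_equality)
    show "0 < \<nu> \<and> (\<exists>v. v \<noteq> 0 \<and> M *v v = \<nu> *\<^sub>R v)"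
      using \<nu> eig wW(2) by (intro conjI exI[of _ w]) auto
    fix \<mu>' assume "0 < \<mu>' \<and> (\<exists>v. v \<noteq> 0 \<and> M *v v = \<mu>' *\<^sub>R v)"
    then obtain v where v: "0 < \<mu>'" "v \<noteq> 0" "M *v v = \<mu>' *\<^sub>R v" by blast
    have "v = (1 / \<mu>') *\<^sub>R (M *v v)" using v by simp
    then have "v \<in> W" unfolding M by (metis subspace_scale[OF W] Wmul)
    then have "\<nu> * (norm v)\<^sup>2 \<le> (norm (B *v v))\<^sup>2" by (rule ray)
    also have "\<dots> = \<mu>' * (norm v)\<^sup>2"
      using MB[of v v] v by (simp add: power2_norm_eq_inner)
    finally show "\<nu> \<le> \<mu>'" using v by simp
  qed
  with \<nu> ray Wmul show "0 < \<mu>" "\<And>z. \<mu> * (norm (transpose B *v z))\<^sup>2 \<le> (norm (B *v (transpose B *v z)))\<^sup>2"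
    by auto
qed

text \<open>Only the component \<open>u\<close> of \<open>\<sigma>\<close> in the range of
  \<open>transpose B\<close> matters: the orthogonal component is killed by \<open>B\<close> and
  does not enter the pairing. The dual hypothesis and Cauchy-Schwarz give
  \<open>1 \<le> norm u\<close>, and the Rayleigh bound applies to \<open>u\<close>.\<close>

lemma least_positive_eigenvalue_le_of_dual:
  fixes B :: "real^'k^'m"
  assumes nz: "transpose B *v y \<noteq> 0" and dual: "norm (transpose B *v y) \<le> \<sigma> \<bullet> (transpose B *v y)"
  shows "least_positive_eigenvalue (transpose B ** B) \<le> (norm (B *v \<sigma>))\<^sup>2"
proof -
  let ?\<mu> = "least_positive_eigenvalue (transpose B ** B)"
  define W where "W = range ((*v) (transpose B))"
  have W: "subspace W"
    unfolding W_def by (rule linear_subspace_image) (auto simp: matrix_vector_mul_linear subspace_UNIV)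
  have Wmul: "transpose B *v z \<in> W" for z by (simp add: W_def)
  obtain u v where uv: "u \<in> W" "\<And>w. w \<in> W \<Longrightarrow> v \<bullet> w = 0" "\<sigma> = u + v"
    using orthogonal_subspace_decomp_exists[of W \<sigma>] span_eq_iff[THEN iffD2, OF W]
    by (metis orthogonal_def)
  have "(B *v v) \<bullet> (B *v v) = 0"
    using uv(2)[OF Wmul] by (simp add: inner_matrix_transpose)
  then have B: "B *v \<sigma> = B *v u" by (simp add: uv(3) matrix_vector_right_distrib)
  obtain z where z: "u = transpose B *v z" using uv(1) by (auto simp: W_def)
  have "norm (transpose B *v y) \<le> u \<bullet> (transpose B *v y)"
    using dual uv(2)[OF Wmul] by (simp add: uv(3) inner_add_left)
  also have "\<dots> \<le> norm u * norm (transpose B *v y)" by (rule norm_cauchy_schwarz)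
  finally have "1 \<le> norm u" using nz by simp
  then have "1 \<le> (norm u)\<^sup>2" by (rule one_le_power)
  then have "?\<mu> * 1 \<le> ?\<mu> * (norm u)\<^sup>2"
    using least_positive_eigenvalue_gram(1)[OF nz] by (intro mult_left_mono) auto
  also have "\<dots> \<le> (norm (B *v \<sigma>))\<^sup>2"
    unfolding B z by (rule least_positive_eigenvalue_gram(2)[OF nz])
  finally show ?thesis by simp
qed

section \<open>The incidence matrix of the communication graph\<close>

lemma sum_prod_UNIV: "(\<Sum>p\<in>UNIV. h p) = (\<Sum>k\<in>UNIV. \<Sum>q\<in>UNIV. h (k, q))"
  for h :: "'a::finite \<times> 'b::finite \<Rightarrow> real"
  by (simp add: sum.cartesian_product flip: UNIV_Times_UNIV)

lemma extended_incidence_mult: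
  "(extended_incidence A e *v u) $ (i, q) = (\<Sum>k\<in>UNIV. incidence A e $ i $ k * u $ (k, q))"
  by (simp add: matrix_vector_mult_def extended_incidence_def kronecker_def mat_def sum_prod_UNIV
      if_distrib[of "\<lambda>x. _ * x"] if_distrib[of "\<lambda>x. x * _"] cong: if_cong)

lemma extended_incidence_transpose_mult:
  "(transpose (extended_incidence A e) *v y) $ (k, q) = (\<Sum>i\<in>UNIV. incidence A e $ i $ k * y $ (i, q))"
proof -
  have "(transpose (extended_incidence A e) *v y) $ (k, q) =
     (\<Sum>i\<in>UNIV. \<Sum>q'\<in>UNIV. if q' = q then incidence A e $ i $ k * y $ (i, q') else 0)"
    unfolding matrix_vector_mult_def transpose_def extended_incidence_def kronecker_def mat_def sum_prod_UNIV
    by (simp add: if_distrib[of "\<lambda>x. _ * x"] if_distrib[of "\<lambda>x. x * _"] cong: if_cong)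
  then show ?thesis by simp
qed

context
  fixes E :: "('N::{finite,linorder} \<times> 'N) set"
    and A :: "real^'N::{finite,linorder}^'N::{finite,linorder}"
    and e :: "'m::finite \<Rightarrow> 'N \<times> 'N"
  assumes graph: "connected_weighted_graph E A"
    and edges: "edge_enumeration E e"
begin

lemma edge_sym: "(i, j) \<in> E \<longleftrightarrow> (j, i) \<in> E"
  using graph unfolding connected_weighted_graph_def by metis

lemma edge_of_weight: "A $ i $ j \<noteq> 0 \<Longrightarrow> (i, j) \<in> E"
  using graph edge_sym unfolding connected_weighted_graph_def by (metis less_eq_real_def)

lemma edge_range: "e k = (i, j) \<Longrightarrow> (i, j) \<in> E \<and> i < j"
  using bij_betwE[OF edges[unfolded edge_enumeration_def], rule_format, of k] by simp

text \<open>An edge enters once, oriented from its smaller to its larger end, with opposite signs at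
  the two ends. Antisymmetry of \<open>\<tau>\<close> absorbs that sign, so the edge sum at
  \<open>i\<close> becomes a sum over all neighbours, smaller and larger alike.\<close>

lemma sum_incidence:
  assumes anti: "\<And>i j. \<tau> i j = - \<tau> j i"
  shows "(\<Sum>k\<in>UNIV. incidence A e $ i $ k * (case e k of (l, j) \<Rightarrow> \<tau> l j)) = (\<Sum>j\<in>UNIV. A $ i $ j * \<tau> i j)"
proof -
  define c where "c p = (case p of (l, j) \<Rightarrow>
      (if i = l then A $ l $ j else if i = j then - A $ l $ j else 0) * \<tau> l j)" for p
  have sym: "A $ i $ j = A $ j $ i" and diag: "A $ i $ i = 0" for i j
    using graph by (auto simp: connected_weighted_graph_def)
  have "(\<Sum>k\<in>UNIV. incidence A e $ i $ k * (case e k of (l, j) \<Rightarrow> \<tau> l j)) = (\<Sum>k\<in>UNIV. c (e k))"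
    by (auto simp: incidence_def c_def intro!: sum.cong split: prod.split)
  also have "\<dots> = (\<Sum>p\<in>{(i, j). (i, j) \<in> E \<and> i < j}. c p)"
    using edges unfolding edge_enumeration_def by (rule sum.reindex_bij_betw)
  also have "\<dots> = (\<Sum>p\<in>UNIV. if fst p < snd p then c p else 0)"
    by (rule sum.mono_neutral_cong_left) (auto simp: c_def split: if_splits intro: edge_of_weight)
  also have "\<dots> = (\<Sum>l\<in>UNIV. \<Sum>j\<in>UNIV.
      (if l = i then if i < j then A $ i $ j * \<tau> i j else 0 else 0) +
      (if j = i then if l < i then A $ i $ l * \<tau> i l else 0 else 0))"
    unfolding sum_prod_UNIV
  proof (intro sum.cong refl)
    fix l j
    have "- A $ l $ i * \<tau> l i = A $ i $ l * \<tau> i l" by (subst anti) (simp add: sym)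
    then show "(if fst (l, j) < snd (l, j) then c (l, j) else 0) =
      (if l = i then if i < j then A $ i $ j * \<tau> i j else 0 else 0) +
      (if j = i then if l < i then A $ i $ l * \<tau> i l else 0 else 0)"
      by (auto simp: c_def)
  qed
  also have "\<dots> = (\<Sum>j\<in>UNIV. if i < j then A $ i $ j * \<tau> i j else 0) + (\<Sum>l\<in>UNIV. if l < i then A $ i $ l * \<tau> i l else 0)"
    unfolding sum.distrib
    by (subst sum.swap) (simp add: sum.swap[of "\<lambda>l j. if j = i then _ l j else 0"])
  also have "\<dots> = (\<Sum>j\<in>UNIV. A $ i $ j * \<tau> i j)"
    unfolding sum.distrib[symmetric] by (intro sum.cong) (auto simp: diag not_less_iff_gr_or_eq)
  finally show ?thesis .
qed

lemma consensus_of_edges: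
  assumes "\<And>l j. (l, j) \<in> E \<Longrightarrow> x l = x j"
  shows "x i = x j"
proof -
  have "(i, j) \<in> E\<^sup>*" using graph by (simp add: connected_weighted_graph_def)
  then show ?thesis by (induction rule: rtrancl_induct) (auto dest: assms)
qed

lemma consensus_of_transpose_incidence_eq_0:
  fixes \<Lambda> :: "(real^'n)^'N::{finite,linorder}"
  assumes "transpose (extended_incidence A e) *v (\<chi> p. \<Lambda> $ fst p $ snd p) = 0"
  shows "\<Lambda> $ i = \<Lambda> $ j"
proof -
  have edge: "\<Lambda> $ l = \<Lambda> $ j" if lj: "(l, j) \<in> E" "l < j" for l j
  proof -
    obtain k where k: "e k = (l, j)"
      using edges lj unfolding edge_enumeration_def bij_betw_def
      by (metis (mono_tags, lifting) case_prodI image_iff mem_Collect_eq)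
    have A: "A $ l $ j \<noteq> 0" using graph lj edge_sym by (metis connected_weighted_graph_def less_irrefl)
    have "A $ l $ j * (\<Lambda> $ l $ q - \<Lambda> $ j $ q) = 0" for q
    proof -
      have "0 = (\<Sum>i\<in>UNIV. incidence A e $ i $ k * \<Lambda> $ i $ q)"
        using arg_cong[OF assms, of "\<lambda>v. v $ (k, q)"] by (simp add: extended_incidence_transpose_mult)
      also have "\<dots> = (\<Sum>i\<in>UNIV. (if i = l then A $ l $ j * \<Lambda> $ l $ q else 0) + (if i = j then - A $ l $ j * \<Lambda> $ j $ q else 0))"
        using lj by (intro sum.cong) (auto simp: incidence_def k)
      finally show ?thesis by (auto simp: sum.distrib right_diff_distrib)
    qed
    then show ?thesis using A by (simp add: vec_eq_iff)
  qed
  have "\<Lambda> $ l = \<Lambda> $ j" if "(l, j) \<in> E" for l j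
    using edge[of l j] edge[of j l] that edge_sym[of l j] by (cases l j rule: linorder_cases) auto
  then show ?thesis by (rule consensus_of_edges[of "\<lambda>i. \<Lambda> $ i"])
qed

text \<open>With \<open>s\<close> the vector of signs on the edges, \<open>B *v s\<close> collects
  the net sign terms of the nodes, and the entries of \<open>transpose B *v y\<close> are the
  weighted differences along edges. The pairing of the two is thus at least the 1-norm of the
  latter, hence at least its Euclidean norm.\<close>

lemma incidence_sign_bound:
  fixes \<Lambda> :: "(real^'n)^'N::{finite,linorder}" and \<sigma> :: "'N \<Rightarrow> 'N \<Rightarrow> real^'n"
  defines "B \<equiv> extended_incidence A e :: real^('m \<times> 'n)^('N::{finite,linorder} \<times> 'n)"
  assumes anti: "\<And>i j. \<sigma> i j = - \<sigma> j i"
    and sign: "\<And>i j q. \<bar>\<Lambda> $ i $ q - \<Lambda> $ j $ q\<bar> \<le> \<sigma> i j $ q * (\<Lambda> $ i $ q - \<Lambda> $ j $ q)"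
    and nc: "\<Lambda> $ i0 \<noteq> \<Lambda> $ j0"
  shows "0 < least_positive_eigenvalue (transpose B ** B)"
    and "least_positive_eigenvalue (transpose B ** B) \<le> (\<Sum>i\<in>UNIV. (norm (\<Sum>j\<in>UNIV. A $ i $ j *\<^sub>R \<sigma> i j))\<^sup>2)"
proof -
  define y where "y = (\<chi> p. \<Lambda> $ fst p $ snd p)"
  have nz: "transpose B *v y \<noteq> 0"
    using consensus_of_transpose_incidence_eq_0 nc unfolding y_def B_def by blast
  show "0 < least_positive_eigenvalue (transpose B ** B)"
    by (rule least_positive_eigenvalue_gram(1)[OF nz])
  define s where "s = (\<chi> p. case e (fst p) of (l, j) \<Rightarrow> \<sigma> l j $ snd p)"
  have w: "(transpose B *v y) $ (k, q) = (case e k of (l, j) \<Rightarrow> A $ l $ j * (\<Lambda> $ l $ q - \<Lambda> $ j $ q))" for k q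
  proof -
    obtain l j where k: "e k = (l, j)" by (cases "e k")
    then have "l \<noteq> j" using edge_range by blast
    have "(transpose B *v y) $ (k, q) = (\<Sum>i\<in>UNIV. incidence A e $ i $ k * \<Lambda> $ i $ q)"
      by (simp add: B_def y_def extended_incidence_transpose_mult)
    also have "\<dots> = (\<Sum>i\<in>UNIV. (if i = l then A $ l $ j * \<Lambda> $ l $ q else 0) + (if i = j then - A $ l $ j * \<Lambda> $ j $ q else 0))"
      using \<open>l \<noteq> j\<close> by (intro sum.cong) (auto simp: incidence_def k)
    finally show ?thesis by (simp add: k sum.distrib algebra_simps)
  qed
  have Bs: "(B *v s) $ (i, q) = (\<Sum>j\<in>UNIV. A $ i $ j *\<^sub>R \<sigma> i j) $ q" for i q
  proof -
    have "(B *v s) $ (i, q) = (\<Sum>k\<in>UNIV. incidence A e $ i $ k * (case e k of (l, j) \<Rightarrow> \<sigma> l j $ q))"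
      unfolding B_def extended_incidence_mult by (simp add: s_def)
    also have "\<dots> = (\<Sum>j\<in>UNIV. A $ i $ j * \<sigma> i j $ q)"
      by (rule sum_incidence) (metis anti vector_uminus_component)
    finally show ?thesis by simp
  qed
  have "norm (transpose B *v y) \<le> s \<bullet> (transpose B *v y)"
  proof -
    have "\<bar>(transpose B *v y) $ (k, q)\<bar> \<le> s $ (k, q) * (transpose B *v y) $ (k, q)" for k q
    proof -
      obtain l j where k: "e k = (l, j)" by (cases "e k")
      have "0 \<le> A $ l $ j" using graph by (simp add: connected_weighted_graph_def)
      then show ?thesis
        using mult_left_mono[OF sign[of l q j]] by (simp add: w s_def k abs_mult mult_ac)
    qed
    then have "(\<Sum>p\<in>UNIV. \<bar>(transpose B *v y) $ p\<bar>) \<le> s \<bullet> (transpose B *v y)"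
      unfolding inner_vec_def by (intro sum_mono) (auto split: prod.split)
    then show ?thesis using norm_le_l1_cart order_trans by blast
  qed
  from least_positive_eigenvalue_le_of_dual[OF nz this]
  have "least_positive_eigenvalue (transpose B ** B) \<le> (norm (B *v s))\<^sup>2" .
  also have "\<dots> = (\<Sum>i\<in>UNIV. (norm (\<Sum>j\<in>UNIV. A $ i $ j *\<^sub>R \<sigma> i j))\<^sup>2)"
    unfolding power2_norm_eq_inner inner_vec_def[of "B *v s"] sum_prod_UNIV Bs
    by (simp add: inner_vec_def)
  finally show "least_positive_eigenvalue (transpose B ** B) \<le> (\<Sum>i\<in>UNIV. (norm (\<Sum>j\<in>UNIV. A $ i $ j *\<^sub>R \<sigma> i j))\<^sup>2)" .
qed

end

section \<open>Filippov velocities\<close>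

text \<open>A nonzero derivative would isolate \<open>t\<close> among the zeros of \<open>w\<close>,
  while almost every zero is approached closely by other zeros. No regularity of \<open>w\<close>
  away from \<open>t\<close> enters.\<close>

lemma zero_derivative_ae_on_zeros:
  fixes w :: "real \<Rightarrow> real"
  obtains N where "negligible N"
    and "\<And>t D. t \<notin> N \<Longrightarrow> w t = 0 \<Longrightarrow> (w has_real_derivative D) (at t) \<Longrightarrow> D = 0"
proof -
  obtain N where N: "negligible N"
    and acc: "\<And>t \<epsilon>. t \<in> {t. w t = 0} \<Longrightarrow> t \<notin> N \<Longrightarrow> 0 < \<epsilon> \<Longrightarrow>
      \<exists>\<delta>>0. \<forall>s. \<bar>s - t\<bar> < \<delta> \<longrightarrow> (\<exists>s'\<in>{t. w t = 0}. \<bar>s' - s\<bar> \<le> \<epsilon> * \<bar>s - t\<bar>)"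
    by (rule ae_infdist_small[of "{t. w t = 0}"]) blast
  show thesis
  proof (rule that[OF N], rule ccontr)
    fix t D assume t: "t \<notin> N" "w t = 0" and D: "(w has_real_derivative D) (at t)" "D \<noteq> 0"
    obtain d where d: "d > 0" "\<And>s. \<bar>s - t\<bar> < d \<Longrightarrow> \<bar>w s - w t - D * (s - t)\<bar> \<le> \<bar>D\<bar> / 2 * \<bar>s - t\<bar>"
      using D unfolding has_field_derivative_def has_derivative_at_alt
      by (metis real_norm_def zero_less_abs_iff half_gt_zero)
    obtain \<delta> where \<delta>: "\<delta> > 0" "\<And>s. \<bar>s - t\<bar> < \<delta> \<Longrightarrow> \<exists>s'\<in>{t. w t = 0}. \<bar>s' - s\<bar> \<le> 1 / 2 * \<bar>s - t\<bar>"
      using acc[of t "1 / 2"] t by auto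
    \<comment> \<open>The zero found near \<open>t + h\<close> lies between \<open>t + h / 2\<close>
      and \<open>t + 3 * h / 2\<close>, so it differs from \<open>t\<close> and is still within
      \<open>d\<close> of it.\<close>
    define h where "h = min \<delta> d / 2"
    have h: "0 < h" "h < \<delta>" "h \<le> d / 2" using d(1) \<delta>(1) by (auto simp: h_def)
    obtain s where s: "w s = 0" "\<bar>s - (t + h)\<bar> \<le> 1 / 2 * h"
      using \<delta>(2)[of "t + h"] h by auto
    have "s \<noteq> t" "\<bar>s - t\<bar> < d" using s(2) h by (auto simp: abs_if split: if_splits)
    then have "\<bar>D\<bar> * \<bar>s - t\<bar> \<le> \<bar>D\<bar> / 2 * \<bar>s - t\<bar>"
      using d(2)[of s] s(1) t(2) by (simp add: abs_mult)
    then show False using \<open>s \<noteq> t\<close> D(2) by simp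
  qed
qed

lemma negligible_of_AE:
  fixes P :: "'a::euclidean_space \<Rightarrow> bool"
  assumes "AE x in lebesgue. P x"
  shows "negligible {x. \<not> P x}"
proof -
  obtain N where "N \<in> null_sets lebesgue" "{x. \<not> P x} \<subseteq> N"
    using assms unfolding eventually_ae_filter by auto
  then show ?thesis using negligible_subset negligible_iff_null_sets by blast
qed

text \<open>At zeros of \<open>w\<close> the value of \<sigma> is left free, since
  \<open>D = 0\<close> there. This is what lets an arbitrary Filippov selection be used.\<close>

lemma DERIV_abs_sign:
  fixes w :: "real \<Rightarrow> real"
  assumes D: "(w has_real_derivative D) (at t)"
    and \<sigma>: "0 < w t \<Longrightarrow> \<sigma> = 1" "w t < 0 \<Longrightarrow> \<sigma> = - 1" "w t = 0 \<Longrightarrow> D = 0"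
  shows "((\<lambda>s. \<bar>w s\<bar>) has_real_derivative \<sigma> * D) (at t)"
proof (cases "w t = 0")
  case True
  then have "D = 0" by (rule \<sigma>)
  with D True have "\<And>e. 0 < e \<Longrightarrow> \<exists>d>0. \<forall>s. \<bar>s - t\<bar> < d \<longrightarrow> \<bar>w s\<bar> \<le> e * \<bar>s - t\<bar>"
    unfolding has_field_derivative_def has_derivative_at_alt by simp
  then show ?thesis
    unfolding has_field_derivative_def has_derivative_at_alt using True \<open>D = 0\<close>
    by (simp add: bounded_linear_mult_right)
next
  case False
  have "isCont w t" using D by (rule DERIV_isCont)
  show ?thesis
  proof (cases "0 < w t")
    case True
    have "\<forall>\<^sub>F s in nhds t. 0 < w s"
      using \<open>isCont w t\<close> True by (metis isCont_def order_tendstoD(1) tendsto_at_iff_tendsto_nhds)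
    then have "\<forall>\<^sub>F s in nhds t. \<bar>w s\<bar> = w s" by eventually_elim simp
    then show ?thesis using D \<sigma>(1)[OF True] by (simp add: DERIV_cong_ev[OF refl _ refl])
  next
    case neg: False
    with False have neg: "w t < 0" by simp
    have "\<forall>\<^sub>F s in nhds t. w s < 0"
      using \<open>isCont w t\<close> neg by (metis isCont_def order_tendstoD(2) tendsto_at_iff_tendsto_nhds)
    then have "\<forall>\<^sub>F s in nhds t. \<bar>w s\<bar> = - w s" by eventually_elim simp
    then show ?thesis using DERIV_minus[OF D] \<sigma>(2)[OF neg] by (simp add: DERIV_cong_ev[OF refl _ refl])
  qed
qed

text \<open>One radius and one null set suffice to confine an element of the Filippov map;
  closedness and convexity of \<open>C\<close> absorb the closure and the hull.\<close>

lemma filippov_map_in_closed_convex: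
  assumes v: "v \<in> filippov_map h t x" and "0 < r" "negligible N" "convex C" "closed C"
    and C: "\<And>y. y \<in> ball x r \<Longrightarrow> y \<notin> N \<Longrightarrow> h t y \<in> C"
  shows "v \<in> C"
proof -
  have "v \<in> closure (convex hull (h t ` (ball x r - N)))"
    using v assms(2,3) by (auto simp: filippov_map_def)
  also have "\<dots> \<subseteq> C"
    using assms(4,5) C by (intro closure_minimal hull_minimal) auto
  finally show ?thesis .
qed

text \<open>Surjectivity of \<open>L\<close> makes preimages of null sets null, and nonexpansiveness
  sends balls into balls of the same radius. It is meant for the projection onto a single internal
  state.\<close>

lemma filippov_map_semiconjugate:
  fixes L :: "'a::euclidean_space \<Rightarrow> 'b::euclidean_space"
  assumes L: "linear L" and g: "linear g" "\<And>u. L (g u) = u" and nonexp: "\<And>y. norm (L y) \<le> norm y"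
    and sc: "\<And>y. L (h t y) = k t (L y)"
    and v: "v \<in> filippov_map h t x"
  shows "L v \<in> filippov_map k t (L x)"
  unfolding filippov_map_def
proof (intro INT_I)
  fix r :: real and N :: "'b set" assume "r \<in> {0<..}" "N \<in> {N. negligible N}"
  then have rN: "0 < r" "negligible N" by auto
  let ?C = "closure (convex hull (k t ` (ball (L x) r - N)))"
  have "v \<in> L -` ?C"
  proof (rule filippov_map_in_closed_convex[OF v rN(1)])
    show "negligible (L -` N)" by (rule negligible_vimage_linear_surjection[OF L g rN(2)])
    show "convex (L -` ?C)" by (intro convex_linear_vimage L convex_closure convex_convex_hull)
    show "closed (L -` ?C)"
      by (intro closed_vimage closed_closure linear_continuous_on) (use L linear_conv_bounded_linear in blast)
    fix y assume y: "y \<in> ball x r" "y \<notin> L -` N"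
    have "dist (L x) (L y) \<le> dist x y"
      using nonexp[of "x - y"] by (simp add: dist_norm linear_diff[OF L])
    then have "L y \<in> ball (L x) r - N" using y by auto
    then have "k t (L y) \<in> k t ` (ball (L x) r - N)" by (rule imageI)
    then show "h t y \<in> L -` ?C"
      using hull_subset[of "k t ` (ball (L x) r - N)" convex] closure_subset by (auto simp: sc)
  qed
  then show "L v \<in> ?C" by simp
qed

lemma filippov_solution_semiconjugate:
  fixes L :: "'a::euclidean_space \<Rightarrow> 'b::euclidean_space"
  assumes L: "linear L" and g: "linear g" "\<And>u. L (g u) = u" and nonexp: "\<And>y. norm (L y) \<le> norm y"
    and sc: "\<And>t y. L (h t y) = k t (L y)"
    and x: "filippov_solution h x"
  shows "filippov_solution k (\<lambda>t. L (x t))"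
  unfolding filippov_solution_def
proof (intro conjI allI impI)
  fix b :: real assume "0 \<le> b"
  then have "absolutely_continuous_on 0 b x" using x by (simp add: filippov_solution_def)
  then show "absolutely_continuous_on 0 b (\<lambda>t. L (x t))"
  proof (rule absolutely_continuous_on_dominated)
    fix u v :: real assume "u \<le> v"
    have "dist (L (x u)) (L (x v)) \<le> dist (x u) (x v)"
      using nonexp[of "x u - x v"] by (simp add: dist_norm linear_diff[OF L])
    with \<open>u \<le> v\<close> show "dist (L (x u)) (L (x v)) \<le> 1 * (dist (x u) (x v) + (v - u))" by simp
  qed simp
next
  have bl: "bounded_linear L" using L by (simp add: linear_conv_bounded_linear)
  have "AE t in lebesgue. 0 \<le> t \<longrightarrow> (\<exists>v. (x has_vector_derivative v) (at t) \<and> v \<in> filippov_map h t (x t))"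
    using x by (simp add: filippov_solution_def)
  then show "AE t in lebesgue. 0 \<le> t \<longrightarrow>
      (\<exists>v. ((\<lambda>t. L (x t)) has_vector_derivative v) (at t) \<and> v \<in> filippov_map k t (L (x t)))"
  proof (rule AE_mp, intro AE_I2 impI)
    fix t :: real
    assume "0 \<le> t \<longrightarrow> (\<exists>v. (x has_vector_derivative v) (at t) \<and> v \<in> filippov_map h t (x t))" "0 \<le> t"
    then obtain v where v: "(x has_vector_derivative v) (at t)" "v \<in> filippov_map h t (x t)" by blast
    have "((\<lambda>t. L (x t)) has_vector_derivative L v) (at t)"
      by (rule bounded_linear.has_vector_derivative[OF bl v(1)])
    moreover have "L v \<in> filippov_map k t (L (x t))"
      by (rule filippov_map_semiconjugate[where h = h and k = k and t = t and x = "x t", OF L g nonexp sc v(2)])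
    ultimately show "\<exists>v. ((\<lambda>t. L (x t)) has_vector_derivative v) (at t) \<and> v \<in> filippov_map k t (L (x t))"
      by blast
  qed
qed

text \<open>Convexified sign patterns: where two components agree, any value in
  \<open>[-1, 1]\<close> is allowed, but antisymmetry is retained, since the hull averages all
  entries with the same weights. The value for a negative difference follows from
  antisymmetry.\<close>

definition sign_selections :: "(real^'n)^'N \<Rightarrow> ((real^'n)^'N^'N) set" where
  "sign_selections l = {\<sigma>. \<forall>i j q. \<sigma> $ i $ j $ q = - \<sigma> $ j $ i $ q \<and> \<bar>\<sigma> $ i $ j $ q\<bar> \<le> 1 \<and>
     (l $ j $ q < l $ i $ q \<longrightarrow> \<sigma> $ i $ j $ q = 1)}"

lemma sign_selectionsD:
  assumes "\<sigma> \<in> sign_selections l"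
  shows sign_selections_antisym: "\<sigma> $ i $ j $ q = - \<sigma> $ j $ i $ q"
    and sign_selections_abs_le: "\<bar>\<sigma> $ i $ j $ q\<bar> \<le> 1"
    and sign_selections_eq_1: "l $ j $ q < l $ i $ q \<Longrightarrow> \<sigma> $ i $ j $ q = 1"
proof -
  note * = assms[unfolded sign_selections_def mem_Collect_eq, rule_format, of i j q]
  show "\<sigma> $ i $ j $ q = - \<sigma> $ j $ i $ q" by (rule *[THEN conjunct1])
  show "\<bar>\<sigma> $ i $ j $ q\<bar> \<le> 1" by (rule *[THEN conjunct2, THEN conjunct1])
  show "l $ j $ q < l $ i $ q \<Longrightarrow> \<sigma> $ i $ j $ q = 1" by (rule *[THEN conjunct2, THEN conjunct2, rule_format])
qed

lemma norm_vec_le_sum: "norm (x :: ('a::real_normed_vector)^'n) \<le> (\<Sum>i\<in>UNIV. norm (x $ i))"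
  unfolding norm_vec_def by (rule L2_set_le_sum) simp

lemma compact_sign_selections: "compact (sign_selections l)"
proof (rule compact_eq_bounded_closed[THEN iffD2], intro conjI)
  have "norm \<sigma> \<le> (\<Sum>i\<in>(UNIV::'b set). \<Sum>j\<in>(UNIV::'b set). \<Sum>q\<in>(UNIV::'a set). 1)" if "\<sigma> \<in> sign_selections l" for \<sigma>
  proof -
    have "norm \<sigma> \<le> (\<Sum>i\<in>UNIV. norm (\<sigma> $ i))" by (rule norm_vec_le_sum)
    also have "\<dots> \<le> (\<Sum>i\<in>UNIV. \<Sum>j\<in>UNIV. norm (\<sigma> $ i $ j))"
      by (intro sum_mono norm_vec_le_sum)
    also have "\<dots> \<le> (\<Sum>i\<in>UNIV. \<Sum>j\<in>UNIV. \<Sum>q\<in>UNIV. norm (\<sigma> $ i $ j $ q))"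
      by (intro sum_mono norm_vec_le_sum)
    also have "\<dots> \<le> (\<Sum>i\<in>(UNIV::'b set). \<Sum>j\<in>(UNIV::'b set). \<Sum>q\<in>(UNIV::'a set). 1)"
      using sign_selections_abs_le[OF that] by (intro sum_mono) simp
    finally show ?thesis .
  qed
  then show "bounded (sign_selections l)" unfolding bounded_iff by blast
  show "closed (sign_selections l)"
    unfolding sign_selections_def
    by (intro closed_Collect_all closed_Collect_conj closed_Collect_imp closed_Collect_eq closed_Collect_le
        open_Collect_const continuous_intros)
qed

lemma convex_sign_selections: "convex (sign_selections l)"
proof (rule convexI)
  fix \<sigma> \<tau> u v assume st: "\<sigma> \<in> sign_selections l" "\<tau> \<in> sign_selections l" and uv: "0 \<le> u" "0 \<le> v" "u + v = (1::real)"
  show "u *\<^sub>R \<sigma> + v *\<^sub>R \<tau> \<in> sign_selections l"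
    unfolding sign_selections_def
  proof (intro CollectI allI conjI impI)
    fix i j q
    have \<sigma>: "\<sigma> $ i $ j $ q = - \<sigma> $ j $ i $ q" "\<bar>\<sigma> $ i $ j $ q\<bar> \<le> 1" "l $ j $ q < l $ i $ q \<Longrightarrow> \<sigma> $ i $ j $ q = 1"
      by (rule sign_selectionsD[OF st(1)], assumption?)+
    have \<tau>: "\<tau> $ i $ j $ q = - \<tau> $ j $ i $ q" "\<bar>\<tau> $ i $ j $ q\<bar> \<le> 1" "l $ j $ q < l $ i $ q \<Longrightarrow> \<tau> $ i $ j $ q = 1"
      by (rule sign_selectionsD[OF st(2)], assumption?)+
    have "u * \<sigma> $ i $ j $ q + v * \<tau> $ i $ j $ q = - (u * \<sigma> $ j $ i $ q + v * \<tau> $ j $ i $ q)"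
      by (subst \<sigma>(1), subst \<tau>(1)) simp
    then show "(u *\<^sub>R \<sigma> + v *\<^sub>R \<tau>) $ i $ j $ q = - (u *\<^sub>R \<sigma> + v *\<^sub>R \<tau>) $ j $ i $ q"
      by simp
    have "\<bar>u * \<sigma> $ i $ j $ q + v * \<tau> $ i $ j $ q\<bar> \<le> u * \<bar>\<sigma> $ i $ j $ q\<bar> + v * \<bar>\<tau> $ i $ j $ q\<bar>"
      using abs_triangle_ineq[of "u * \<sigma> $ i $ j $ q" "v * \<tau> $ i $ j $ q"] uv by (simp add: abs_mult)
    also have "\<dots> \<le> u * 1 + v * 1" using uv by (intro add_mono mult_left_mono \<sigma>(2) \<tau>(2))
    finally show "\<bar>(u *\<^sub>R \<sigma> + v *\<^sub>R \<tau>) $ i $ j $ q\<bar> \<le> 1" using uv by simp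
    assume "l $ j $ q < l $ i $ q"
    then have "\<sigma> $ i $ j $ q = 1" "\<tau> $ i $ j $ q = 1" by (rule \<sigma>(3), rule \<tau>(3))
    then show "(u *\<^sub>R \<sigma> + v *\<^sub>R \<tau>) $ i $ j $ q = 1" using uv by simp
  qed
qed

text \<open>The neighbourhood is a Minkowski sum written as a double union, the form to which
  \<open>convex_sums\<close> and \<open>compact_sums'\<close> apply.\<close>

lemma mem_all_neighbourhoods_of_compact:
  fixes D :: "'a::euclidean_space set"
  assumes D: "compact D" and x: "\<And>\<eta>. 0 < \<eta> \<Longrightarrow> x \<in> (\<Union>a\<in>D. \<Union>b\<in>cball 0 \<eta>. {a + b})"
  shows "x \<in> D"
proof -
  have "x \<in> closure D"
    unfolding closure_approachable
  proof (intro allI impI)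
    fix e :: real assume "0 < e"
    then obtain a b where "a \<in> D" "b \<in> cball 0 (e / 2)" "x = a + b" using x[of "e / 2"] by auto
    with \<open>0 < e\<close> show "\<exists>y\<in>D. dist y x < e" by (intro bexI[of _ a]) (auto simp: dist_norm)
  qed
  then show ?thesis using D by (simp add: compact_imp_closed)
qed

lemma tendsto_nhds_of_continuous:
  fixes f :: "'a::t2_space \<Rightarrow> 'b::topological_space"
  assumes "continuous_on UNIV f"
  shows "(f \<longlongrightarrow> f x) (nhds x)"
  using assms unfolding continuous_on_eq_continuous_at[OF open_UNIV] isCont_def tendsto_at_iff_tendsto_nhds by blast

lemma norm_sgn_vec_le: "norm (sgn_vec (v :: real^'n)) \<le> real CARD('n)"
proof -
  have "norm (sgn_vec v) \<le> (\<Sum>q\<in>UNIV. \<bar>sgn_vec v $ q\<bar>)" by (rule norm_le_l1_cart)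
  also have "\<dots> \<le> (\<Sum>q\<in>(UNIV::'n set). 1)" by (intro sum_mono) (simp add: sgn_vec_def abs_sgn_eq)
  finally show ?thesis by simp
qed

text \<open>
  Boundedness of \<open>\<phi>\<close> near the state makes the error from freezing \<open>\<H>\<close> and \<open>\<g>\<close> at the state
  uniformly small, so that the combination \<open>fst v - \<H> (snd v)\<close>, in which \<open>\<phi>\<close> cancels, lies in
  every neighbourhood of a compact convex set parametrised by the sign selections.
\<close>

lemma filippov_map_sign_coupling:
  fixes \<H> :: "'N::finite \<Rightarrow> real^'n \<Rightarrow> real^'n^'n" and \<g> :: "'N \<Rightarrow> real^'n \<Rightarrow> real^'n"
    and c :: "'N \<Rightarrow> real^'n" and A :: "real^'N^'N"
  assumes contH: "\<And>i. continuous_on UNIV (\<H> i)" and contg: "\<And>i. continuous_on UNIV (\<g> i)"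
    and bdd: "\<And>i. locally_essentially_bounded (\<phi> i)"
    and h: "\<And>l z. h t (l, z) =
      (\<chi> i. \<H> i (l $ i) *v (c i - \<phi> i (z $ i) - \<alpha> *\<^sub>R (\<Sum>j\<in>UNIV. A $ i $ j *\<^sub>R sgn_vec (l $ i - l $ j))) + \<g> i (l $ i),
       \<chi> i. - \<phi> i (z $ i))"
    and v: "v \<in> filippov_map h t (l0, z0)"
  obtains \<sigma> where "\<sigma> \<in> sign_selections l0"
    and "\<And>i. fst v $ i = \<H> i (l0 $ i) *v (snd v $ i + c i - \<alpha> *\<^sub>R (\<Sum>j\<in>UNIV. A $ i $ j *\<^sub>R \<sigma> $ i $ j)) + \<g> i (l0 $ i)"
proof -
  have "\<exists>r M. 0 < r \<and> (AE y in lebesgue. y \<in> ball (z0 $ i) r \<longrightarrow> norm (\<phi> i y) \<le> M)" for i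
    using bdd[of i] unfolding locally_essentially_bounded_def by blast
  then have "\<forall>i. \<exists>r M. 0 < r \<and> (AE y in lebesgue. y \<in> ball (z0 $ i) r \<longrightarrow> norm (\<phi> i y) \<le> M)" ..
  from choice[OF this] obtain r
    where "\<forall>i. \<exists>M. 0 < r i \<and> (AE y in lebesgue. y \<in> ball (z0 $ i) (r i) \<longrightarrow> norm (\<phi> i y) \<le> M)" ..
  from choice[OF this] obtain M
    where rM: "\<forall>i. 0 < r i \<and> (AE y in lebesgue. y \<in> ball (z0 $ i) (r i) \<longrightarrow> norm (\<phi> i y) \<le> M i)" ..
  have r: "0 < r i" and M: "AE y in lebesgue. y \<in> ball (z0 $ i) (r i) \<longrightarrow> norm (\<phi> i y) \<le> M i" for i
    using rM[rule_format, of i] by (rule conjunct1, rule conjunct2)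
  define N where "N i = {y. \<not> (y \<in> ball (z0 $ i) (r i) \<longrightarrow> norm (\<phi> i y) \<le> M i)}" for i
  have N: "negligible (N i)" for i
    unfolding N_def by (rule negligible_of_AE[OF M])
  \<comment> \<open>The bound on \<open>\<phi> i\<close> holds off a null set of internal states,
    which is pulled back to a null set of full states.\<close>
  define NN where "NN = (\<Union>i. (\<lambda>p :: ((real^'n)^'N) \<times> ((real^'n)^'N). snd p $ i) -` N i)"
  have NN: "negligible NN"
    unfolding NN_def
  proof (intro negligible_countable_Union countable_image ballI countable_finite finite, clarify)
    fix i
    show "negligible ((\<lambda>p :: ((real^'n)^'N) \<times> ((real^'n)^'N). snd p $ i) -` N i)"
      by (rule negligible_vimage_linear_surjection[where g = "\<lambda>u. (0, axis i u)", OF _ _ _ N])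
        (auto intro!: linearI simp: vec_eq_iff axis_def)
  qed
  define T where "T \<sigma> = (\<chi> i. \<H> i (l0 $ i) *v (c i - \<alpha> *\<^sub>R (\<Sum>j\<in>UNIV. A $ i $ j *\<^sub>R \<sigma> $ i $ j)) + \<g> i (l0 $ i))" for \<sigma> :: "(real^'n)^'N^'N"
  \<comment> \<open>The Hessian is the one at the centre \<open>l0\<close>, so \<open>L\<close> is a
    fixed linear map; at a nearby state \<open>\<phi>\<close> cancels up to the difference of the
    two Hessians.\<close>
  define L where "L w = (\<chi> i. fst w $ i - \<H> i (l0 $ i) *v (snd w $ i))" for w :: "((real^'n)^'N) \<times> ((real^'n)^'N)"
  have linL: "linear L"
    by (rule linearI) (simp_all add: L_def vec_eq_iff matrix_vector_right_distrib matrix_vector_mult_scaleR algebra_simps)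
  define D where "D = T ` sign_selections l0"
  have "compact D"
    unfolding D_def T_def
    by (intro compact_continuous_image compact_sign_selections continuous_intros)
  have "convex D"
  proof -
    have add: "(\<Sum>j\<in>UNIV. A $ i $ j *\<^sub>R (\<sigma> + \<tau>) $ i $ j) =
        (\<Sum>j\<in>UNIV. A $ i $ j *\<^sub>R \<sigma> $ i $ j) + (\<Sum>j\<in>UNIV. A $ i $ j *\<^sub>R \<tau> $ i $ j)" for \<sigma> \<tau> :: "(real^'n)^'N^'N" and i
      by (simp add: scaleR_add_right sum.distrib)
    have scale: "(\<Sum>j\<in>UNIV. A $ i $ j *\<^sub>R (k *\<^sub>R \<sigma>) $ i $ j) = k *\<^sub>R (\<Sum>j\<in>UNIV. A $ i $ j *\<^sub>R \<sigma> $ i $ j)"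
      for \<sigma> :: "(real^'n)^'N^'N" and i k
      by (simp add: scaleR_sum_right mult.commute)
    \<comment> \<open>\<open>T\<close> is affine rather than linear, so its value at 0 is subtracted
      and restored by a translation.\<close>
    have "linear (\<lambda>\<sigma>. T \<sigma> - T 0)"
      unfolding T_def
      by (rule linearI; unfold add scale vec_eq_iff)
        (simp_all add: matrix_vector_mult_diff_distrib matrix_vector_right_distrib matrix_vector_mult_scaleR algebra_simps)
    then have "convex ((\<lambda>\<sigma>. T \<sigma> - T 0) ` sign_selections l0)"
      by (rule convex_linear_image) (rule convex_sign_selections)
    then have "convex ((\<lambda>x. T 0 + x) ` ((\<lambda>\<sigma>. T \<sigma> - T 0) ` sign_selections l0))"
      by (rule convex_translation)
    then show ?thesis by (simp add: image_image D_def)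
  qed
  have "L v \<in> D"
  proof (rule mem_all_neighbourhoods_of_compact[OF \<open>compact D\<close>])
    fix \<eta> :: real assume \<eta>: "0 < \<eta>"
    let ?C = "\<Union>a\<in>D. \<Union>b\<in>cball 0 \<eta>. {a + b}"
    define S where "S i = (\<Sum>j\<in>UNIV. \<bar>A $ i $ j\<bar> * real CARD('n))" for i
    \<comment> \<open>A bound, uniform near the state, for the vector on which the Hessian acts; it
      is here that \<open>\<phi>\<close> must be bounded.\<close>
    define Kc where "Kc i = norm (c i) + M i + \<bar>\<alpha>\<bar> * S i" for i
    define err where "err i l = norm (\<H> i l - \<H> i (l0 $ i)) * Kc i + norm (\<g> i l - \<g> i (l0 $ i))" for i l
    \<comment> \<open>Besides the smallness of the error, strict inequalities between components at
      \<open>l0\<close> must persist at \<open>l\<close>, so that the actual signs at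
      \<open>l\<close> form a selection for \<open>l0\<close>.\<close>
    have ev: "\<forall>\<^sub>F l in nhds l0. (\<forall>i. err i (l $ i) < \<eta> / CARD('N)) \<and>
        (\<forall>i j q. l0 $ j $ q < l0 $ i $ q \<longrightarrow> l $ j $ q < l $ i $ q)"
    proof (intro eventually_conj eventually_all_finite)
      fix i
      have "((\<lambda>l. err i (l $ i)) \<longlongrightarrow> err i (l0 $ i)) (nhds l0)"
        unfolding err_def
        by (rule tendsto_nhds_of_continuous)
          (intro continuous_intros continuous_on_compose2[OF contH] continuous_on_compose2[OF contg], auto)
      moreover have "err i (l0 $ i) < \<eta> / CARD('N)" using \<eta> by (simp add: err_def)
      ultimately show "\<forall>\<^sub>F l in nhds l0. err i (l $ i) < \<eta> / CARD('N)" by (rule order_tendstoD(2))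
    next
      fix i j q
      have "((\<lambda>l. l $ i $ q - l $ j $ q) \<longlongrightarrow> l0 $ i $ q - l0 $ j $ q) (nhds l0)"
        by (rule tendsto_nhds_of_continuous) (intro continuous_intros)
      then show "\<forall>\<^sub>F l in nhds l0. l0 $ j $ q < l0 $ i $ q \<longrightarrow> l $ j $ q < l $ i $ q"
        by (cases "l0 $ j $ q < l0 $ i $ q") (auto dest!: order_tendstoD(1)[where a = 0])
    qed
    then obtain d where d: "d > 0" "\<And>l. dist l l0 < d \<Longrightarrow> (\<forall>i. err i (l $ i) < \<eta> / CARD('N)) \<and>
        (\<forall>i j q. l0 $ j $ q < l0 $ i $ q \<longrightarrow> l $ j $ q < l $ i $ q)"
      unfolding eventually_nhds_metric by blast
    define \<rho> where "\<rho> = min d (Min (range r))"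
    have \<rho>: "0 < \<rho>" using d(1) r by (simp add: \<rho>_def)
    have "v \<in> L -` ?C"
    proof (rule filippov_map_in_closed_convex[OF v \<rho> NN])
      show "convex (L -` ?C)"
        by (intro convex_linear_vimage linL convex_sums \<open>convex D\<close> convex_cball)
      show "closed (L -` ?C)"
        using linL by (intro closed_vimage compact_imp_closed compact_sums' \<open>compact D\<close> compact_cball linear_continuous_on)
          (simp add: linear_conv_bounded_linear)
      fix y assume y: "y \<in> ball (l0, z0) \<rho>" "y \<notin> NN"
      obtain l z where yl: "y = (l, z)" by (cases y)
      have dl: "dist l l0 < d" "\<And>i. dist (z $ i) (z0 $ i) < r i"
      proof -
        have "dist (l0, z0) (l, z) < \<rho>" using y yl by simp
        then have "dist l0 l < \<rho>" "dist z0 z < \<rho>"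
          using dist_fst_le[of "(l0, z0)" "(l, z)"] dist_snd_le[of "(l0, z0)" "(l, z)"] by auto
        then show "dist l l0 < d" by (simp add: \<rho>_def dist_commute)
        fix i
        have "dist (z $ i) (z0 $ i) \<le> dist z0 z" by (metis dist_commute dist_vec_nth_le)
        also have "\<dots> < \<rho>" by fact
        also have "\<rho> \<le> r i" by (simp add: \<rho>_def min.coboundedI2)
        finally show "dist (z $ i) (z0 $ i) < r i" .
      qed
      have \<phi>M: "norm (\<phi> i (z $ i)) \<le> M i" for i
        using y(2) dl(2)[of i] by (auto simp: NN_def N_def yl dist_commute)
      define \<sigma> where "\<sigma> = (\<chi> i j. sgn_vec (l $ i - l $ j))"
      have \<sigma>: "\<sigma> \<in> sign_selections l0"
        using d(2)[OF dl(1)] by (auto simp: sign_selections_def \<sigma>_def sgn_vec_def abs_sgn_eq sgn_if)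
      have "norm (L (h t y) - T \<sigma>) \<le> \<eta>"
      proof -
        have "norm ((L (h t y) - T \<sigma>) $ i) \<le> \<eta> / CARD('N)" for i
        proof -
          define s where "s = (\<Sum>j\<in>UNIV. A $ i $ j *\<^sub>R sgn_vec (l $ i - l $ j))"
          have s: "norm s \<le> S i"
            unfolding s_def S_def
            by (intro sum_norm_le) (auto intro!: mult_left_mono norm_sgn_vec_le)
          define u where "u = c i - \<phi> i (z $ i) - \<alpha> *\<^sub>R s"
          have "norm u \<le> norm (c i) + norm (\<phi> i (z $ i)) + norm (\<alpha> *\<^sub>R s)"
            unfolding u_def by (intro order_trans[OF norm_triangle_ineq4] add_right_mono norm_triangle_ineq4)
          also have "\<dots> \<le> Kc i"
            unfolding Kc_def using s by (intro add_mono \<phi>M order_refl) (auto intro: mult_left_mono)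
          finally have u: "norm u \<le> Kc i" .
          have "(L (h t y) - T \<sigma>) $ i = (\<H> i (l $ i) - \<H> i (l0 $ i)) *v u + (\<g> i (l $ i) - \<g> i (l0 $ i))"
            unfolding yl h L_def T_def u_def s_def \<sigma>_def
            by (simp add: matrix_vector_mult_diff_rdistrib matrix_vector_mult_diff_distrib
                matrix_vector_right_distrib linear_neg[OF matrix_vector_mul_linear] algebra_simps)
          also have "norm \<dots> \<le> norm (\<H> i (l $ i) - \<H> i (l0 $ i)) * norm u + norm (\<g> i (l $ i) - \<g> i (l0 $ i))"
            by (intro norm_triangle_mono norm_matrix_vector_mult_le order_refl)
          also have "\<dots> \<le> err i (l $ i)"
            unfolding err_def using u by (intro add_right_mono mult_left_mono) auto
          also have "\<dots> \<le> \<eta> / CARD('N)" using d(2)[OF dl(1)] by (auto intro: less_imp_le)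
          finally show ?thesis .
        qed
        then have "(\<Sum>i\<in>UNIV. norm ((L (h t y) - T \<sigma>) $ i)) \<le> (\<Sum>i\<in>(UNIV::'N set). \<eta> / CARD('N))"
          by (intro sum_mono)
        also have "\<dots> = \<eta>" by simp
        finally show ?thesis using norm_vec_le_sum order_trans by blast
      qed
      then have "L (h t y) - T \<sigma> \<in> cball 0 \<eta>" by simp
      moreover have "T \<sigma> \<in> D" using \<sigma> by (simp add: D_def)
      moreover have "L (h t y) = T \<sigma> + (L (h t y) - T \<sigma>)" by simp
      ultimately show "h t y \<in> L -` ?C" unfolding vimage_eq by blast
    qed
    then show "L v \<in> ?C" by simp
  qed
  then obtain \<sigma> where \<sigma>: "\<sigma> \<in> sign_selections l0" "L v = T \<sigma>" by (auto simp: D_def)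
  show thesis
  proof (rule that[OF \<sigma>(1)])
    fix i
    have "L v $ i = T \<sigma> $ i" using \<sigma>(2) by simp
    then show "fst v $ i = \<H> i (l0 $ i) *v (snd v $ i + c i - \<alpha> *\<^sub>R (\<Sum>j\<in>UNIV. A $ i $ j *\<^sub>R \<sigma> $ i $ j)) + \<g> i (l0 $ i)"
      by (simp add: L_def T_def matrix_vector_right_distrib matrix_vector_mult_diff_distrib algebra_simps)
  qed
qed

text \<open>Young's inequality in the metric of the \<open>Q i\<close>, with parameter \<beta>. The
  equation for \<beta> makes the upper bound on the \<open>p\<close> term equal to
  \<open>\<beta>\<^sup>2\<close> times the lower bound on the \<open>s\<close> term, so the mixed
  term is at most \<beta> times the \<open>s\<close> term and the surplus
  \<open>\<alpha> - \<beta>\<close> gives the decay.\<close>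

lemma quadratic_descent:
  fixes Q :: "'N::finite \<Rightarrow> real^'n^'n" and s p :: "'N \<Rightarrow> real^'n"
  assumes sym: "\<And>i u v. u \<bullet> (Q i *v v) = v \<bullet> (Q i *v u)"
    and lower: "\<And>i v. \<theta> * (norm v)\<^sup>2 \<le> v \<bullet> (Q i *v v)"
    and upper: "\<And>i v. v \<bullet> (Q i *v v) \<le> \<Theta> * (norm v)\<^sup>2"
    and \<theta>: "0 < \<theta>" and p: "\<And>i. norm (p i) \<le> P"
    and \<mu>: "0 < \<mu>" "\<mu> \<le> (\<Sum>i\<in>UNIV. (norm (s i))\<^sup>2)"
    and \<beta>: "0 < \<beta>" "\<beta>\<^sup>2 * (\<theta> * \<mu>) = real CARD('N) * \<Theta> * P\<^sup>2" "\<beta> \<le> \<alpha>" and \<Theta>: "0 \<le> \<Theta>"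
  shows "(\<Sum>i\<in>UNIV. s i \<bullet> (Q i *v (p i - \<alpha> *\<^sub>R s i))) \<le> - ((\<alpha> - \<beta>) * (\<theta> * \<mu>))"
proof -
  define Qss where "Qss = (\<Sum>i\<in>UNIV. s i \<bullet> (Q i *v s i))"
  define Qsp where "Qsp = (\<Sum>i\<in>UNIV. s i \<bullet> (Q i *v p i))"
  define Qpp where "Qpp = (\<Sum>i\<in>UNIV. p i \<bullet> (Q i *v p i))"
  have "\<theta> * \<mu> \<le> \<theta> * (\<Sum>i\<in>UNIV. (norm (s i))\<^sup>2)" using \<mu> \<theta> by simp
  also have "\<dots> \<le> Qss" unfolding Qss_def sum_distrib_left by (intro sum_mono lower)
  finally have ss: "\<theta> * \<mu> \<le> Qss" .
  \<comment> \<open>Expanding this square gives the bound on the mixed term directly, without square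
    roots of the matrices.\<close>
  have "0 \<le> (\<Sum>i\<in>UNIV. (\<beta> *\<^sub>R s i - p i) \<bullet> (Q i *v (\<beta> *\<^sub>R s i - p i)))"
    using \<theta> by (intro sum_nonneg order_trans[OF _ lower]) auto
  also have "\<dots> = (\<Sum>i\<in>UNIV. \<beta>\<^sup>2 * (s i \<bullet> (Q i *v s i)) - 2 * \<beta> * (s i \<bullet> (Q i *v p i)) + p i \<bullet> (Q i *v p i))"
  proof (intro sum.cong refl)
    fix i
    have "p i \<bullet> (Q i *v s i) = s i \<bullet> (Q i *v p i)" by (rule sym)
    then show "(\<beta> *\<^sub>R s i - p i) \<bullet> (Q i *v (\<beta> *\<^sub>R s i - p i)) =
        \<beta>\<^sup>2 * (s i \<bullet> (Q i *v s i)) - 2 * \<beta> * (s i \<bullet> (Q i *v p i)) + p i \<bullet> (Q i *v p i)"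
      by (simp add: matrix_vector_mult_diff_distrib matrix_vector_mult_scaleR inner_diff_left inner_diff_right
          power2_eq_square algebra_simps)
  qed
  also have "\<dots> = \<beta>\<^sup>2 * Qss - 2 * \<beta> * Qsp + Qpp"
    by (simp add: Qss_def Qsp_def Qpp_def sum.distrib sum_subtractf sum_distrib_left)
  finally have young: "2 * \<beta> * Qsp \<le> \<beta>\<^sup>2 * Qss + Qpp" by simp
  have "Qpp \<le> (\<Sum>i\<in>(UNIV::'N set). \<Theta> * P\<^sup>2)"
    unfolding Qpp_def using \<Theta> p
    by (intro sum_mono order_trans[OF upper] mult_left_mono power_mono) auto
  also have "\<dots> = \<beta>\<^sup>2 * (\<theta> * \<mu>)" using \<beta>(2) by simp
  also have "\<dots> \<le> \<beta>\<^sup>2 * Qss" using ss by (intro mult_left_mono) auto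
  finally have "2 * \<beta> * Qsp \<le> 2 * \<beta> * (\<beta> * Qss)" using young by (simp add: power2_eq_square)
  then have "Qsp \<le> \<beta> * Qss" using \<beta>(1) by simp
  moreover have "(\<alpha> - \<beta>) * (\<theta> * \<mu>) \<le> (\<alpha> - \<beta>) * Qss" using ss \<beta>(3) by (intro mult_left_mono) auto
  moreover have "(\<Sum>i\<in>UNIV. s i \<bullet> (Q i *v (p i - \<alpha> *\<^sub>R s i))) = Qsp - \<alpha> * Qss"
    by (simp add: Qsp_def Qss_def matrix_vector_mult_diff_distrib matrix_vector_mult_scaleR inner_diff_right
        sum_subtractf sum_distrib_left)
  ultimately show ?thesis by (simp add: algebra_simps)
qed

section \<open>Conservation, consensus and optimality\<close>

locale protocol_run =
  fixes E :: "('N::{finite,linorder} \<times> 'N) set"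
    and A :: "real^'N::{finite,linorder}^'N::{finite,linorder}"
    and e :: "'m::finite \<Rightarrow> 'N \<times> 'N"
    and f :: "'N \<Rightarrow> real^'n \<Rightarrow> real \<Rightarrow> real"
    and d :: "'N \<Rightarrow> real \<Rightarrow> real^'n"
    and \<phi> :: "'N \<Rightarrow> real^'n \<Rightarrow> real^'n"
    and \<theta> \<Theta> \<kappa> \<delta> \<alpha> :: real
    and \<Lambda> Z :: "real \<Rightarrow> (real^'n)^'N::{finite,linorder}"
  assumes graph: "connected_weighted_graph E A"
    and edges: "edge_enumeration E e"
    and tracked: "\<And>i. tracked_cost (f i) \<theta> \<kappa>"
    and hessian_upper: "\<And>i x t v. 0 \<le> t \<Longrightarrow> v \<bullet> (hessian (\<lambda>y. f i y t) x *v v) \<le> \<Theta> * (norm v)\<^sup>2"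
    and gradient_cont: "\<And>i t. 0 \<le> t \<Longrightarrow> continuous_on UNIV (\<lambda>x. time_deriv (time_gradient (f i) x) t)"
    and d_diff: "\<And>i t. 0 \<le> t \<Longrightarrow> d i differentiable (at t within {0..})"
    and d_bound: "\<And>i t. 0 \<le> t \<Longrightarrow> norm (time_deriv (d i) t) \<le> \<delta>"
    and phi_bounded: "\<And>i. locally_essentially_bounded (\<phi> i)"
    and solution: "filippov_solution (protocol f d \<phi> A \<alpha>) (\<lambda>t. (\<Lambda> t, Z t))"
begin

abbreviation "X i \<equiv> primal_response (f i)"
abbreviation "\<H> t i l \<equiv> hessian (\<lambda>y. f i y t) (X i l t)"
abbreviation "\<g> t i l \<equiv> time_deriv (time_gradient (f i) (X i l t)) t"
abbreviation "net \<sigma> i \<equiv> \<Sum>j\<in>UNIV. A $ i $ j *\<^sub>R \<sigma> $ i $ j"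

lemma weights: "A $ i $ j = A $ j $ i" "0 \<le> A $ i $ j"
  using graph by (auto simp: connected_weighted_graph_def)

lemma sum_net_eq_0:
  assumes "\<sigma> \<in> sign_selections l"
  shows "(\<Sum>i\<in>UNIV. net \<sigma> i $ q) = 0"
proof -
  let ?S = "\<Sum>i\<in>UNIV. \<Sum>j\<in>UNIV. A $ i $ j * \<sigma> $ i $ j $ q"
  have "?S = (\<Sum>i\<in>UNIV. \<Sum>j\<in>UNIV. - (A $ j $ i * \<sigma> $ j $ i $ q))"
  proof (intro sum.cong refl)
    fix i j
    show "A $ i $ j * \<sigma> $ i $ j $ q = - (A $ j $ i * \<sigma> $ j $ i $ q)"
      by (subst sign_selections_antisym[OF assms], subst weights(1)) simp
  qed
  also have "\<dots> = - (\<Sum>i\<in>UNIV. \<Sum>j\<in>UNIV. A $ j $ i * \<sigma> $ j $ i $ q)" by (simp add: sum_negf)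
  also have "\<dots> = - ?S" by (subst sum.swap) (rule refl)
  finally show ?thesis by simp
qed

text \<open>Exchanging \<open>i\<close> and \<open>j\<close> changes both the sign of \<sigma> and
  that of the difference, so the two halves of the sum agree, whence the factor 2.\<close>

lemma sum_net_inner:
  assumes "\<sigma> \<in> sign_selections l"
  shows "(\<Sum>i\<in>UNIV. \<Sum>j\<in>UNIV. \<Sum>q\<in>UNIV. A $ i $ j * (\<sigma> $ i $ j $ q * (v i $ q - v j $ q))) = 2 * (\<Sum>i\<in>UNIV. net \<sigma> i \<bullet> v i)"
proof -
  let ?a = "\<lambda>i j. \<Sum>q\<in>UNIV. A $ i $ j * (\<sigma> $ i $ j $ q * v i $ q)"
  have net: "net \<sigma> i \<bullet> v i = (\<Sum>j\<in>UNIV. ?a i j)" for i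
    unfolding inner_sum_left
    by (intro sum.cong refl) (simp add: inner_vec_def sum_distrib_left mult.assoc)
  have "(\<Sum>i\<in>UNIV. \<Sum>j\<in>UNIV. \<Sum>q\<in>UNIV. A $ i $ j * (\<sigma> $ i $ j $ q * (v i $ q - v j $ q)))
      = (\<Sum>i\<in>UNIV. \<Sum>j\<in>UNIV. ?a i j + ?a j i)"
  proof (intro sum.cong refl)
    fix i j
    have "A $ i $ j * (\<sigma> $ i $ j $ q * (v i $ q - v j $ q)) =
        A $ i $ j * (\<sigma> $ i $ j $ q * v i $ q) + A $ j $ i * (\<sigma> $ j $ i $ q * v j $ q)" for q
      by (subst (2) sign_selections_antisym[OF assms], subst (3) weights(1)) (simp add: algebra_simps)
    then show "(\<Sum>q\<in>UNIV. A $ i $ j * (\<sigma> $ i $ j $ q * (v i $ q - v j $ q))) = ?a i j + ?a j i"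
      by (simp add: sum.distrib)
  qed
  also have "\<dots> = (\<Sum>i\<in>UNIV. \<Sum>j\<in>UNIV. ?a i j) + (\<Sum>i\<in>UNIV. \<Sum>j\<in>UNIV. ?a j i)"
    by (simp add: sum.distrib)
  also have "(\<Sum>i\<in>UNIV. \<Sum>j\<in>UNIV. ?a j i) = (\<Sum>i\<in>UNIV. \<Sum>j\<in>UNIV. ?a i j)" by (rule sum.swap)
  finally show ?thesis by (simp only: net) 
qed

lemma d_has_vector_derivative:
  "0 \<le> t \<Longrightarrow> (d i has_vector_derivative time_deriv (d i) t) (at t within {0..})"
  using d_diff vector_derivative_works unfolding time_deriv_def by blast

lemma at_within_pos: "0 < t \<Longrightarrow> at t within {0..} = at (t::real)"
  by (rule at_within_interior) simp

lemma d_lipschitz: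
  assumes "0 \<le> s" "0 \<le> t"
  shows "norm (d i s - d i t) \<le> \<delta> * \<bar>s - t\<bar>"
proof -
  have "norm (d i s - d i t) \<le> \<delta> * norm (s - t)"
  proof (rule differentiable_bound[of "{0..}"])
    fix u :: real assume u: "u \<in> {0..}"
    show "(d i has_derivative (\<lambda>h. h *\<^sub>R time_deriv (d i) u)) (at u within {0..})"
      using d_has_vector_derivative[of u i] u by (simp add: has_vector_derivative_def)
    show "onorm (\<lambda>h. h *\<^sub>R time_deriv (d i) u) \<le> \<delta>"
      using d_bound[of u i] u by (intro onorm_le) (simp add: mult.commute[of \<delta>] mult_left_mono)
  qed (use assms in auto)
  then show ?thesis by simp
qed

lemma delta_nonneg: "0 \<le> \<delta>"
  using d_bound[of 0] norm_ge_zero order_trans by blast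

text \<open>The response differentiates to the inverse Hessian applied to the velocity of \<lambda>
  minus the drift \<open>\<g>\<close>, while the protocol multiplies by the Hessian and the drift
  reappears as an additive term. Both cancel, so the velocity of \<open>x\<^sub>i\<close> contains
  no Hessian.\<close>

lemma velocity_ae:
  obtains N where "negligible N"
    and "\<And>t. t \<notin> N \<Longrightarrow> 0 < t \<Longrightarrow> \<exists>v \<sigma>. ((\<lambda>t. (\<Lambda> t, Z t)) has_vector_derivative v) (at t) \<and>
      \<sigma> \<in> sign_selections (\<Lambda> t) \<and>
      (\<forall>i. fst v $ i = \<H> t i (\<Lambda> t $ i) *v (snd v $ i + time_deriv (d i) t - \<alpha> *\<^sub>R net \<sigma> i) + \<g> t i (\<Lambda> t $ i)) \<and>
      (\<forall>i. ((\<lambda>s. X i (\<Lambda> s $ i) s) has_vector_derivative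
         snd v $ i + time_deriv (d i) t - \<alpha> *\<^sub>R net \<sigma> i) (at t))"
proof -
  have "\<forall>i. \<exists>N. negligible N \<and> (\<forall>t l. t \<notin> N \<longrightarrow> 0 < t \<longrightarrow> ((\<lambda>p. X i (fst p) (snd p)) has_derivative
      (\<lambda>h. matrix_inv (\<H> t i l) *v (fst h - snd h *\<^sub>R \<g> t i l))) (at (l, t)))"
  proof
    fix i
    show "\<exists>N. negligible N \<and> (\<forall>t l. t \<notin> N \<longrightarrow> 0 < t \<longrightarrow> ((\<lambda>p. X i (fst p) (snd p)) has_derivative
      (\<lambda>h. matrix_inv (\<H> t i l) *v (fst h - snd h *\<^sub>R \<g> t i l))) (at (l, t)))"
      by (rule tracked_cost.response_has_derivative_ae[OF tracked[of i]]) blast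
  qed
  from choice[OF this] obtain NX where NX: "\<forall>i. negligible (NX i) \<and> (\<forall>t l. t \<notin> NX i \<longrightarrow> 0 < t \<longrightarrow>
      ((\<lambda>p. X i (fst p) (snd p)) has_derivative
      (\<lambda>h. matrix_inv (\<H> t i l) *v (fst h - snd h *\<^sub>R \<g> t i l))) (at (l, t)))" ..
  define NS where "NS = {t. \<not> (0 \<le> t \<longrightarrow> (\<exists>v. ((\<lambda>t. (\<Lambda> t, Z t)) has_vector_derivative v) (at t) \<and>
      v \<in> filippov_map (protocol f d \<phi> A \<alpha>) t (\<Lambda> t, Z t)))}"
  have NS: "negligible NS"
    unfolding NS_def by (rule negligible_of_AE) (use solution in \<open>simp add: filippov_solution_def\<close>)
  show thesis
  proof (rule that)
    show "negligible (NS \<union> (\<Union>i. NX i))"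
      using NS NX by (intro negligible_Un negligible_countable_Union countable_image countable_finite) auto
    fix t :: real assume t: "t \<notin> NS \<union> (\<Union>i. NX i)" "0 < t"
    then have t0: "0 \<le> t" by simp
    have XD: "((\<lambda>p. X i (fst p) (snd p)) has_derivative
      (\<lambda>h. matrix_inv (\<H> t i l) *v (fst h - snd h *\<^sub>R \<g> t i l))) (at (l, t))" for i l
      using NX t by blast
    have inv: "\<H> t i l *v (matrix_inv (\<H> t i l) *v u) = u" "matrix_inv (\<H> t i l) *v (\<H> t i l *v u) = u" for i l u
    proof -
      interpret strongly_convex_C2 "\<lambda>x. f i x t" \<theta> by (rule tracked_cost.strongly_convex[OF tracked t0])
      show "\<H> t i l *v (matrix_inv (\<H> t i l) *v u) = u" by (rule hessian_inv_right)
      show "matrix_inv (\<H> t i l) *v (\<H> t i l *v u) = u" by (rule hessian_inv_left)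
    qed
    \<comment> \<open>This holds for every \<open>l\<close> at the one fixed time, since the
      exceptional sets \<open>NX i\<close> do not depend on \<open>l\<close>.\<close>
    have dual_rate: "time_deriv (time_gradient (local_dual (f i) (d i)) l) t =
        time_deriv (d i) t + matrix_inv (\<H> t i l) *v \<g> t i l" for i l
    proof -
      have "((\<lambda>s. (l, s)) has_derivative (\<lambda>h. (0, h))) (at t)"
        by (intro has_derivative_Pair has_derivative_const has_derivative_ident)
      from diff_chain_at[OF this XD]
      have "((\<lambda>s. X i l s) has_derivative (\<lambda>h. matrix_inv (\<H> t i l) *v (- h *\<^sub>R \<g> t i l))) (at t)"
        by (simp add: o_def)
      then have "((\<lambda>s. X i l s) has_vector_derivative - (matrix_inv (\<H> t i l) *v \<g> t i l)) (at t)"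
        by (simp add: has_vector_derivative_def matrix_vector_mult_scaleR linear_neg[OF matrix_vector_mul_linear])
      then have "((\<lambda>s. d i s - X i l s) has_vector_derivative
          time_deriv (d i) t - - (matrix_inv (\<H> t i l) *v \<g> t i l)) (at t within {0..})"
        by (intro has_vector_derivative_diff d_has_vector_derivative t0) (rule has_vector_derivative_at_within)
      then have "((\<lambda>s. d i s - X i l s) has_vector_derivative
          time_deriv (d i) t + matrix_inv (\<H> t i l) *v \<g> t i l) (at t within {0..})"
        by (simp only: diff_minus_eq_add)
      then have "(time_gradient (local_dual (f i) (d i)) l has_vector_derivative
          time_deriv (d i) t + matrix_inv (\<H> t i l) *v \<g> t i l) (at t within {0..})"
        by (rule has_vector_derivative_transform[rotated 2])
          (use t0 tracked_cost.time_gradient_local_dual[OF tracked] in auto)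
      then show ?thesis
        unfolding time_deriv_def by (rule vector_derivative_within[rotated]) (simp add: at_within_pos t)
    qed
    \<comment> \<open>The drift is pulled out of the product with the Hessian, so that the remaining
      state dependence is continuous apart from the signs and \<open>\<phi>\<close>.\<close>
    have field: "protocol f d \<phi> A \<alpha> t (l, z) =
      (\<chi> i. \<H> t i (l $ i) *v (time_deriv (d i) t - \<phi> i (z $ i) -
          \<alpha> *\<^sub>R (\<Sum>j\<in>UNIV. A $ i $ j *\<^sub>R sgn_vec (l $ i - l $ j))) + \<g> t i (l $ i),
       \<chi> i. - \<phi> i (z $ i))" for l z
    proof -
      have "- (\<H> t i (l $ i) *v (\<phi> i (z $ i) - (time_deriv (d i) t + matrix_inv (\<H> t i (l $ i)) *v \<g> t i (l $ i)) + s))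
        = \<H> t i (l $ i) *v (time_deriv (d i) t - \<phi> i (z $ i) - s) + \<g> t i (l $ i)" for i s
      proof -
        have "- (\<H> t i (l $ i) *v (\<phi> i (z $ i) - (time_deriv (d i) t + matrix_inv (\<H> t i (l $ i)) *v \<g> t i (l $ i)) + s))
          = \<H> t i (l $ i) *v (time_deriv (d i) t - \<phi> i (z $ i) - s) + \<H> t i (l $ i) *v (matrix_inv (\<H> t i (l $ i)) *v \<g> t i (l $ i))"
          by (simp only: linear_neg[OF matrix_vector_mul_linear, symmetric] matrix_vector_right_distrib[symmetric])
            (simp add: algebra_simps)
        then show ?thesis by (simp only: inv)
      qed
      then show ?thesis by (simp add: protocol_def dual_rate)
    qed
    obtain v where v: "((\<lambda>t. (\<Lambda> t, Z t)) has_vector_derivative v) (at t)"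
      "v \<in> filippov_map (protocol f d \<phi> A \<alpha>) t (\<Lambda> t, Z t)"
      using t t0 by (auto simp: NS_def)
    have contX: "continuous_on UNIV (\<lambda>l. X i l t)" for i
    proof (rule continuous_on_subset[OF lipschitz_on_continuous_on subset_UNIV])
      show "(1 / \<theta>)-lipschitz_on UNIV (\<lambda>l. X i l t)"
        using tracked_cost.response_lipschitz[OF tracked t0 t0] tracked_cost.modulus_pos[OF tracked]
        by (intro lipschitz_onI) (auto simp: dist_norm)
    qed
    have contH: "continuous_on UNIV (\<H> t i)" for i
      by (rule continuous_on_compose2[OF tracked_cost.continuous_on_H[OF tracked t0] contX]) simp
    have contg: "continuous_on UNIV (\<g> t i)" for i
      by (rule continuous_on_compose2[OF gradient_cont[OF t0] contX]) simp
    obtain \<sigma> where \<sigma>: "\<sigma> \<in> sign_selections (\<Lambda> t)"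
      "\<And>i. fst v $ i = \<H> t i (\<Lambda> t $ i) *v (snd v $ i + time_deriv (d i) t - \<alpha> *\<^sub>R net \<sigma> i) + \<g> t i (\<Lambda> t $ i)"
      by (rule filippov_map_sign_coupling[OF contH contg phi_bounded field v(2)]) blast
    have "((\<lambda>s. X i (\<Lambda> s $ i) s) has_vector_derivative
         snd v $ i + time_deriv (d i) t - \<alpha> *\<^sub>R net \<sigma> i) (at t)" for i
    proof -
      have "((\<lambda>s. \<Lambda> s $ i) has_derivative (\<lambda>h. h *\<^sub>R (fst v $ i))) (at t)"
        using bounded_linear.has_derivative[OF bounded_linear_vec_nth[of i]
          has_derivative_fst[OF v(1)[unfolded has_vector_derivative_def]]] by simp
      then have "((\<lambda>s. (\<Lambda> s $ i, s)) has_derivative (\<lambda>h. (h *\<^sub>R (fst v $ i), h))) (at t)"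
        by (intro has_derivative_Pair has_derivative_ident)
      from diff_chain_at[OF this XD]
      have "((\<lambda>s. X i (\<Lambda> s $ i) s) has_derivative
          (\<lambda>h. matrix_inv (\<H> t i (\<Lambda> t $ i)) *v (h *\<^sub>R (fst v $ i) - h *\<^sub>R \<g> t i (\<Lambda> t $ i)))) (at t)"
        by (simp add: o_def)
      then have "((\<lambda>s. X i (\<Lambda> s $ i) s) has_vector_derivative
          matrix_inv (\<H> t i (\<Lambda> t $ i)) *v (fst v $ i - \<g> t i (\<Lambda> t $ i))) (at t)"
        by (simp add: has_vector_derivative_def scaleR_diff_right[symmetric] matrix_vector_mult_scaleR)
      then show ?thesis by (simp add: \<sigma>(2) inv)
    qed
    with v(1) \<sigma> show "\<exists>v \<sigma>. ((\<lambda>t. (\<Lambda> t, Z t)) has_vector_derivative v) (at t) \<and>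
      \<sigma> \<in> sign_selections (\<Lambda> t) \<and>
      (\<forall>i. fst v $ i = \<H> t i (\<Lambda> t $ i) *v (snd v $ i + time_deriv (d i) t - \<alpha> *\<^sub>R net \<sigma> i) + \<g> t i (\<Lambda> t $ i)) \<and>
      (\<forall>i. ((\<lambda>s. X i (\<Lambda> s $ i) s) has_vector_derivative
         snd v $ i + time_deriv (d i) t - \<alpha> *\<^sub>R net \<sigma> i) (at t))"
      by blast
  qed
qed

section \<open>Conservation of the total imbalance\<close>

lemma solution_absolutely_continuous: "0 \<le> b \<Longrightarrow> absolutely_continuous_on 0 b (\<lambda>t. (\<Lambda> t, Z t))"
  using solution by (simp add: filippov_solution_def)

lemma dist_components_le:
  "norm (\<Lambda> s $ i - \<Lambda> t $ i) \<le> dist (\<Lambda> s, Z s) (\<Lambda> t, Z t)"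
  "norm (Z s $ i - Z t $ i) \<le> dist (\<Lambda> s, Z s) (\<Lambda> t, Z t)"
proof -
  have "dist (\<Lambda> s $ i) (\<Lambda> t $ i) \<le> dist (\<Lambda> s) (\<Lambda> t)" "dist (Z s $ i) (Z t $ i) \<le> dist (Z s) (Z t)"
    by (rule dist_vec_nth_le)+
  with dist_fst_le[of "(\<Lambda> s, Z s)" "(\<Lambda> t, Z t)"] dist_snd_le[of "(\<Lambda> s, Z s)" "(\<Lambda> t, Z t)"]
  show "norm (\<Lambda> s $ i - \<Lambda> t $ i) \<le> dist (\<Lambda> s, Z s) (\<Lambda> t, Z t)"
    "norm (Z s $ i - Z t $ i) \<le> dist (\<Lambda> s, Z s) (\<Lambda> t, Z t)"
    by (simp_all add: dist_norm)
qed

definition imbalance :: "'n \<Rightarrow> real \<Rightarrow> real" where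
  "imbalance q t = (\<Sum>i\<in>UNIV. X i (\<Lambda> t $ i) t $ q - d i t $ q - Z t $ i $ q)"

lemma absolutely_continuous_imbalance:
  assumes "0 \<le> b"
  shows "absolutely_continuous_on 0 b (imbalance q)"
proof (rule absolutely_continuous_on_dominated[OF solution_absolutely_continuous[OF assms]])
  \<comment> \<open>The three summands are the Lipschitz contributions of the response, of the
    demand and of the internal state.\<close>
  define C where "C = (1 + \<kappa>) / \<theta> + \<delta> + 1"
  have \<theta>: "0 < \<theta>" and \<kappa>: "0 \<le> \<kappa>"
    using tracked_cost.modulus_pos[OF tracked] tracked_cost.rate_nonneg[OF tracked] by auto
  have C: "0 \<le> C" using \<theta> \<kappa> delta_nonneg by (simp add: C_def)
  then show "0 \<le> real CARD('N) * C" by simp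
  fix s t :: real assume st: "0 \<le> s" "s \<le> t" "t \<le> b"
  define \<rho> where "\<rho> = dist (\<Lambda> s, Z s) (\<Lambda> t, Z t) + (t - s)"
  have "\<bar>imbalance q s - imbalance q t\<bar> \<le>
      (\<Sum>i\<in>UNIV. \<bar>(X i (\<Lambda> s $ i) s $ q - d i s $ q - Z s $ i $ q) - (X i (\<Lambda> t $ i) t $ q - d i t $ q - Z t $ i $ q)\<bar>)"
    unfolding imbalance_def sum_subtractf[symmetric] by (rule sum_abs)
  also have "\<dots> \<le> (\<Sum>i\<in>(UNIV :: 'N set). C * \<rho>)"
  proof (rule sum_mono)
    fix i
    have "\<bar>(X i (\<Lambda> s $ i) s - X i (\<Lambda> t $ i) t) $ q\<bar> \<le> (norm (\<Lambda> s $ i - \<Lambda> t $ i) + \<kappa> * \<bar>s - t\<bar>) / \<theta>"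
      by (rule order_trans[OF component_le_norm_cart tracked_cost.response_lipschitz[OF tracked]]) (use st in auto)
    also have "\<dots> \<le> (\<rho> + \<kappa> * \<rho>) / \<theta>"
      using dist_components_le(1)[of s i t] st \<theta> \<kappa>
      by (intro divide_right_mono add_mono mult_left_mono) (auto simp: \<rho>_def)
    finally have 1: "\<bar>(X i (\<Lambda> s $ i) s - X i (\<Lambda> t $ i) t) $ q\<bar> \<le> (1 + \<kappa>) / \<theta> * \<rho>" by (simp add: algebra_simps)
    have "\<bar>(d i s - d i t) $ q\<bar> \<le> \<delta> * \<bar>s - t\<bar>"
      by (rule order_trans[OF component_le_norm_cart d_lipschitz]) (use st in auto)
    also have "\<dots> \<le> \<delta> * \<rho>"
      using delta_nonneg st by (intro mult_left_mono) (auto simp: \<rho>_def)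
    finally have 2: "\<bar>(d i s - d i t) $ q\<bar> \<le> \<delta> * \<rho>" .
    have "\<bar>(Z s $ i - Z t $ i) $ q\<bar> \<le> dist (\<Lambda> s, Z s) (\<Lambda> t, Z t)"
      by (rule order_trans[OF component_le_norm_cart dist_components_le(2)])
    then have 3: "\<bar>(Z s $ i - Z t $ i) $ q\<bar> \<le> \<rho>" using st by (simp add: \<rho>_def)
    have "\<bar>(X i (\<Lambda> s $ i) s $ q - d i s $ q - Z s $ i $ q) - (X i (\<Lambda> t $ i) t $ q - d i t $ q - Z t $ i $ q)\<bar>
      \<le> \<bar>(X i (\<Lambda> s $ i) s - X i (\<Lambda> t $ i) t) $ q\<bar> + \<bar>(d i s - d i t) $ q\<bar> + \<bar>(Z s $ i - Z t $ i) $ q\<bar>"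
      by simp
    also have "\<dots> \<le> (1 + \<kappa>) / \<theta> * \<rho> + \<delta> * \<rho> + \<rho>" by (intro add_mono 1 2 3)
    also have "\<dots> = C * \<rho>" by (simp add: C_def algebra_simps)
    finally show "\<bar>(X i (\<Lambda> s $ i) s $ q - d i s $ q - Z s $ i $ q) - (X i (\<Lambda> t $ i) t $ q - d i t $ q - Z t $ i $ q)\<bar> \<le> C * \<rho>" .
  qed
  also have "\<dots> = real CARD('N) * C * \<rho>" by simp
  finally show "dist (imbalance q s) (imbalance q t) \<le> real CARD('N) * C * (dist (\<Lambda> s, Z s) (\<Lambda> t, Z t) + (t - s))"
    by (simp add: dist_real_def \<rho>_def)
qed

lemma has_vector_derivative_nth:
  "(w has_vector_derivative w') F \<Longrightarrow> ((\<lambda>s. w s $ q) has_vector_derivative w' $ q) F"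
  by (rule bounded_linear.has_vector_derivative[OF bounded_linear_vec_nth])

text \<open>Summing the velocities over the nodes cancels the internal states and the demands, and
  antisymmetry cancels the sign terms. An absolutely continuous function with derivative zero almost
  everywhere is constant, obtained from monotonicity of the function and of its negative.\<close>

lemma imbalance_constant:
  assumes b: "0 \<le> b"
  shows "imbalance q b = imbalance q 0"
proof -
  obtain N where N: "negligible N" and vel: "\<And>t. t \<notin> N \<Longrightarrow> 0 < t \<Longrightarrow> \<exists>v \<sigma>.
      ((\<lambda>t. (\<Lambda> t, Z t)) has_vector_derivative v) (at t) \<and> \<sigma> \<in> sign_selections (\<Lambda> t) \<and>
      (\<forall>i. fst v $ i = \<H> t i (\<Lambda> t $ i) *v (snd v $ i + time_deriv (d i) t - \<alpha> *\<^sub>R net \<sigma> i) + \<g> t i (\<Lambda> t $ i)) \<and>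
      (\<forall>i. ((\<lambda>s. X i (\<Lambda> s $ i) s) has_vector_derivative
         snd v $ i + time_deriv (d i) t - \<alpha> *\<^sub>R net \<sigma> i) (at t))"
    by (rule velocity_ae) blast
  have der: "(imbalance q has_real_derivative 0) (at t)" if t: "0 < t" "t \<notin> N" for t
  proof -
    obtain v \<sigma> where v: "((\<lambda>t. (\<Lambda> t, Z t)) has_vector_derivative v) (at t)"
      and \<sigma>: "\<sigma> \<in> sign_selections (\<Lambda> t)"
      and x: "\<And>i. ((\<lambda>s. X i (\<Lambda> s $ i) s) has_vector_derivative
         snd v $ i + time_deriv (d i) t - \<alpha> *\<^sub>R net \<sigma> i) (at t)"
      using vel[OF t(2,1)] by blast
    have z: "((\<lambda>s. Z s $ i $ q) has_vector_derivative snd v $ i $ q) (at t)" for i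
      using has_vector_derivative_nth[OF has_vector_derivative_nth[OF
        bounded_linear.has_vector_derivative[OF bounded_linear_snd v]]] by simp
    have dd: "((\<lambda>s. d i s $ q) has_vector_derivative time_deriv (d i) t $ q) (at t)" for i
      using has_vector_derivative_nth[OF d_has_vector_derivative[of t i]] t by (simp add: at_within_pos)
    have "(imbalance q has_vector_derivative
        (\<Sum>i\<in>UNIV. (snd v $ i + time_deriv (d i) t - \<alpha> *\<^sub>R net \<sigma> i) $ q - time_deriv (d i) t $ q - snd v $ i $ q)) (at t)"
      unfolding imbalance_def
      by (intro has_vector_derivative_sum has_vector_derivative_diff has_vector_derivative_nth[OF x] dd z)
    moreover have "(\<Sum>i\<in>UNIV. (snd v $ i + time_deriv (d i) t - \<alpha> *\<^sub>R net \<sigma> i) $ q - time_deriv (d i) t $ q - snd v $ i $ q)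
      = - \<alpha> * (\<Sum>i\<in>UNIV. net \<sigma> i $ q)"
      unfolding sum_distrib_left by (intro sum.cong refl) simp
    ultimately show ?thesis
      using sum_net_eq_0[OF \<sigma>, of q] by (simp add: has_real_derivative_iff_has_vector_derivative)
  qed
  have "imbalance q b \<le> imbalance q 0"
    by (rule absolutely_continuous_on_nonincreasing[OF b absolutely_continuous_imbalance[OF b] N])
      (use der in blast)
  moreover have "- imbalance q b \<le> - imbalance q 0"
  proof (rule absolutely_continuous_on_nonincreasing[OF b _ N])
    show "absolutely_continuous_on 0 b (\<lambda>t. - imbalance q t)"
      by (rule absolutely_continuous_on_dominated[OF absolutely_continuous_imbalance[OF b, of q], of 1])
        (auto simp: dist_real_def)
    show "\<exists>D\<le>0. ((\<lambda>t. - imbalance q t) has_real_derivative D) (at t)" if "0 < t" "t < b" "t \<notin> N" for t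
      using DERIV_minus[OF der[OF that(1,3)]] by auto
  qed
  ultimately show ?thesis by simp
qed

section \<open>Finite-time decay of the disagreement\<close>

definition disagreement :: "real \<Rightarrow> real" where
  "disagreement t = (\<Sum>i\<in>UNIV. \<Sum>j\<in>UNIV. \<Sum>q\<in>UNIV. A $ i $ j * \<bar>\<Lambda> t $ i $ q - \<Lambda> t $ j $ q\<bar>)"

lemma disagreement_nonneg: "0 \<le> disagreement t"
  unfolding disagreement_def by (intro sum_nonneg mult_nonneg_nonneg weights) auto

lemma disagreement_pos_imp:
  assumes "0 < disagreement t"
  shows "\<exists>i j. \<Lambda> t $ i \<noteq> \<Lambda> t $ j"
proof (rule ccontr)
  assume "\<nexists>i j. \<Lambda> t $ i \<noteq> \<Lambda> t $ j"
  then have "\<Lambda> t $ i $ q - \<Lambda> t $ j $ q = 0" for i j q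
    by (metis diff_self)
  then have "disagreement t = 0" unfolding disagreement_def by (simp only: abs_zero mult_zero_right sum.neutral_const)
  then show False using assms by simp
qed

lemma consensus_of_disagreement_eq_0:
  assumes "disagreement t = 0"
  shows "\<Lambda> t $ i = \<Lambda> t $ j"
proof (rule consensus_of_edges[OF graph edges, where x = "\<lambda>i. \<Lambda> t $ i"])
  fix l j assume "(l, j) \<in> E"
  then have "A $ l $ j \<noteq> 0" using graph weights by (metis connected_weighted_graph_def less_irrefl)
  have "A $ l $ j * \<bar>\<Lambda> t $ l $ q - \<Lambda> t $ j $ q\<bar> = 0" for q
  proof -
    have "(\<Sum>i\<in>UNIV. \<Sum>j\<in>UNIV. \<Sum>q\<in>UNIV. A $ i $ j * \<bar>\<Lambda> t $ i $ q - \<Lambda> t $ j $ q\<bar>) = 0"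
      using assms by (simp add: disagreement_def)
    then have "(\<Sum>j\<in>UNIV. \<Sum>q\<in>UNIV. A $ l $ j * \<bar>\<Lambda> t $ l $ q - \<Lambda> t $ j $ q\<bar>) = 0"
      by (subst (asm) sum_nonneg_eq_0_iff) (auto intro!: sum_nonneg mult_nonneg_nonneg weights)
    then have "(\<Sum>q\<in>UNIV. A $ l $ j * \<bar>\<Lambda> t $ l $ q - \<Lambda> t $ j $ q\<bar>) = 0"
      by (subst (asm) sum_nonneg_eq_0_iff) (auto intro!: sum_nonneg mult_nonneg_nonneg weights)
    then show ?thesis
      by (subst (asm) sum_nonneg_eq_0_iff) (auto intro!: mult_nonneg_nonneg weights)
  qed
  then show "\<Lambda> t $ l = \<Lambda> t $ j" using \<open>A $ l $ j \<noteq> 0\<close> by (simp add: vec_eq_iff)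
qed

lemma absolutely_continuous_disagreement:
  assumes "0 \<le> b"
  shows "absolutely_continuous_on 0 b disagreement"
proof (rule absolutely_continuous_on_dominated[OF solution_absolutely_continuous[OF assms]])
  define C where "C = (\<Sum>i\<in>(UNIV :: 'N set). \<Sum>j\<in>(UNIV :: 'N set). \<Sum>q\<in>(UNIV :: 'n set). A $ i $ j * 2)"
  show "0 \<le> C" unfolding C_def by (intro sum_nonneg mult_nonneg_nonneg weights) auto
  fix s t :: real assume st: "0 \<le> s" "s \<le> t" "t \<le> b"
  define \<rho> where "\<rho> = dist (\<Lambda> s, Z s) (\<Lambda> t, Z t)"
  have "\<bar>disagreement s - disagreement t\<bar> \<le> (\<Sum>i\<in>UNIV. \<Sum>j\<in>UNIV. \<Sum>q\<in>UNIV.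
      \<bar>A $ i $ j * \<bar>\<Lambda> s $ i $ q - \<Lambda> s $ j $ q\<bar> - A $ i $ j * \<bar>\<Lambda> t $ i $ q - \<Lambda> t $ j $ q\<bar>\<bar>)"
    unfolding disagreement_def sum_subtractf[symmetric]
    by (intro order_trans[OF sum_abs] sum_mono order_refl)
  also have "\<dots> \<le> (\<Sum>i\<in>(UNIV :: 'N set). \<Sum>j\<in>(UNIV :: 'N set). \<Sum>q\<in>(UNIV :: 'n set). A $ i $ j * (2 * \<rho>))"
  proof (intro sum_mono)
    fix i j q
    have "\<bar>(\<Lambda> s $ k - \<Lambda> t $ k) $ q\<bar> \<le> \<rho>" for k
      unfolding \<rho>_def by (rule order_trans[OF component_le_norm_cart dist_components_le(1)])
    from this[of i] this[of j]
    have "\<bar>\<bar>\<Lambda> s $ i $ q - \<Lambda> s $ j $ q\<bar> - \<bar>\<Lambda> t $ i $ q - \<Lambda> t $ j $ q\<bar>\<bar> \<le> 2 * \<rho>" by simp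
    then have "A $ i $ j * \<bar>\<bar>\<Lambda> s $ i $ q - \<Lambda> s $ j $ q\<bar> - \<bar>\<Lambda> t $ i $ q - \<Lambda> t $ j $ q\<bar>\<bar> \<le> A $ i $ j * (2 * \<rho>)"
      by (rule mult_left_mono) (rule weights)
    then show "\<bar>A $ i $ j * \<bar>\<Lambda> s $ i $ q - \<Lambda> s $ j $ q\<bar> - A $ i $ j * \<bar>\<Lambda> t $ i $ q - \<Lambda> t $ j $ q\<bar>\<bar> \<le> A $ i $ j * (2 * \<rho>)"
      by (simp only: right_diff_distrib[symmetric] abs_mult abs_of_nonneg[OF weights(2)])
  qed
  also have "\<dots> = C * \<rho>"
    unfolding C_def sum_distrib_right by (intro sum.cong refl) simp
  also have "\<dots> \<le> C * (\<rho> + (t - s))" using st \<open>0 \<le> C\<close> by (intro mult_left_mono) auto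
  finally show "dist (disagreement s) (disagreement t) \<le> C * (dist (\<Lambda> s, Z s) (\<Lambda> t, Z t) + (t - s))"
    by (simp add: dist_real_def \<rho>_def)
qed

text \<open>The strict rate is available only away from consensus, where the sign terms are bounded
  below. The weaker claim \<open>D \<le> 0\<close> holds on both sides, so consensus persists once
  reached.\<close>

lemma disagreement_descent_ae:
  fixes \<mu> \<beta> :: real
  defines "\<mu> \<equiv> least_positive_eigenvalue
      (transpose (extended_incidence A e) ** (extended_incidence A e :: real^('m \<times> 'n)^('N::{finite,linorder} \<times> 'n)))"
    and "\<beta> \<equiv> (\<kappa> / \<theta> + \<delta>) * sqrt (real CARD('N) * \<Theta> / (\<theta> * \<mu>))"
  assumes gain: "\<beta> < \<alpha>" and pos: "0 < \<kappa>" "0 < \<delta>" "0 < \<Theta>" and Z0: "\<And>t. Tz \<le> t \<Longrightarrow> Z t = 0" and Tz: "0 \<le> Tz"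
  obtains N where "negligible N"
    and "\<And>t. Tz < t \<Longrightarrow> t \<notin> N \<Longrightarrow> \<exists>D\<le>0. (disagreement has_real_derivative D) (at t) \<and>
      (0 < disagreement t \<longrightarrow> D \<le> - (2 * ((\<alpha> - \<beta>) * (\<theta> * \<mu>))))"
proof -
  have \<theta>: "0 < \<theta>" using tracked_cost.modulus_pos[OF tracked] by blast
  obtain N where N: "negligible N" and vel: "\<And>t. t \<notin> N \<Longrightarrow> 0 < t \<Longrightarrow> \<exists>v \<sigma>.
      ((\<lambda>t. (\<Lambda> t, Z t)) has_vector_derivative v) (at t) \<and> \<sigma> \<in> sign_selections (\<Lambda> t) \<and>
      (\<forall>i. fst v $ i = \<H> t i (\<Lambda> t $ i) *v (snd v $ i + time_deriv (d i) t - \<alpha> *\<^sub>R net \<sigma> i) + \<g> t i (\<Lambda> t $ i)) \<and>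
      (\<forall>i. ((\<lambda>s. X i (\<Lambda> s $ i) s) has_vector_derivative
         snd v $ i + time_deriv (d i) t - \<alpha> *\<^sub>R net \<sigma> i) (at t))"
    by (rule velocity_ae) blast
  \<comment> \<open>One exceptional null set for each of the finitely many triples of two nodes and
    a coordinate.\<close>
  have "\<forall>k. \<exists>M. negligible M \<and> (\<forall>t D. t \<notin> M \<longrightarrow> \<Lambda> t $ fst k $ snd (snd k) - \<Lambda> t $ fst (snd k) $ snd (snd k) = 0 \<longrightarrow>
      ((\<lambda>t. \<Lambda> t $ fst k $ snd (snd k) - \<Lambda> t $ fst (snd k) $ snd (snd k)) has_real_derivative D) (at t) \<longrightarrow> D = 0)"
    (is "\<forall>k. \<exists>M. ?P k M")
  proof
    fix k show "\<exists>M. ?P k M"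
      by (rule zero_derivative_ae_on_zeros[of "\<lambda>t. \<Lambda> t $ fst k $ snd (snd k) - \<Lambda> t $ fst (snd k) $ snd (snd k)"]) blast
  qed
  from choice[OF this] obtain M where M: "\<forall>k. ?P k (M k)" ..
  show thesis
  proof (rule that)
    show "negligible (N \<union> (\<Union>k. M k))"
      using N M by (intro negligible_Un negligible_countable_Union countable_image countable_finite) auto
    fix t assume t: "Tz < t" "t \<notin> N \<union> (\<Union>k. M k)"
    then have t0: "0 < t" "0 \<le> t" using Tz by auto
    obtain v \<sigma> where v: "((\<lambda>t. (\<Lambda> t, Z t)) has_vector_derivative v) (at t)"
      and \<sigma>: "\<sigma> \<in> sign_selections (\<Lambda> t)"
      and vL: "\<And>i. fst v $ i = \<H> t i (\<Lambda> t $ i) *v (snd v $ i + time_deriv (d i) t - \<alpha> *\<^sub>R net \<sigma> i) + \<g> t i (\<Lambda> t $ i)"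
      using vel[of t] t t0 by blast
    have "(Z has_vector_derivative snd v) (at t)"
      using bounded_linear.has_vector_derivative[OF bounded_linear_snd v] by simp
    \<comment> \<open>Since \<open>t\<close> is strictly beyond \<open>Tz\<close>, the internal
      states vanish on a whole neighbourhood and the second component of the velocity is
      zero.\<close>
    moreover have "(Z has_vector_derivative 0) (at t)"
    proof (rule has_vector_derivative_transform_within_open[OF has_vector_derivative_const])
      show "open {Tz<..}" "t \<in> {Tz<..}" using t by auto
      fix s assume "s \<in> {Tz<..}"
      then show "0 = Z s" using Z0[of s] by simp
    qed
    ultimately have sndv: "snd v = 0" by (rule vector_derivative_unique_at)
    \<comment> \<open>The part of the velocity that the sign terms must dominate. Its norm bound
      \<open>\<kappa> / \<theta> + \<delta>\<close> is the first factor of the gain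
      threshold.\<close>
    define p where "p i = time_deriv (d i) t + matrix_inv (\<H> t i (\<Lambda> t $ i)) *v \<g> t i (\<Lambda> t $ i)" for i
    have v1: "fst v $ i = \<H> t i (\<Lambda> t $ i) *v (p i - \<alpha> *\<^sub>R net \<sigma> i)" for i
    proof -
      interpret strongly_convex_C2 "\<lambda>x. f i x t" \<theta> by (rule tracked_cost.strongly_convex[OF tracked t0(2)])
      have "\<H> t i (\<Lambda> t $ i) *v (p i - \<alpha> *\<^sub>R net \<sigma> i) =
        \<H> t i (\<Lambda> t $ i) *v ((time_deriv (d i) t - \<alpha> *\<^sub>R net \<sigma> i) + matrix_inv (\<H> t i (\<Lambda> t $ i)) *v \<g> t i (\<Lambda> t $ i))"
        by (simp add: p_def algebra_simps)
      then show ?thesis by (simp only: matrix_vector_right_distrib hessian_inv_right vL sndv) simp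
    qed
    have L: "((\<lambda>s. \<Lambda> s $ i $ q - \<Lambda> s $ j $ q) has_real_derivative fst v $ i $ q - fst v $ j $ q) (at t)" for i j q
    proof -
      have "((\<lambda>s. \<Lambda> s $ i $ q) has_vector_derivative fst v $ i $ q) (at t)" for i
        using has_vector_derivative_nth[OF has_vector_derivative_nth[OF
          bounded_linear.has_vector_derivative[OF bounded_linear_fst v]]] by simp
      then show ?thesis
        unfolding has_real_derivative_iff_has_vector_derivative by (intro has_vector_derivative_diff)
    qed
    have zero: "fst v $ i $ q - fst v $ j $ q = 0" if "\<Lambda> t $ i $ q - \<Lambda> t $ j $ q = 0" for i j q
    proof -
      have "t \<notin> M (i, j, q)" using t by blast
      moreover have "\<forall>t D. t \<notin> M (i, j, q) \<longrightarrow> \<Lambda> t $ i $ q - \<Lambda> t $ j $ q = 0 \<longrightarrow>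
          ((\<lambda>t. \<Lambda> t $ i $ q - \<Lambda> t $ j $ q) has_real_derivative D) (at t) \<longrightarrow> D = 0"
        using M[THEN spec, of "(i, j, q)"] by simp
      ultimately show ?thesis using that L[of i q j] by blast
    qed
    have absder: "((\<lambda>s. \<bar>\<Lambda> s $ i $ q - \<Lambda> s $ j $ q\<bar>) has_real_derivative
        \<sigma> $ i $ j $ q * (fst v $ i $ q - fst v $ j $ q)) (at t)" for i j q
    proof (rule DERIV_abs_sign[OF L])
      show "\<sigma> $ i $ j $ q = 1" if "0 < \<Lambda> t $ i $ q - \<Lambda> t $ j $ q"
        by (rule sign_selections_eq_1[OF \<sigma>]) (use that in simp)
      show "\<sigma> $ i $ j $ q = - 1" if "\<Lambda> t $ i $ q - \<Lambda> t $ j $ q < 0"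
        using sign_selections_eq_1[OF \<sigma>, of i q j] that sign_selections_antisym[OF \<sigma>, of i j q] by simp
    qed (rule zero)
    define D where "D = (\<Sum>i\<in>UNIV. \<Sum>j\<in>UNIV. \<Sum>q\<in>UNIV. A $ i $ j * (\<sigma> $ i $ j $ q * (fst v $ i $ q - fst v $ j $ q)))"
    have der: "(disagreement has_real_derivative D) (at t)"
      unfolding disagreement_def D_def by (intro DERIV_sum DERIV_cmult absder)
    have D2: "D = 2 * (\<Sum>i\<in>UNIV. net \<sigma> i \<bullet> (\<H> t i (\<Lambda> t $ i) *v (p i - \<alpha> *\<^sub>R net \<sigma> i)))"
      unfolding D_def sum_net_inner[OF \<sigma>] v1 by (rule refl)
    have strict: "D \<le> - (2 * ((\<alpha> - \<beta>) * (\<theta> * \<mu>))) \<and> 0 < \<mu>" if dis: "0 < disagreement t"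
    proof -
      obtain i0 j0 where nc: "\<Lambda> t $ i0 \<noteq> \<Lambda> t $ j0" using disagreement_pos_imp[OF dis] by blast
      have anti: "\<sigma> $ i $ j = - \<sigma> $ j $ i" for i j
        by (intro vec_eq_iff[THEN iffD2] allI)
          (simp only: vector_uminus_component, rule sign_selections_antisym[OF \<sigma>])
      have sign: "\<bar>\<Lambda> t $ i $ q - \<Lambda> t $ j $ q\<bar> \<le> \<sigma> $ i $ j $ q * (\<Lambda> t $ i $ q - \<Lambda> t $ j $ q)" for i j q
        using sign_selections_eq_1[OF \<sigma>, of j q i] sign_selections_eq_1[OF \<sigma>, of i q j]
          sign_selections_antisym[OF \<sigma>, of i j q]
        by (cases "\<Lambda> t $ i $ q" "\<Lambda> t $ j $ q" rule: linorder_cases) auto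
      note bnd = incidence_sign_bound[OF graph edges, where \<sigma> = "\<lambda>i j. \<sigma> $ i $ j", OF anti sign nc]
      have \<mu>: "0 < \<mu>" unfolding \<mu>_def by (rule bnd(1))
      have P: "norm (p i) \<le> \<kappa> / \<theta> + \<delta>" for i
      proof -
        interpret strongly_convex_C2 "\<lambda>x. f i x t" \<theta> by (rule tracked_cost.strongly_convex[OF tracked t0(2)])
        have "norm (matrix_inv (\<H> t i (\<Lambda> t $ i)) *v \<g> t i (\<Lambda> t $ i)) \<le> \<kappa> / \<theta>"
          by (intro order_trans[OF norm_hessian_inv_le] divide_right_mono
              tracked_cost.time_gradient_deriv_le[OF tracked t0(2)] less_imp_le[OF \<theta>])
        then show ?thesis
          unfolding p_def using norm_triangle_mono[OF d_bound[OF t0(2), of i]] by (metis add.commute)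
      qed
      have "(\<Sum>i\<in>UNIV. net \<sigma> i \<bullet> (\<H> t i (\<Lambda> t $ i) *v (p i - \<alpha> *\<^sub>R net \<sigma> i))) \<le> - ((\<alpha> - \<beta>) * (\<theta> * \<mu>))"
      proof (rule quadratic_descent[where \<Theta> = \<Theta> and P = "\<kappa> / \<theta> + \<delta>"])
        fix i u w
        interpret strongly_convex_C2 "\<lambda>x. f i x t" \<theta> by (rule tracked_cost.strongly_convex[OF tracked t0(2)])
        show "u \<bullet> (\<H> t i (\<Lambda> t $ i) *v w) = w \<bullet> (\<H> t i (\<Lambda> t $ i) *v u)"
          by (rule hessian_symmetric[OF C2])
        show "\<theta> * (norm w)\<^sup>2 \<le> w \<bullet> (\<H> t i (\<Lambda> t $ i) *v w)" by (rule hessian_coercive)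
        show "w \<bullet> (\<H> t i (\<Lambda> t $ i) *v w) \<le> \<Theta> * (norm w)\<^sup>2" by (rule hessian_upper[OF t0(2)])
      next
        show "0 < \<beta>" unfolding \<beta>_def using pos \<theta> \<mu> by (intro mult_pos_pos) (auto intro!: add_pos_pos divide_pos_pos)
        have "(sqrt (real CARD('N) * \<Theta> / (\<theta> * \<mu>)))\<^sup>2 = real CARD('N) * \<Theta> / (\<theta> * \<mu>)"
          using pos \<theta> \<mu> by (intro real_sqrt_pow2) auto
        then show "\<beta>\<^sup>2 * (\<theta> * \<mu>) = real CARD('N) * \<Theta> * (\<kappa> / \<theta> + \<delta>)\<^sup>2"
          unfolding \<beta>_def using \<theta> \<mu> by (simp add: power_mult_distrib)
      qed (use \<theta> P \<mu> bnd(2)[folded \<mu>_def] gain pos in auto)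
      with \<mu> show ?thesis unfolding D2 by linarith
    qed
    \<comment> \<open>At consensus the nonnegative disagreement attains its minimum, so a derivative
      there must be zero, without recourse to the sign terms.\<close>
    have "D \<le> 0"
    proof (cases "0 < disagreement t")
      case True
      have "0 \<le> (\<alpha> - \<beta>) * (\<theta> * \<mu>)" using strict[OF True] gain \<theta> by (intro mult_nonneg_nonneg) auto
      then show ?thesis using strict[OF True] by linarith
    next
      case False
      then have "disagreement t = 0" using disagreement_nonneg[of t] by simp
      then have "\<forall>y. \<bar>t - y\<bar> < 1 \<longrightarrow> disagreement t \<le> disagreement y"
        by (simp add: disagreement_nonneg)
      then show ?thesis using DERIV_local_min[OF der, of 1] by simp
    qed
    with der strict show "\<exists>D\<le>0. (disagreement has_real_derivative D) (at t) \<and>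
      (0 < disagreement t \<longrightarrow> D \<le> - (2 * ((\<alpha> - \<beta>) * (\<theta> * \<mu>))))" by blast
  qed
qed

text \<open>If the disagreement stayed positive, the fixed negative rate would make it negative in
  finite time. After its first known zero, monotonicity and nonnegativity keep it at zero.\<close>

lemma disagreement_vanishes:
  fixes \<mu> \<beta> :: real
  defines "\<mu> \<equiv> least_positive_eigenvalue
      (transpose (extended_incidence A e) ** (extended_incidence A e :: real^('m \<times> 'n)^('N::{finite,linorder} \<times> 'n)))"
    and "\<beta> \<equiv> (\<kappa> / \<theta> + \<delta>) * sqrt (real CARD('N) * \<Theta> / (\<theta> * \<mu>))"
  assumes gain: "\<beta> < \<alpha>" and pos: "0 < \<kappa>" "0 < \<delta>" "0 < \<Theta>" and Z0: "\<And>t. Tz \<le> t \<Longrightarrow> Z t = 0" and Tz: "0 \<le> Tz"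
  obtains T where "Tz \<le> T" "\<And>t. T \<le> t \<Longrightarrow> disagreement t = 0"
proof -
  have \<theta>: "0 < \<theta>" using tracked_cost.modulus_pos[OF tracked] by blast
  obtain N where N: "negligible N" and der: "\<And>t. Tz < t \<Longrightarrow> t \<notin> N \<Longrightarrow>
      \<exists>D\<le>0. (disagreement has_real_derivative D) (at t) \<and>
      (0 < disagreement t \<longrightarrow> D \<le> - (2 * ((\<alpha> - \<beta>) * (\<theta> * \<mu>))))"
    by (rule disagreement_descent_ae[OF gain[unfolded \<beta>_def \<mu>_def] pos Z0 Tz, folded \<mu>_def, folded \<beta>_def], assumption)
      (rule that)
  have ac: "absolutely_continuous_on a b disagreement" if "Tz \<le> a" "a \<le> b" for a b
    by (rule absolutely_continuous_on_subinterval[OF absolutely_continuous_disagreement[of b]]) (use that Tz in auto)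
  have mono: "disagreement b \<le> disagreement a" if "Tz \<le> a" "a \<le> b" for a b
  proof (rule absolutely_continuous_on_nonincreasing[OF that(2) ac[OF that] N])
    fix t assume "a < t" "t < b" "t \<notin> N"
    then have "Tz < t" "t \<notin> N" using that by simp_all
    then show "\<exists>D\<le>0. (disagreement has_real_derivative D) (at t)" using der by blast
  qed
  have "\<exists>T\<ge>Tz. disagreement T = 0"
  proof (rule ccontr)
    assume "\<not> ?thesis"
    then have "disagreement t \<noteq> 0" if "Tz \<le> t" for t using that by blast
    then have pd: "0 < disagreement t" if "Tz \<le> t" for t
      using that disagreement_nonneg[of t] by (simp add: less_le)
    obtain i0 j0 where nc: "\<Lambda> Tz $ i0 \<noteq> \<Lambda> Tz $ j0" using disagreement_pos_imp[OF pd[OF order_refl]] by blast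
    have \<mu>: "0 < \<mu>"
      \<comment> \<open>Positivity of the eigenvalue needs only a nonconstant \<Lambda>, so the
        plain componentwise signs serve as selection here.\<close>
      unfolding \<mu>_def by (rule incidence_sign_bound(1)[OF graph edges, where \<sigma> = "\<lambda>i j. sgn_vec (\<Lambda> Tz $ i - \<Lambda> Tz $ j)", OF _ _ nc])
        (auto simp: sgn_vec_def vec_eq_iff sgn_if)
    define c where "c = 2 * ((\<alpha> - \<beta>) * (\<theta> * \<mu>))"
    have c: "0 < c" using gain \<theta> \<mu> by (simp add: c_def)
    \<comment> \<open>The added 1 pushes the bound at \<open>T\<close> down to \<open>- c\<close>,
      strictly below zero.\<close>
    define T where "T = Tz + disagreement Tz / c + 1"
    have T: "Tz \<le> T" using c disagreement_nonneg[of Tz] by (simp add: T_def)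
    have "disagreement T \<le> disagreement Tz + (- c) * (T - Tz)"
    proof (rule absolutely_continuous_on_growth_bound[OF T ac[OF order_refl T] N])
      fix t assume "Tz < t" "t < T" "t \<notin> N"
      then show "\<exists>D\<le>- c. (disagreement has_real_derivative D) (at t)"
        using der[of t] pd[of t] by (auto simp: c_def)
    qed
    also have "\<dots> = - c" using c by (simp add: T_def field_simps)
    finally show False using disagreement_nonneg[of T] c by linarith
  qed
  then obtain T where T: "Tz \<le> T" "disagreement T = 0" by blast
  show thesis
  proof (rule that[OF T(1)])
    fix t assume "T \<le> t"
    then show "disagreement t = 0" using mono[OF T(1)] T(2) disagreement_nonneg[of t] by fastforce
  qed
qed

text \<open>\<open>m\<close> acts as Lagrange multiplier: in the sum of the strong convexity
  inequalities the terms with \<open>m\<close> cancel, because both allocations meet the same total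
  demand. The quadratic remainder makes the minimiser unique, which determines
  \<open>ARG_MIN\<close>.\<close>

lemma optimal_allocation_eqI:
  assumes t: "0 \<le> t" and feas: "(\<Sum>i\<in>UNIV. X i m t) = (\<Sum>i\<in>UNIV. d i t)"
  shows "optimal_allocation f d t = (\<chi> i. X i m t)"
proof -
  define x where "x = (\<chi> i. X i m t)"
  have \<theta>: "0 < \<theta>" using tracked_cost.modulus_pos[OF tracked] by blast
  have *: "(\<Sum>i\<in>UNIV. f i (x $ i) t) < (\<Sum>i\<in>UNIV. f i (y $ i) t)"
    if y: "(\<Sum>i\<in>UNIV. y $ i) = (\<Sum>i\<in>UNIV. d i t)" "y \<noteq> x" for y
  proof -
    have each: "f i (x $ i) t + m \<bullet> (y $ i) - m \<bullet> (x $ i) + \<theta> / 2 * (norm (y $ i - x $ i))\<^sup>2 \<le> f i (y $ i) t" for i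
    proof -
      interpret strongly_convex_C2 "\<lambda>x. f i x t" \<theta> by (rule tracked_cost.strongly_convex[OF tracked t])
      have "x $ i = response m" by (simp add: x_def tracked_cost.response_eq[OF tracked t])
      then show ?thesis using response_optimal[of m "y $ i"] by simp
    qed
    obtain k where k: "y $ k \<noteq> x $ k" using y(2) vec_eq_iff[of y x] by blast
    have "0 < \<theta> / 2 * (norm (y $ k - x $ k))\<^sup>2" using k \<theta> by simp
    also have "\<dots> \<le> (\<Sum>i\<in>UNIV. \<theta> / 2 * (norm (y $ i - x $ i))\<^sup>2)"
      using \<theta> by (intro member_le_sum) auto
    finally have "0 < (\<Sum>i\<in>UNIV. \<theta> / 2 * (norm (y $ i - x $ i))\<^sup>2)" .
    moreover have "(\<Sum>i\<in>UNIV. f i (x $ i) t + m \<bullet> (y $ i) - m \<bullet> (x $ i) + \<theta> / 2 * (norm (y $ i - x $ i))\<^sup>2)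
        \<le> (\<Sum>i\<in>UNIV. f i (y $ i) t)"
      by (intro sum_mono each)
    moreover have "(\<Sum>i\<in>UNIV. m \<bullet> (y $ i)) = (\<Sum>i\<in>UNIV. m \<bullet> (x $ i))"
      using y(1) feas by (simp add: inner_sum_right[symmetric] x_def)
    ultimately show ?thesis by (simp add: sum.distrib sum_subtractf)
  qed
  have feas': "(\<Sum>i\<in>UNIV. x $ i) = (\<Sum>i\<in>UNIV. d i t)" using feas by (simp add: x_def)
  show ?thesis
    unfolding optimal_allocation_def arg_min_def x_def[symmetric]
  proof (rule some_equality)
    show "is_arg_min (\<lambda>x. \<Sum>i\<in>UNIV. f i (x $ i) t) (\<lambda>x. (\<Sum>i\<in>UNIV. x $ i) = (\<Sum>i\<in>UNIV. d i t)) x"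
      unfolding is_arg_min_def
    proof (intro conjI feas' notI)
      assume "\<exists>y. (\<Sum>i\<in>UNIV. y $ i) = (\<Sum>i\<in>UNIV. d i t) \<and> (\<Sum>i\<in>UNIV. f i (y $ i) t) < (\<Sum>i\<in>UNIV. f i (x $ i) t)"
      then obtain y where y: "(\<Sum>i\<in>UNIV. y $ i) = (\<Sum>i\<in>UNIV. d i t)"
        "(\<Sum>i\<in>UNIV. f i (y $ i) t) < (\<Sum>i\<in>UNIV. f i (x $ i) t)" by blast
      then have "y \<noteq> x" by auto
      from *[OF y(1) this] y(2) show False by (rule less_asym)
    qed
    fix y assume y: "is_arg_min (\<lambda>x. \<Sum>i\<in>UNIV. f i (x $ i) t) (\<lambda>x. (\<Sum>i\<in>UNIV. x $ i) = (\<Sum>i\<in>UNIV. d i t)) y"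
    show "y = x"
    proof (rule ccontr)
      assume "y \<noteq> x"
      with y * have "(\<Sum>i\<in>UNIV. f i (x $ i) t) < (\<Sum>i\<in>UNIV. f i (y $ i) t)"
        by (simp add: is_arg_min_def)
      with y feas' show False by (auto simp: is_arg_min_def)
    qed
  qed
qed

text \<open>The initial condition on \<open>Z\<close> says exactly that the imbalance starts at
  zero. Its conservation and \<open>Z t = 0\<close> give feasibility, and consensus supplies the
  common multiplier.\<close>

lemma allocation_optimal_of_consensus:
  assumes init: "\<And>i. Z 0 $ i = - time_gradient (local_dual (f i) (d i)) (\<Lambda> 0 $ i) 0"
    and t: "0 \<le> t" and Zt: "Z t = 0" and cons: "disagreement t = 0"
  shows "X i (\<Lambda> t $ i) t = optimal_allocation f d t $ i"
proof -
  have "imbalance q 0 = 0" for q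
    by (simp add: imbalance_def init tracked_cost.time_gradient_local_dual[OF tracked])
  then have "imbalance q t = 0" for q using imbalance_constant[OF t] by simp
  then have "(\<Sum>j\<in>UNIV. X j (\<Lambda> t $ j) t) $ q = (\<Sum>j\<in>UNIV. d j t) $ q" for q
    by (simp add: imbalance_def Zt sum_subtractf)
  then have "(\<Sum>j\<in>UNIV. X j (\<Lambda> t $ j) t) = (\<Sum>j\<in>UNIV. d j t)" by (simp add: vec_eq_iff)
  moreover have "(\<Sum>j\<in>UNIV. X j (\<Lambda> t $ i) t) = (\<Sum>j\<in>UNIV. X j (\<Lambda> t $ j) t)"
    by (intro sum.cong refl arg_cong[where f = "\<lambda>l. X _ l t"] consensus_of_disagreement_eq_0[OF cons])
  ultimately have "(\<Sum>j\<in>UNIV. X j (\<Lambda> t $ i) t) = (\<Sum>j\<in>UNIV. d j t)" by simp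
  from optimal_allocation_eqI[OF t this] show ?thesis by simp
qed

text \<open>Finite-time stability speaks of Filippov solutions of each internal system on its own,
  while the run is a solution of the joint system. The projection to one internal state
  semiconjugates the two fields, with the embedding of that coordinate as right inverse.\<close>

lemma internal_state_filippov_solution: "filippov_solution (\<lambda>_ z. - \<phi> i z) (\<lambda>t. Z t $ i)"
proof -
  have "filippov_solution (\<lambda>_ z. - \<phi> i z) (\<lambda>t. (\<lambda>p. snd p $ i) (\<Lambda> t, Z t))"
  proof (rule filippov_solution_semiconjugate[where g = "\<lambda>u. (0, axis i u)", OF _ _ _ _ _ solution])
    show "linear (\<lambda>p :: ((real^'n)^'N::{finite,linorder}) \<times> ((real^'n)^'N::{finite,linorder}). snd p $ i)" by (rule linearI) auto
    show "linear (\<lambda>u :: real^'n. (0 :: ((real^'n)^'N::{finite,linorder}), axis i u))" by (rule linearI) (auto simp: vec_eq_iff axis_def)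
    show "norm (snd y $ i) \<le> norm y" for y :: "((real^'n)^'N::{finite,linorder}) \<times> ((real^'n)^'N::{finite,linorder})"
      using norm_snd_le[of "snd y" "fst y"] Finite_Cartesian_Product.norm_nth_le[of "snd y" i] by simp
  qed (auto simp: protocol_def axis_def)
  then show ?thesis by simp
qed

end

section \<open>Common settling times and the tracking statement\<close>

lemma vanishes_at_mono:
  assumes "vanishes_at z T" "T \<le> T'"
  shows "vanishes_at z T'"
proof (cases "T = T'")
  case False
  with assms(2) have "T < T'" by simp
  have "\<forall>\<^sub>F t in at T' within {0..}. T < t"
    using order_tendstoD(1)[OF tendsto_ident_at \<open>T < T'\<close>] .
  then have "\<forall>\<^sub>F t in at T' within {0..}. 0 = z t"
    by eventually_elim (use assms in \<open>simp add: vanishes_at_def\<close>)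
  then have "(z \<longlongrightarrow> 0) (at T' within {0..})" by (rule Lim_transform_eventually[OF tendsto_const])
  then show ?thesis using assms by (auto simp: vanishes_at_def)
qed (use assms in simp)

theorem corollary1:
  fixes E :: "('N::{finite,linorder} \<times> 'N) set"
    and A :: "real^'N::{finite,linorder}^'N::{finite,linorder}"
    and e :: "'m::finite \<Rightarrow> 'N \<times> 'N"
    and f :: "'N \<Rightarrow> real^'n \<Rightarrow> real \<Rightarrow> real"
    and d :: "'N \<Rightarrow> real \<Rightarrow> real^'n"
    and \<phi> :: "'N \<Rightarrow> real^'n \<Rightarrow> real^'n"
    and X0 :: "'N \<Rightarrow> (real^'n) set"
    and \<theta>l \<theta>u :: "'N \<Rightarrow> real"
    and \<kappa> \<omega> \<delta> \<alpha> :: real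
    and \<Lambda> Z :: "real \<Rightarrow> (real^'n)^'N::{finite,linorder}"
  assumes graph: "connected_weighted_graph E A"
    and edges: "edge_enumeration E e"
    and theta_pos: "\<And>i. 0 < \<theta>l i" "\<And>i. 0 < \<theta>u i"
    and C2: "\<And>i t. 0 \<le> t \<Longrightarrow> twice_continuously_differentiable (\<lambda>x. f i x t)"
    and hessian_bounds: "\<And>i x t. 0 \<le> t \<Longrightarrow>
          loewner_le (mat (\<theta>l i)) (hessian (\<lambda>y. f i y t) x) \<and>
          loewner_le (hessian (\<lambda>y. f i y t) x) (mat (\<theta>u i))"
    and gradient_diff: "\<And>i x t. 0 \<le> t \<Longrightarrow> time_gradient (f i) x differentiable (at t within {0..})"
    and gradient_meas: "\<And>i x. time_deriv (time_gradient (f i) x) \<in> borel_measurable (lebesgue_on {0..})"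
    and gradient_cont: "\<And>i t. 0 \<le> t \<Longrightarrow> continuous_on UNIV (\<lambda>x. time_deriv (time_gradient (f i) x) t)"
    and kappa_pos: "0 < \<kappa>"
    and gradient_bound: "\<And>i x t. 0 \<le> t \<Longrightarrow> norm (time_deriv (time_gradient (f i) x) t) \<le> \<kappa>"
    and omega_pos: "0 < \<omega>"
    and similarity: "\<And>i j xi xj t. 0 \<le> t \<Longrightarrow>
          norm1 (matrix_inv (hessian (\<lambda>y. f i y t) xi) *v time_deriv (time_gradient (f i) xi) t
               - matrix_inv (hessian (\<lambda>y. f j y t) xj) *v time_deriv (time_gradient (f j) xj) t) \<le> \<omega>"
    and d_diff: "\<And>i t. 0 \<le> t \<Longrightarrow> d i differentiable (at t within {0..})"
    and delta_pos: "0 < \<delta>"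
    and d_bound: "\<And>i t. 0 \<le> t \<Longrightarrow> norm (time_deriv (d i) t) \<le> \<delta>"
    and phi_bounded: "\<And>i. locally_essentially_bounded (\<phi> i)"
    and phi_stable: "\<And>i. finite_time_stable (\<lambda>z. - \<phi> i z) (X0 i)"
    and gain: "\<alpha> > (\<kappa> / Min (range \<theta>l) + \<delta>) *
          sqrt (real CARD('N) * Max (range \<theta>u) /
            (Min (range \<theta>l) * least_positive_eigenvalue
              (transpose (extended_incidence A e) ** (extended_incidence A e :: real^('m \<times> 'n)^('N \<times> 'n)))))"
    and solution: "filippov_solution (protocol f d \<phi> A \<alpha>) (\<lambda>t. (\<Lambda> t, Z t))"
    and init: "\<And>i. Z 0 $ i = - time_gradient (local_dual (f i) (d i)) (\<Lambda> 0 $ i) 0"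
    and init_X0: "\<And>i. Z 0 $ i \<in> X0 i"
  shows "\<exists>Tz\<ge>0. (\<forall>i. vanishes_at (\<lambda>t. Z t $ i) Tz) \<and>
           (\<exists>T\<ge>Tz. \<forall>i.
              ((\<lambda>t. norm (primal_response (f i) (\<Lambda> t $ i) t - optimal_allocation f d t $ i))
                 \<longlongrightarrow> 0) (at T within {0..}))"
proof -
  define \<theta> where "\<theta> = Min (range \<theta>l)"
  define \<Theta> where "\<Theta> = Max (range \<theta>u)"
  have \<theta>: "0 < \<theta>" "\<theta> \<le> \<theta>l i" for i
    unfolding \<theta>_def using theta_pos(1) by (subst Min_gr_iff) auto
  have \<Theta>: "0 < \<Theta>" "\<theta>u i \<le> \<Theta>" for i
    unfolding \<Theta>_def using theta_pos(2) by (subst Max_gr_iff) auto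
  interpret protocol_run E A e f d \<phi> \<theta> \<Theta> \<kappa> \<delta> \<alpha> \<Lambda> Z
  proof (rule protocol_run.intro)
    fix i t assume t: "(0::real) \<le> t"
    fix x v :: "real^'n"
    show "v \<bullet> (hessian (\<lambda>y. f i y t) x *v v) \<le> \<Theta> * (norm v)\<^sup>2"
    proof -
      have "v \<bullet> (hessian (\<lambda>y. f i y t) x *v v) \<le> \<theta>u i * (norm v)\<^sup>2"
        using hessian_bounds[OF t, of i x] by (simp add: loewner_le_def power2_norm_eq_inner)
      also have "\<dots> \<le> \<Theta> * (norm v)\<^sup>2" using \<Theta>(2) by (intro mult_right_mono) auto
      finally show ?thesis .
    qed
  next
    fix i
    show "tracked_cost (f i) \<theta> \<kappa>"
    proof (rule tracked_cost.intro)
      fix t assume t: "(0::real) \<le> t"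
      show "strongly_convex_C2 (\<lambda>x. f i x t) \<theta>"
      proof (rule strongly_convex_C2.intro)
        fix x
        show "loewner_le (mat \<theta>) (hessian (\<lambda>x. f i x t) x)"
          unfolding loewner_le_def
        proof
          fix v :: "real^'n"
          have "\<theta> * (norm v)\<^sup>2 \<le> \<theta>l i * (norm v)\<^sup>2" using \<theta>(2) by (intro mult_right_mono) auto
          then show "v \<bullet> (mat \<theta> *v v) \<le> v \<bullet> (hessian (\<lambda>x. f i x t) x *v v)"
            using hessian_bounds[OF t, of i x] unfolding loewner_le_def
            by (simp add: power2_norm_eq_inner) (meson order_trans)
        qed
      qed (use \<theta> C2 t in auto)
    qed (use gradient_diff gradient_bound in auto)
  qed (use graph edges gradient_cont d_diff d_bound phi_bounded solution in auto)
  have "\<exists>T\<ge>0. vanishes_at (\<lambda>t. Z t $ i) T" for i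
    using phi_stable[of i] init_X0[of i] internal_state_filippov_solution[of i]
    unfolding finite_time_stable_def by blast
  then have "\<forall>i. \<exists>T\<ge>0. vanishes_at (\<lambda>t. Z t $ i) T" ..
  from choice[OF this[unfolded Bex_def]] obtain \<tau> where \<tau>: "\<And>i. 0 \<le> \<tau> i" "\<And>i. vanishes_at (\<lambda>t. Z t $ i) (\<tau> i)"
    by blast
  \<comment> \<open>The nodes settle at individual times; a later time serves equally well, so the
    largest is common to all.\<close>
  define Tz where "Tz = Max (range \<tau>)"
  have \<tau>Tz: "\<tau> i \<le> Tz" for i by (simp add: Tz_def)
  have Tz: "0 \<le> Tz" using \<tau>(1) \<tau>Tz order_trans by blast
  have van: "vanishes_at (\<lambda>t. Z t $ i) Tz" for i by (rule vanishes_at_mono[OF \<tau>(2) \<tau>Tz])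
  then have Z0: "Z t = 0" if "Tz \<le> t" for t using that by (simp add: vanishes_at_def vec_eq_iff[of "Z t"])
  note gain' = gain[folded \<theta>_def \<Theta>_def]
  obtain T where T: "Tz \<le> T" "\<And>t. T \<le> t \<Longrightarrow> disagreement t = 0"
    by (rule disagreement_vanishes[OF gain' kappa_pos delta_pos \<Theta>(1) Z0 Tz]) blast+
  have opt: "primal_response (f i) (\<Lambda> t $ i) t = optimal_allocation f d t $ i" if "T \<le> t" for i t
    by (rule allocation_optimal_of_consensus[OF init]) (use that T Tz Z0 in auto)
  \<comment> \<open>At \<open>T\<close> itself nothing is known about earlier times. The limit is
    taken at \<open>T + 1\<close>, around which the responses are optimal on both sides.\<close>
  have "((\<lambda>t. norm (primal_response (f i) (\<Lambda> t $ i) t - optimal_allocation f d t $ i)) \<longlongrightarrow> 0) (at (T + 1) within {0..})" for i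
  proof (rule Lim_transform_eventually[OF tendsto_const])
    have "\<forall>\<^sub>F t in at (T + 1) within {0..}. T < t"
      by (rule order_tendstoD(1)[OF tendsto_ident_at]) simp
    then show "\<forall>\<^sub>F t in at (T + 1) within {0..}.
        0 = norm (primal_response (f i) (\<Lambda> t $ i) t - optimal_allocation f d t $ i)"
      by eventually_elim (simp add: opt)
  qed
  moreover have "Tz \<le> T + 1" using T(1) by simp
  ultimately show ?thesis using Tz van by blast
qed

end
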